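(* Let $G$ be a reduced proper circular-arc graph that is not a proper interval graph, with $cc(G)\ge 3$, and let $v_1,\dots,v_n$ be a round ordering of $G$, with respect to which pseudo-cutvertices and weak blocks are defined. Then $G$ is locally complete 2-edge-colourable if and only if the following hold: (1) $G$ is perfect. (2) $G$ does not contain any of $F_1,F_2,F_3$ as an induced subgraph. (3) $G$ has an even number of pseudo-cutvertices. (4) Each weak block of $G$ is either complete or of type 4.
   Context: All graphs are simple. A 2-edge-colouring $E(G)\to\{1,2\}$ (not necessarily proper) is locally complete if for each vertex $v$ and each colour $c$, the vertices joined to $v$ by edges of colour $c$ induce a complete subgraph of $G$ (equivalently, there is no monochromatic induced path with two edges); $G$ is locally complete 2-edge-colourable if it has such a colouring. A graph is reduced if no two distinct vertices have the same closed neighbourhood. A proper interval (resp. proper circular-arc) graph is the intersection graph of a family of intervals on a line (resp. arcs on a circle), none properly contained in another. $cc(G)$ is the minimum number of cliques whose union covers $V(G)$. $F_1,F_2,F_3$ have vertex set $\{1,\dots,7\}$ and edges: $F_1$: $12,23,34,45,56,67,24,35,46$. $F_2$: $12,23,34,45,56,67,13,24,35,46,57$. $F_3$: $12,23,34,45,56,67,13,24,35,46,57,25,36$. Round ordering: a circular ordering $v_1,\dots,v_n$ of $V(G)$ such that for each $i$ there are $\ell,\gamma\ge0$ (depending on $i$) with $N[v_i]=\{v_{i-\ell},\dots,v_i,\dots,v_{i+\gamma}\}$ (indices modulo $n$) and both $\{v_{i-\ell},\dots,v_i\}$ and $\{v_i,\dots,v_{i+\gamma}\}$ are cliques. Every proper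 circular-arc graph has one. $G[i,j]$ denotes the subgraph of $G$ induced by the vertices $v_i,v_{i+1},\dots,v_j$ (going forward in the circular ordering from $v_i$ to $v_j$, indices modulo $n$). Pseudo-cutvertex: a vertex $v_i$ with $v_{i-1}$ not adjacent to $v_{i+1}$. Weak block: a subgraph $G[i,j]$ such that $v_i$ and $v_j$ are the only pseudo-cutvertices of $G$ contained in $G[i,j]$. Type 4: let $B$ be a 2-connected reduced proper interval graph with $k=cc(B)\ge2$ and straight ordering $w_1,\dots,w_m$ (i.e. a linear ordering of the vertices in which each closed neighbourhood $N[w]$ is a set of consecutive vertices; let $\ell(w)$ and $\gamma(w)$ be the first and last vertex of $N[w]$). Let $t_i$ be the largest integer such that the subgraph induced by $w_1,\dots,w_{t_i}$ has clique covering number $i$, and let $w_{s_i}=\ell(w_{t_i})$, $1\le i\le k$. $B$ is of type 4 if $t_i=s_{i+1}-1$ for all $1\le i\le k-1$ and, for each $2\le i\le k-1$, if $\gamma(w_{s_i-1})=w_a$ and $\ell(w_{t_i+1})=w_b$ then $a<b$.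
   Formalization: In (4), G[i,j] keeps only edges running forward within the arc (an edge v_i v_j going round the other side is dropped), and a weak block counts as type 4 if its reduction (one vertex per closed-neighbourhood class) is; read literally, (4) fails for some colourable G. *)

theory Defs
  imports Complex_Main
begin

type_synonym 'a graph = "'a set \<times> 'a set set"

abbreviation verts :: "'a graph \<Rightarrow> 'a set" where
  "verts G \<equiv> fst G"

abbreviation edges :: "'a graph \<Rightarrow> 'a set set" where
  "edges G \<equiv> snd G"

definition simple_graph :: "'a graph \<Rightarrow> bool" where
  "simple_graph G \<longleftrightarrow> finite (verts G) \<and> (\<forall>e\<in>edges G. e \<subseteq> verts G \<and> card e = 2)"

definition adj :: "'a graph \<Rightarrow> 'a \<Rightarrow> 'a \<Rightarrow> bool" where
  "adj G u v \<longleftrightarrow> {u, v} \<in> edges G"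

definition closed_nbhd :: "'a graph \<Rightarrow> 'a \<Rightarrow> 'a set" where
  "closed_nbhd G v = {u \<in> verts G. u = v \<or> adj G u v}"

definition induced_subgraph :: "'a graph \<Rightarrow> 'a set \<Rightarrow> 'a graph" where
  "induced_subgraph G U = (verts G \<inter> U, {e \<in> edges G. e \<subseteq> U})"

definition contains_induced :: "'a graph \<Rightarrow> 'b graph \<Rightarrow> bool" where
  "contains_induced G H \<longleftrightarrow>
     (\<exists>f. inj_on f (verts H) \<and> f ` verts H \<subseteq> verts G \<and>
          (\<forall>u\<in>verts H. \<forall>v\<in>verts H. adj H u v \<longleftrightarrow> adj G (f u) (f v)))"

definition clique :: "'a graph \<Rightarrow> 'a set \<Rightarrow> bool" where
  "clique G K \<longleftrightarrow> K \<subseteq> verts G \<and> (\<forall>u\<in>K. \<forall>v\<in>K. u \<noteq> v \<longrightarrow> adj G u v)"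

definition complete_graph :: "'a graph \<Rightarrow> bool" where
  "complete_graph G \<longleftrightarrow> clique G (verts G)"

definition clique_cover_number :: "'a graph \<Rightarrow> nat" where
  "clique_cover_number G =
     (LEAST k. \<exists>\<C>. finite \<C> \<and> card \<C> = k \<and> (\<forall>K\<in>\<C>. clique G K) \<and> \<Union>\<C> = verts G)"

definition clique_number :: "'a graph \<Rightarrow> nat" where
  "clique_number G = Max (card ` {K. clique G K})"

definition chromatic_number :: "'a graph \<Rightarrow> nat" where
  "chromatic_number G =
     (LEAST k. \<exists>f :: 'a \<Rightarrow> nat. (\<forall>v\<in>verts G. f v < k) \<and>
                (\<forall>u\<in>verts G. \<forall>v\<in>verts G. adj G u v \<longrightarrow> f u \<noteq> f v))"

definition perfect_graph :: "'a graph \<Rightarrow> bool" where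
  "perfect_graph G \<longleftrightarrow>
     (\<forall>U\<subseteq>verts G. chromatic_number (induced_subgraph G U) = clique_number (induced_subgraph G U))"

definition connected_graph :: "'a graph \<Rightarrow> bool" where
  "connected_graph G \<longleftrightarrow> (\<forall>u\<in>verts G. \<forall>v\<in>verts G. (u, v) \<in> {(x, y). adj G x y}\<^sup>*)"

definition two_connected :: "'a graph \<Rightarrow> bool" where
  "two_connected G \<longleftrightarrow> card (verts G) \<ge> 3 \<and> connected_graph G \<and>
     (\<forall>v\<in>verts G. connected_graph (induced_subgraph G (verts G - {v})))"

definition locally_complete_colouring :: "'a graph \<Rightarrow> ('a set \<Rightarrow> nat) \<Rightarrow> bool" where
  "locally_complete_colouring G c \<longleftrightarrow>
     (\<forall>e\<in>edges G. c e \<in> {1, 2}) \<and>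
     (\<forall>v\<in>verts G. \<forall>k\<in>{1, 2}.
        complete_graph (induced_subgraph G {u \<in> verts G. adj G v u \<and> c {v, u} = k}))"

definition locally_complete_2_edge_colourable :: "'a graph \<Rightarrow> bool" where
  "locally_complete_2_edge_colourable G \<longleftrightarrow> (\<exists>c. locally_complete_colouring G c)"

definition reduced :: "'a graph \<Rightarrow> bool" where
  "reduced G \<longleftrightarrow>
     (\<forall>u\<in>verts G. \<forall>v\<in>verts G. u \<noteq> v \<longrightarrow> closed_nbhd G u \<noteq> closed_nbhd G v)"

text \<open>\<open>H\<close> arises from \<open>G\<close> by keeping exactly one vertex of each class of vertices with the same
  closed neighbourhood; it is unique up to isomorphism, and it is \<open>G\<close> itself if \<open>G\<close> is reduced.\<close>

definition reduction_of :: "'a graph \<Rightarrow> 'a graph \<Rightarrow> bool" where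
  "reduction_of G H \<longleftrightarrow>
     (\<exists>R\<subseteq>verts G. (\<forall>u\<in>verts G. \<exists>!r. r \<in> R \<and> closed_nbhd G r = closed_nbhd G u) \<and>
        H = induced_subgraph G R)"

definition proper_intersection_rep :: "'a graph \<Rightarrow> ('a \<Rightarrow> 'b set) \<Rightarrow> bool" where
  "proper_intersection_rep G I \<longleftrightarrow>
     (\<forall>u\<in>verts G. \<forall>v\<in>verts G. u \<noteq> v \<longrightarrow> (adj G u v \<longleftrightarrow> I u \<inter> I v \<noteq> {})) \<and>
     (\<forall>u\<in>verts G. \<forall>v\<in>verts G. \<not> I u \<subset> I v)"

definition proper_interval_graph :: "'a graph \<Rightarrow> bool" where
  "proper_interval_graph G \<longleftrightarrow>
     (\<exists>l r :: 'a \<Rightarrow> real. (\<forall>v\<in>verts G. l v \<le> r v) \<and>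
        proper_intersection_rep G (\<lambda>v. {l v..r v}))"

definition proper_circular_arc_graph :: "'a graph \<Rightarrow> bool" where
  "proper_circular_arc_graph G \<longleftrightarrow>
     (\<exists>l r :: 'a \<Rightarrow> real. (\<forall>v\<in>verts G. l v \<le> r v) \<and>
        proper_intersection_rep G (\<lambda>v. cis ` {l v..r v}))"

definition F1 :: "nat graph" where
  "F1 = ({1..7}, {{1,2},{2,3},{3,4},{4,5},{5,6},{6,7},{2,4},{3,5},{4,6}})"

definition F2 :: "nat graph" where
  "F2 = ({1..7}, {{1,2},{2,3},{3,4},{4,5},{5,6},{6,7},{1,3},{2,4},{3,5},{4,6},{5,7}})"

definition F3 :: "nat graph" where
  "F3 = ({1..7}, {{1,2},{2,3},{3,4},{4,5},{5,6},{6,7},{1,3},{2,4},{3,5},{4,6},{5,7},{2,5},{3,6}})"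

text \<open>Indices modulo \<open>n\<close> are rendered by extending \<open>v 1, \<dots>, v n\<close> periodically to all integers.\<close>

definition round_ordering :: "'a graph \<Rightarrow> nat \<Rightarrow> (int \<Rightarrow> 'a) \<Rightarrow> bool" where
  "round_ordering G n v \<longleftrightarrow>
     bij_betw v {1..int n} (verts G) \<and> (\<forall>i. v (i + int n) = v i) \<and>
     (\<forall>i\<in>{1..int n}. \<exists>l \<gamma> :: nat.
        closed_nbhd G (v i) = v ` {i - int l..i + int \<gamma>} \<and>
        clique G (v ` {i - int l..i}) \<and> clique G (v ` {i..i + int \<gamma>}))"

definition pseudo_cutvertex :: "'a graph \<Rightarrow> (int \<Rightarrow> 'a) \<Rightarrow> 'a \<Rightarrow> bool" where
  "pseudo_cutvertex G v x \<longleftrightarrow> (\<exists>i. x = v i \<and> \<not> adj G (v (i - 1)) (v (i + 1)))"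

text \<open>\<open>arc_subgraph G v i j\<close> (for \<open>i \<le> j < i + n\<close>) is \<open>G[i,j]\<close>. In a round ordering every edge
  \<open>v a v b\<close> with \<open>a < b < a + n\<close> runs across a clique, either forward over \<open>v a, \<dots>, v b\<close> or
  over \<open>v b, \<dots>, v (a + n)\<close>; only edges running forward inside the arc are kept. When
  \<open>v i\<close> and \<open>v j\<close> are pseudo-cutvertices and the clique cover number is at least 3, this is
  the subgraph induced by \<open>v i, \<dots>, v j\<close>, except that the edge \<open>v i v j\<close> is left out if it runs
  around the other side. That only happens when \<open>v i\<close> and \<open>v j\<close> are the only pseudo-cutvertices
  and the other weak block is complete, and then the edge belongs to that other weak
  block. With it, the subgraph would contain an induced cycle of length at least 4, so it could
  not be a proper interval graph even where \<open>G\<close> is colourable: take \<open>w 1, \<dots>, w 6\<close> with the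
  triangles \<open>w 1 w 2 w 3\<close> and \<open>w 4 w 5 w 6\<close>, the edges \<open>w 2 w 4\<close>, \<open>w 3 w 4\<close>, \<open>w 3 w 5\<close>, \<open>w 1 w 6\<close>, and
  one more vertex adjacent to \<open>w 1\<close> and \<open>w 6\<close> only.\<close>

definition arc_subgraph :: "'a graph \<Rightarrow> (int \<Rightarrow> 'a) \<Rightarrow> int \<Rightarrow> int \<Rightarrow> 'a graph" where
  "arc_subgraph G v i j =
     (v ` {i..j}, {{v a, v b} | a b. i \<le> a \<and> a < b \<and> b \<le> j \<and> clique G (v ` {a..b})})"

definition weak_block :: "'a graph \<Rightarrow> nat \<Rightarrow> (int \<Rightarrow> 'a) \<Rightarrow> 'a graph \<Rightarrow> bool" where
  "weak_block G n v B \<longleftrightarrow>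
     (\<exists>i j. i \<le> j \<and> j < i + int n \<and> B = arc_subgraph G v i j \<and>
        {x \<in> verts B. pseudo_cutvertex G v x} = {v i, v j})"

definition straight_ordering :: "'a graph \<Rightarrow> nat \<Rightarrow> (nat \<Rightarrow> 'a) \<Rightarrow> bool" where
  "straight_ordering B m w \<longleftrightarrow>
     bij_betw w {1..m} (verts B) \<and>
     (\<forall>x\<in>verts B. \<exists>p q. 1 \<le> p \<and> q \<le> m \<and> closed_nbhd B x = w ` {p..q})"

definition first_nbr :: "'a graph \<Rightarrow> nat \<Rightarrow> (nat \<Rightarrow> 'a) \<Rightarrow> nat \<Rightarrow> nat" where
  "first_nbr B m w p = Min {q \<in> {1..m}. w q \<in> closed_nbhd B (w p)}"

definition last_nbr :: "'a graph \<Rightarrow> nat \<Rightarrow> (nat \<Rightarrow> 'a) \<Rightarrow> nat \<Rightarrow> nat" where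
  "last_nbr B m w p = Max {q \<in> {1..m}. w q \<in> closed_nbhd B (w p)}"

definition t_index :: "'a graph \<Rightarrow> nat \<Rightarrow> (nat \<Rightarrow> 'a) \<Rightarrow> nat \<Rightarrow> nat" where
  "t_index B m w i = Max {t \<in> {1..m}. clique_cover_number (induced_subgraph B (w ` {1..t})) = i}"

definition s_index :: "'a graph \<Rightarrow> nat \<Rightarrow> (nat \<Rightarrow> 'a) \<Rightarrow> nat \<Rightarrow> nat" where
  "s_index B m w i = first_nbr B m w (t_index B m w i)"

text \<open>The straight ordering of a connected reduced proper interval graph is unique up to
  reversal, and the conditions below are invariant under reversal.\<close>

definition type_4 :: "'a graph \<Rightarrow> bool" where
  "type_4 B \<longleftrightarrow>
     two_connected B \<and> reduced B \<and> proper_interval_graph B \<and> clique_cover_number B \<ge> 2 \<and>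
     (\<exists>m w. straight_ordering B m w \<and>
        (\<forall>i\<in>{1..clique_cover_number B - 1}. t_index B m w i = s_index B m w (i + 1) - 1) \<and>
        (\<forall>i\<in>{2..clique_cover_number B - 1}.
           last_nbr B m w (s_index B m w i - 1) < first_nbr B m w (t_index B m w i + 1)))"

text \<open>Type 4 is defined for reduced graphs, but a weak block of a reduced graph need not be reduced:
  an end of the block may have the same closed neighbourhood inside the block as an inner vertex
  and be told apart from it only by its neighbours outside the block. This occurs in colourable
  graphs (take the arcs \<open>v 1, \<dots>, v 9\<close> reaching forward over 1, 1, 1, 1, 2, 2, 2, 3, 2 further
  vertices), so such a block is classified by its reduction.\<close>

definition weak_block_of_type_4 :: "'a graph \<Rightarrow> bool" where
  "weak_block_of_type_4 B \<longleftrightarrow> (\<exists>H. reduction_of B H \<and> type_4 H)"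

end

theory Submission
  imports Defs
begin

text \<open>In a round ordering every vertex \<open>v i\<close> reaches forward over a clique \<open>v i, \<dots>, v (r i)\<close>, so that \<open>G\<close> is
  described by a monotone function \<open>r\<close> on the integers (with adjoint \<open>l\<close>, the backward reach). A
  colouring is locally complete iff consecutive edges \<open>x \<rightarrow> y \<rightarrow> z\<close> with \<open>r x < z\<close> alternate. Hence two
  adjacent vertices \<open>x < y\<close> with \<open>l x < l y\<close> and \<open>r x < r y\<close> see their forward edges in different
  colours, and odd cycles of this relation are excluded: they come from \<open>F1\<close> (for \<open>l (i - 1) = l i\<close>
  and \<open>r i = r (i + 1)\<close>), from \<open>F2\<close> (triangles) and from \<open>F3\<close> (for \<open>r (i - 1) = r i\<close> and
  \<open>l i = l (i + 1)\<close>). Their absence forces the vertices to be tiled by cliques each of whose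
  vertices sees at most one of the two neighbouring cliques, where the tiling restarts at
  every pseudo-cutvertex. Colouring the edges inside the cliques against the edges between them, and
  swapping the colours at every pseudo-cutvertex, is locally complete; and colouring the
  vertices of each clique from both ends shows that \<open>G\<close> is perfect. In a weak block
  the tiling is the greedy clique cover that defines type 4.

  Without pseudo-cutvertices the same local analysis applies to every vertex that has two
  non-adjacent non-neighbours. If no vertex has them, then \<open>G\<close> contains an odd antihole,
  and if only some have them, then \<open>G\<close> contains a cycle of length 5 or \<open>F2\<close> or \<open>F3\<close>.\<close>

section \<open>Reach functions\<close>

text \<open>Since \<open>G\<close> is reduced, the step from \<open>i\<close> to
  \<open>i + 1\<close> increases \<open>r\<close> or \<open>l\<close>. Lemma names use one letter
  per step: L if only \<open>l\<close> grows, R if only \<open>r\<close> grows, B if both grow. Away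
  from pseudo-cutvertices a tile reads as L steps followed by R steps, with at most one B step in
  between, and a B step leads to the next tile, which opens with an L step (\<open>type2\<close>).
  The obstacle is the other side of the circle: \<open>x \<rightarrow> y \<rightarrow> z\<close>
  with \<open>r x < z\<close> must alternate only if \<open>z\<close> is not joined to
  \<open>x\<close> around that side. Alternation always suffices for a colouring. Its necessity is
  proved from the existence of a pseudo-cutvertex, which no closed walk of three steps can jump
  over; without pseudo-cutvertices the tiling is derived, in both directions of the theorem, from
  the absence of odd antiholes and of \<open>F1\<close>, \<open>F2\<close>, \<open>F3\<close>. The
  bound on the clique cover number enters as \<open>two\<close>: two consecutive forward cliques
  always leave a vertex uncovered. Hence an edge runs forward in only one of the two directions
  around the circle.\<close>

locale reach =
  fixes r l :: "int \<Rightarrow> int"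
  assumes gal: "l j \<le> x \<longleftrightarrow> j \<le> r x"
    and gt: "i < r i"
    and red: "r i < r (i + 1) \<or> l i < l (i + 1)"
begin

lemma l_r: "l (r x) \<le> x"
  by (simp add: gal)

lemma r_l: "j \<le> r (l j)"
  using gal by blast

lemma r_mono: "x \<le> y \<Longrightarrow> r x \<le> r y"
  using gal l_r order_trans by blast

lemma l_mono: "x \<le> y \<Longrightarrow> l x \<le> l y"
  using gal r_l order_trans by blast

lemma l_lt: "l j < j"
  using gal[of j "j - 1"] gt[of "j - 1"] by simp

text \<open>Read as intervals \<open>{l x..r x}\<close>, the closed neighbourhoods of two adjacent
  vertices are incomparable under inclusion exactly in this case.\<close>

definition incomp :: "int \<Rightarrow> int \<Rightarrow> bool" where
  "incomp x y \<longleftrightarrow> x < y \<and> y \<le> r x \<and> l x < l y \<and> r x < r y"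

definition pseudo :: "int \<Rightarrow> bool" where
  "pseudo i \<longleftrightarrow> r (i - 1) = i"

lemma pseudo_r_le: "pseudo u \<Longrightarrow> x < u \<Longrightarrow> r x \<le> u"
  using r_mono[of x "u - 1"] by (simp add: pseudo_def)

lemma pseudo_l_ge: "pseudo u \<Longrightarrow> u < x \<Longrightarrow> u \<le> l x"
  using pseudo_r_le[of u "l x"] r_l[of x] by linarith

lemma nonpseudo_r: "\<not> pseudo i \<Longrightarrow> i + 1 \<le> r (i - 1)"
  using gt[of "i - 1"] by (simp add: pseudo_def)

lemma nonpseudo_l: "\<not> pseudo i \<Longrightarrow> l (i + 1) \<le> i - 1"
  using gal[of "i + 1" "i - 1"] nonpseudo_r[of i] by simp

text \<open>A B step followed by an L step: the place where a tile begins without a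
  pseudo-cutvertex.\<close>

definition type2 :: "int \<Rightarrow> bool" where
  "type2 s \<longleftrightarrow> r (s - 1) < r s \<and> l (s - 1) < l s \<and> r s = r (s + 1)"

definition start :: "int \<Rightarrow> bool" where
  "start s \<longleftrightarrow> pseudo s \<or> type2 s"

lemma const_between_l: "l a = l b \<Longrightarrow> a \<le> x \<Longrightarrow> x \<le> b \<Longrightarrow> l x = l a"
  using l_mono[of a x] l_mono[of x b] by linarith

end

text \<open>Each axiom excludes an odd cycle of \<open>incomp\<close>: a triangle, and two 5-cycles
  on \<open>l i\<close>, \<open>i - 1\<close>, \<open>i\<close>, \<open>i + 1\<close>,
  \<open>r i\<close>. In the last axiom the cycle exists only if \<open>r (l i) = r i\<close> fails,
  that is, if \<open>{l i..r i}\<close> is not a clique.\<close>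

locale good_reach = reach +
  assumes no_triangle: "\<lbrakk>incomp x y; incomp y z; z \<le> r x\<rbrakk> \<Longrightarrow> False"
    and no_RL: "\<lbrakk>\<not> pseudo i; l (i - 1) = l i; r i = r (i + 1)\<rbrakk> \<Longrightarrow> False"
    and LR_simplicial: "\<lbrakk>r (i - 1) = r i; l i = l (i + 1)\<rbrakk> \<Longrightarrow> r (l i) = r i"
begin

lemma triangle: "\<lbrakk>x < y; y < z; z \<le> r x; l x < l y; l y < l z; r x < r y; r y < r z\<rbrakk> \<Longrightarrow> False"
  using no_triangle[of x y z] r_mono[of x y] by (simp add: incomp_def)

lemma no_BB:
  assumes "\<not> pseudo i" "r (i - 1) < r i" "l (i - 1) < l i" "r i < r (i + 1)" "l i < l (i + 1)"
  shows False
  using triangle[of "i - 1" i "i + 1"] assms nonpseudo_r[of i] by simp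

lemma no_LBL:
  assumes "r (i - 1) = r i" "r i < r (i + 1)" "l i < l (i + 1)" "r (i + 1) = r (i + 2)"
    and np: "\<not> pseudo (i + 1)"
  shows False
proof -
  \<comment> \<open>The third vertex of the triangle is the earliest one that sees
    \<open>i + 1\<close>. It misses \<open>i + 2\<close>, which \<open>i\<close> sees, and therefore
    reaches less far than \<open>i\<close>.\<close>
  let ?c = "l (i + 1)"
  have 1: "l (i - 1) < l i" using red[of "i - 1"] assms(1) by simp
  have 2: "l (i + 1) < l (i + 2)" using red[of "i + 1"] assms(4) by (simp add: add.assoc)
  have r2: "i + 2 \<le> r i" using nonpseudo_r[OF np] by simp
  have c: "?c \<le> i - 1" using gal[of "i + 1" "i - 1"] assms(1) r2 by simp
  have rc: "r ?c < i + 2" using gal[of "i + 2" ?c] 2 by linarith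
  show False
  proof (rule triangle[of ?c i "i + 1"])
    show "l ?c < l i" using l_mono[OF c] 1 by simp
    show "i + 1 \<le> r ?c" by (rule r_l)
  qed (use c rc r2 assms in auto)
qed

lemma no_RBR:
  assumes "l (i - 1) = l i" "r i < r (i + 1)" "l i < l (i + 1)" "l (i + 1) = l (i + 2)"
    and np: "\<not> pseudo i"
  shows False
proof -
  \<comment> \<open>Mirror image of the choice in \<open>no_LBL\<close>: the last vertex seen from
    \<open>i\<close> misses \<open>i - 1\<close>, which \<open>i + 1\<close> sees.\<close>
  let ?c = "r i"
  have 1: "r (i - 1) < r i" using red[of "i - 1"] assms(1) by simp
  have 2: "r (i + 1) < r (i + 2)" using red[of "i + 1"] assms(4) by (simp add: add.assoc)
  have l2: "l (i + 1) \<le> i - 1" using nonpseudo_l[OF np] by simp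
  have c: "i + 2 \<le> ?c" using gal[of "i + 2" i] assms(4) l2 by simp
  have lc: "i - 1 < l ?c" using gal[of ?c "i - 1"] 1 by linarith
  show False
  proof (rule triangle[of i "i + 1" ?c])
    show "r (i + 1) < r ?c" using r_mono[OF c] 2 by simp
  qed (use c lc l2 assms in auto)
qed

lemma start_props:
  assumes "start s"
  shows "r (s - 1) < r s" "\<And>v. r (s - 1) < v \<Longrightarrow> v \<le> r s \<Longrightarrow> l v = s"
    "\<not> pseudo s \<Longrightarrow> r s = r (s + 1)"
proof -
  show 1: "r (s - 1) < r s"
    using assms gt[of s] by (auto simp: start_def pseudo_def type2_def)
  show "\<not> pseudo s \<Longrightarrow> r s = r (s + 1)"
    using assms by (auto simp: start_def type2_def)
  fix v assume v: "r (s - 1) < v" "v \<le> r s"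
  show "l v = s" using gal[of v "s - 1"] gal[of v s] v by linarith
qed

text \<open>The tile \<open>{s..t}\<close> with \<open>t = r s\<close> splits at \<open>m\<close>,
  the last vertex that does not reach \<open>t + 1\<close>. Up to \<open>m\<close> nothing beyond
  \<open>t\<close> is seen, and \<open>key\<close> says that after \<open>m\<close> nothing before
  \<open>s\<close> is seen. All five conclusions are read off from this split.\<close>

lemma start_step:
  assumes s: "start s" and np: "\<not> pseudo (r s)"
  shows "r (r s) < r (r s + 1)" "\<not> pseudo (r s + 1)" "type2 (r s + 1)" "r (r (s - 1)) \<le> r s"
    "\<And>u. s < u \<Longrightarrow> u \<le> r s \<Longrightarrow> \<not> start u"
proof -
  define t where "t = r s"
  have st: "s < t" using gt t_def by blast
  have lt: "l t = s" using start_props(2)[OF s, of t] start_props(1)[OF s] by (simp add: t_def)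
  have nps: "\<not> pseudo u" if "s < u" "u \<le> t" for u
    using pseudo_r_le[of u s] that np t_def by force
  define m where "m = l (t + 1) - 1"
  have rm: "r x = t" if "s \<le> x" "x \<le> m" for x
    using gal[of "t + 1" x] that r_mono[of s x] t_def by (auto simp: m_def)
  have rm1: "t < r x" if "m < x" for x
    using gal[of "t + 1" x] that by (simp add: m_def)
  have sm: "s \<le> m" using gal[of "t + 1" s] t_def by (simp add: m_def)
  have m2: "m + 2 \<le> t"
    using nonpseudo_l[of t] np by (simp add: m_def t_def)
  have lstep: "l x < l (x + 1)" if "s \<le> x" "x < m" for x
    using red[of x] rm[of x] rm[of "x + 1"] that by simp
  have ge: "l x \<le> s" if "x \<le> t" for x using l_mono[OF that] lt by simp
  have key: "r (s - 1) \<le> m"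
  proof (cases "pseudo s")
    case True then show ?thesis using sm by (simp add: pseudo_def)
  next
    case False
    show ?thesis
    proof (rule ccontr)
      assume c: "\<not> r (s - 1) \<le> m"
      have t2: "type2 s" using s False by (simp add: start_def)
      have ms: "s + 1 \<le> m" using rm1[of "s + 1"] t2 t_def sm by (force simp: type2_def)
      have lm1: "l (m + 1) \<le> s - 1" using gal[of "m + 1" "s - 1"] c by simp
      have rr: "r (s - 1) < t" using start_props(1)[OF s] t_def by simp
      have lm_less: "l m < l (m + 1)"
      proof (rule ccontr)
        assume "\<not> l m < l (m + 1)"
        then have eq: "l m = l (m + 1)" using l_mono[of m "m + 1"] by simp
        have "r (l m) = r m"
          using LR_simplicial[of m] eq rm[of m] rm[of "m - 1"] ms by simp
        then have "t \<le> r (s - 1)"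
          using r_mono[of "l m" "s - 1"] eq lm1 rm[of m] ms by simp
        then show False using rr by simp
      qed
      \<comment> \<open>The last vertex with the same first neighbour as \<open>m + 1\<close>. If
        the step after \<open>u\<close> is B, then \<open>m\<close>, \<open>u\<close>,
        \<open>u + 1\<close> form a triangle; if it is L, the word LBL arises when
        \<open>u = m + 1\<close>, and RL otherwise.\<close>
      define u where "u = r (l (m + 1)) "
      have um: "m + 1 \<le> u" by (simp add: u_def r_l)
      have ut: "u < t" using r_mono[OF lm1] rr by (simp add: u_def)
      have lu: "l u = l (m + 1)"
        using l_r[of "l (m + 1)"] l_mono[OF um] by (simp add: u_def)
      have lu1: "l u < l (u + 1)"
        using gal[of "u + 1" "l (m + 1)"] lu by (simp add: u_def)
      show False
      proof (cases "r u < r (u + 1)")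
        case True
        show False
        proof (rule triangle[of m u "u + 1"])
          show "l m < l u" using lm_less lu by simp
        qed (use True lu1 rm[of m] rm1[of u] ms um ut in auto)
      next
        case False
        then have req: "r u = r (u + 1)" using r_mono[of u "u + 1"] by simp
        show False
        proof (cases "u = m + 1")
          case True
          then show False
            using no_LBL[of m] rm[of m] rm[of "m - 1"] rm1[of "m + 1"] ms lm_less req nps[of "m + 1"] m2
            by (auto simp: add.assoc)
        next
          case False
          then have "l (u - 1) = l u"
            using const_between_l[of "m + 1" u "u - 1"] lu um by simp
          then show False
            using no_RL[of u] req nps[of u] um ut sm by simp
        qed
      qed
    qed
  qed
  have lR: "l v = s" if "m < v" "v \<le> t" for v
    using start_props(2)[OF s, of v] that key t_def by simp
  have rR: "r v < r (v + 1)" if "m < v" "v < t" for v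
    using red[of v] lR[of v] lR[of "v + 1"] that by simp
  have l1: "l (t + 1) = m + 1" by (simp add: m_def)
  have linc: "l t < l (t + 1)" using lt l1 sm by simp
  have leq: "l (t - 1) = l t" using lR[of "t - 1"] lR[of t] m2 by simp
  show B: "r (r s) < r (r s + 1)"
  proof (rule ccontr)
    assume "\<not> ?thesis"
    then have "r t = r (t + 1)" using r_mono[of t "t + 1"] by (simp add: t_def)
    then show False using no_RL[of t] leq np t_def by simp
  qed
  have "t + 1 \<le> r (t - 1)" using rm1[of "t - 1"] m2 by simp
  then have rt: "t + 2 \<le> r t" using rR[of "t - 1"] m2 by simp
  then show np1: "\<not> pseudo (r s + 1)" by (simp add: pseudo_def t_def)
  \<comment> \<open>The steps into and out of \<open>t\<close> are R and B, so the following step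
    cannot be R by \<open>no_RBR\<close> nor B by \<open>no_BB\<close>.\<close>
  have "r (t + 1) = r (t + 2)"
  proof (rule ccontr)
    assume a: "r (t + 1) \<noteq> r (t + 2)"
    then have ri: "r (t + 1) < r (t + 2)" using r_mono[of "t + 1" "t + 2"] by simp
    show False
    proof (cases "l (t + 1) = l (t + 2)")
      case True
      then show False using no_RBR[of t] leq B linc np t_def by simp
    next
      case False
      then have "l (t + 1) < l (t + 2)" using l_mono[of "t + 1" "t + 2"] by simp
      then show False using no_BB[of "t + 1"] ri np1 B linc t_def by (simp add: add.assoc)
    qed
  qed
  then show "type2 (r s + 1)"
    using B linc by (simp add: type2_def t_def add.assoc)
  show "r (r (s - 1)) \<le> r s"
  proof (cases "pseudo s")
    case True then show ?thesis by (simp add: pseudo_def)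
  next
    case False
    then have "s \<le> r (s - 1)" using gt[of "s - 1"] by simp
    then show ?thesis using rm[OF _ key] t_def by simp
  qed
  fix u assume u: "s < u" "u \<le> r s"
  show "\<not> start u"
  proof
    assume "start u"
    then have t2: "type2 u" using nps[of u] u t_def by (simp add: start_def)
    consider "u \<le> m" | "u = m + 1" | "m + 1 < u" by linarith
    then show False
    proof cases
      case 1 then show False using t2 rm[of u] rm[of "u - 1"] u by (simp add: type2_def)
    next
      case 2 then show False using t2 rR[of u] m2 by (simp add: type2_def)
    next
      case 3 then show False using t2 lR[of u] lR[of "u - 1"] u t_def by (simp add: type2_def)
    qed
  qed
qed

lemma start_end:
  assumes s: "start s" and p: "pseudo (r s)"
  shows "r (r (s - 1)) \<le> r s" "\<And>u. s < u \<Longrightarrow> u < r s \<Longrightarrow> \<not> start u"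
proof -
  show "r (r (s - 1)) \<le> r s"
    by (rule pseudo_r_le[OF p start_props(1)[OF s]])
  fix u assume u: "s < u" "u < r s"
  have "r x = r s" if "s \<le> x" "x < r s" for x
    using pseudo_r_le[OF p that(2)] r_mono[OF that(1)] by simp
  from this[of u] this[of "u - 1"] u have "r u = r s" "r (u - 1) = r s" by auto
  then show "\<not> start u" using u by (auto simp: start_def pseudo_def type2_def)
qed

text \<open>Move from a step that increases \<open>r\<close> to the last vertex \<open>u\<close>
  with the same first neighbour; by \<open>no_RL\<close> the step after \<open>u\<close> is B. If an
  L step follows, \<open>u + 1\<close> has type 2. Otherwise an R step follows,
  \<open>no_RBR\<close> forces \<open>u = i\<close>, and repeating the argument from that R step at
  \<open>i + 1\<close> cannot end in the same alternative.\<close>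

lemma type2_exists:
  assumes np: "\<And>i. \<not> pseudo i"
  shows "\<exists>s. type2 s"
proof -
  have *: "\<exists>u\<ge>i. type2 (u + 1) \<or> (u = i \<and> l i < l (i + 1) \<and> l (i + 1) = l (i + 2))"
    if i: "r i < r (i + 1)" for i
  proof -
    define u where "u = r (l i)"
    have ui: "i \<le> u" by (simp add: u_def r_l)
    have lu: "l u = l i" using l_r[of "l i"] l_mono[OF ui] by (simp add: u_def)
    have lu1: "l u < l (u + 1)" using gal[of "u + 1" "l i"] lu by (simp add: u_def)
    have prev: "l (u - 1) = l u" if "i < u"
      using const_between_l[of i u "u - 1"] lu that by simp
    have B: "r u < r (u + 1)"
    proof (cases "i < u")
      case True
      then show ?thesis using no_RL[of u] prev np r_mono[of u "u + 1"] by force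
    qed (use i ui in auto)
    show ?thesis
    proof (cases "r (u + 1) = r (u + 2)")
      case True
      then have "type2 (u + 1)" using B lu1 by (simp add: type2_def add.assoc)
      then show ?thesis using ui by blast
    next
      case False
      then have ri: "r (u + 1) < r (u + 2)" using r_mono[of "u + 1" "u + 2"] by simp
      have leq: "l (u + 1) = l (u + 2)"
        using no_BB[of "u + 1"] np B lu1 ri l_mono[of "u + 1" "u + 2"] by (force simp: add.assoc)
      then have "\<not> i < u" using no_RBR[of u] prev B lu1 np by force
      then have "u = i" using ui by simp
      then show ?thesis using lu1 leq by blast
    qed
  qed
  have ex: "\<exists>i. r i < r (i + 1)"
  proof -
    have "r (l (r 0 + 1) - 1) < r (l (r 0 + 1) - 1 + 1)"
      using gal[of "r 0 + 1" "l (r 0 + 1) - 1"] r_l[of "r 0 + 1"] by simp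
    then show ?thesis by blast
  qed
  then obtain i where i: "r i < r (i + 1)" by blast
  from *[OF i] show ?thesis
  proof (elim exE conjE disjE)
    assume R: "l (i + 1) = l (i + 2)"
    then have "r (i + 1) < r (i + 1 + 1)" using red[of "i + 1"] by (simp add: add.assoc)
    from *[OF this] R show ?thesis by (auto simp: add.assoc)
  qed blast
qed

end

section \<open>Local constraints forced by a colouring\<close>

locale coloured_reach = reach +
  fixes C :: "int \<Rightarrow> int \<Rightarrow> bool"
  assumes alternate: "\<lbrakk>x < y; y \<le> r x; r x < z; z \<le> r y\<rbrakk> \<Longrightarrow> C x y \<noteq> C y z"
begin

text \<open>The edge arriving from \<open>l x\<close> serves as a probe: as
  \<open>l x < l y\<close>, the vertex \<open>l x\<close> misses \<open>y\<close> and
  \<open>r x\<close>, so \<open>x \<rightarrow> y\<close> and \<open>x \<rightarrow> r x\<close>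
  both differ from \<open>l x \<rightarrow> x\<close> and have the same colour. The edge
  \<open>y \<rightarrow> r y\<close> differs from \<open>x \<rightarrow> y\<close>.\<close>

lemma incomp_colours:
  assumes "incomp x y"
  shows "C x (r x) \<noteq> C y (r y)"
proof -
  have xy: "x < y" "y \<le> r x" "l x < l y" "r x < r y" using assms by (auto simp: incomp_def)
  have a: "r (l x) < y" using gal[of y "l x"] xy by linarith
  have "C (l x) x \<noteq> C x y" "C (l x) x \<noteq> C x (r x)"
    using alternate[of "l x" x y] alternate[of "l x" x "r x"] l_lt[of x] r_l[of x] xy a by auto
  moreover have "C x y \<noteq> C y (r y)"
    using alternate[of x y "r y"] xy by auto
  ultimately show ?thesis by auto
qed

text \<open>By \<open>incomp_colours\<close> the colour of the edge from \<open>x\<close> to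
  \<open>r x\<close> is a proper 2-colouring of \<open>incomp\<close>, so exhibiting an odd cycle
  settles each axiom.\<close>

sublocale good_reach
proof
  fix x y z
  assume a: "incomp x y" "incomp y z" "z \<le> r x"
  then have "incomp x z" by (auto simp: incomp_def)
  then show False using a incomp_colours by blast
next
  fix i
  assume i: "\<not> pseudo i" "l (i - 1) = l i" "r i = r (i + 1)"
  let ?b = "l i" and ?y = "r i"
  have r1: "r (i - 1) < r i" using red[of "i - 1"] i by simp
  have l1: "l i < l (i + 1)" using red[of i] i by simp
  have rb: "r ?b \<le> i" using gal[of "i + 1" ?b] l1 by linarith
  have ib: "i \<le> r ?b" by (rule r_l)
  have p: "i + 1 \<le> r (i - 1)" by (rule nonpseudo_r[OF i(1)])
  have q: "l (i + 1) \<le> i - 1" by (rule nonpseudo_l[OF i(1)])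
  have ly: "i \<le> l ?y" using gal[of ?y "i - 1"] r1 by linarith
  \<comment> \<open>\<open>e0\<close> to \<open>e4\<close> are the edges of the 5-cycle
    \<open>l i\<close>, \<open>i\<close>, \<open>r i\<close>, \<open>i + 1\<close>,
    \<open>i - 1\<close>.\<close>
  have e0: "incomp ?b i"
    using l_lt[of i] l_lt[of ?b] ib rb p r1 by (auto simp: incomp_def)
  have e1: "incomp i ?y"
    using gt[of i] gt[of ?y] ly l_lt[of i] by (auto simp: incomp_def)
  have e2: "incomp (i + 1) ?y"
    using gt[of ?y] ly q p r1 i(3) by (auto simp: incomp_def)
  have e3: "incomp (i - 1) (i + 1)"
    using p l1 r1 i by (auto simp: incomp_def)
  have e4: "incomp ?b (i - 1)"
    using l_lt[of "i - 1"] l_lt[of ?b] ib rb p r1 i by (auto simp: incomp_def)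
  show False
    using e0[THEN incomp_colours] e1[THEN incomp_colours] e2[THEN incomp_colours]
      e3[THEN incomp_colours] e4[THEN incomp_colours] by argo
next
  fix i
  assume i: "r (i - 1) = r i" "l i = l (i + 1)"
  let ?b = "l i" and ?y = "r i"
  have r1: "r i < r (i + 1)" using red[of i] i by simp
  have l1: "l (i - 1) < l i" using red[of "i - 1"] i by simp
  have ib: "i \<le> r ?b" by (rule r_l)
  have ib1: "i + 1 \<le> r ?b" using gal[of "i + 1" ?b] i by simp
  have lb: "?b < i" "l ?b < ?b" by (rule l_lt)+
  show "r (l i) = r i"
  proof (rule ccontr)
    assume "r (l i) \<noteq> r i"
    then have rb: "r ?b < ?y" using r_mono[of ?b i] lb by simp
    have ly: "?b < l ?y" using gal[of ?y ?b] rb by linarith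
    \<comment> \<open>Here the 5-cycle is \<open>l i\<close>, \<open>i\<close>, \<open>r i\<close>,
      \<open>i - 1\<close>, \<open>i + 1\<close>.\<close>
    have e0: "incomp ?b i" using lb ib rb by (auto simp: incomp_def)
    have e1: "incomp i ?y" using gt[of i] gt[of ?y] ly by (auto simp: incomp_def)
    have e2: "incomp (i - 1) ?y"
      using gt[of i] gt[of ?y] ly l1 i by (auto simp: incomp_def)
    have e3: "incomp (i - 1) (i + 1)"
      using gt[of i] l1 r1 i by (auto simp: incomp_def)
    have e4: "incomp ?b (i + 1)"
      using ib1 lb rb r1 i by (auto simp: incomp_def)
    show False
      using e0[THEN incomp_colours] e1[THEN incomp_colours] e2[THEN incomp_colours]
        e3[THEN incomp_colours] e4[THEN incomp_colours] by argo
  qed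
qed

text \<open>Along \<open>s\<close>, \<open>t\<close>, \<open>y\<close>, \<open>t'\<close>,
  \<open>r t'\<close> the colours alternate, and \<open>s' \<rightarrow> t'\<close> also differs
  from the last edge. This makes four changes of colour between the longest edges
  \<open>s \<rightarrow> t\<close> and \<open>s' \<rightarrow> t'\<close> of consecutive
  tiles.\<close>

lemma start_colour_step:
  assumes s: "start s" and np: "\<not> pseudo (r s)"
  shows "C s (r s) = C (r s + 1) (r (r s + 1))"
proof -
  define t s' where "t = r s" and "s' = r s + 1"
  define t' where "t' = r s'"
  define y where "y = r t"
  note st = start_step[OF s np]
  have s': "start s'" using st(3) by (simp add: start_def s'_def)
  have st': "s < t" "t < y" "s' \<le> y" using gt[of s] gt[of t] by (auto simp: t_def y_def s'_def)
  have yt': "y < t'" using st(1) by (simp add: y_def t_def t'_def s'_def)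
  have ry: "t' \<le> r y" using r_mono[OF st'(3)] by (simp add: t'_def)
  have ry2: "r y \<le> t'"
    using start_step(4)[OF s'] start_end(1)[OF s'] by (cases "pseudo t'") (auto simp: y_def t_def t'_def s'_def)
  have z: "t' < r t'" by (rule gt)
  have "C s t \<noteq> C t y" using alternate[of s t y] st' t_def y_def by simp
  moreover have "C t y \<noteq> C y t'" using alternate[of t y t'] st' yt' ry y_def by simp
  moreover have "C y t' \<noteq> C t' (r t')" using alternate[of y t' "r t'"] yt' ry ry2 z by simp
  moreover have "C s' t' \<noteq> C t' (r t')"
    using alternate[of s' t' "r t'"] st' yt' z t'_def by simp
  ultimately show ?thesis by (auto simp: t_def s'_def t'_def)
qed

lemma start_colour_flip:
  assumes p: "pseudo (r s)"
  shows "C s (r s) \<noteq> C (r s) (r (r s))"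
  using alternate[of s "r s" "r (r s)"] gt by simp

text \<open>Induction from tile to tile: passing to the next tile keeps the colour, except that it
  is swapped where the tiles share a pseudo-cutvertex.\<close>

lemma start_colour_parity:
  assumes "start s" "start s'" "s \<le> s'"
  shows "C s (r s) = C s' (r s') \<longleftrightarrow> even (card {u. pseudo u \<and> s < u \<and> u \<le> s'})"
  using assms
proof (induction "nat (s' - s)" arbitrary: s rule: less_induct)
  case less
  show ?case
  proof (cases "s = s'")
    case True
    then have "{u. pseudo u \<and> s < u \<and> u \<le> s'} = {}" by auto
    then show ?thesis using True by (simp del: Collect_empty_eq)
  next
    case False
    then have ss: "s < s'" using less.prems by simp
    show ?thesis
    proof (cases "pseudo (r s)")
      case True
      have le: "r s \<le> s'"
        using start_end(2)[OF less.prems(1) True ss] less.prems(2) by force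
      have none: "\<not> pseudo u" if "s < u" "u < r s" for u
        using start_end(2)[OF less.prems(1) True that] by (simp add: start_def)
      have fin: "finite {u. pseudo u \<and> r s < u \<and> u \<le> s'}"
        by (rule finite_subset[of _ "{r s..s'}"]) auto
      have "{u. pseudo u \<and> s < u \<and> u \<le> s'} = insert (r s) {u. pseudo u \<and> r s < u \<and> u \<le> s'}"
        using none le True gt[of s] by force
      then have c: "card {u. pseudo u \<and> s < u \<and> u \<le> s'} = Suc (card {u. pseudo u \<and> r s < u \<and> u \<le> s'})"
        using fin by simp
      have "C (r s) (r (r s)) = C s' (r s') \<longleftrightarrow> even (card {u. pseudo u \<and> r s < u \<and> u \<le> s'})"
        by (rule less.hyps) (use le gt[of s] ss less.prems True in \<open>auto simp: start_def\<close>)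
      then show ?thesis using start_colour_flip[OF True] unfolding c by auto
    next
      case False
      note st = start_step[OF less.prems(1) False]
      have le: "r s + 1 \<le> s'"
        using st(5)[OF ss] less.prems(2) by force
      have none: "\<not> pseudo u" if "s < u" "u \<le> r s" for u
        using st(5)[OF that] by (simp add: start_def)
      have none2: "\<not> pseudo u" if "s < u" "u \<le> r s + 1" for u
        using none[of u] st(2) that by (cases "u = r s + 1") auto
      have "{u. pseudo u \<and> s < u \<and> u \<le> s'} = {u. pseudo u \<and> r s + 1 < u \<and> u \<le> s'}"
        using none2 gt[of s] by force
      moreover have "C (r s + 1) (r (r s + 1)) = C s' (r s') \<longleftrightarrow>
          even (card {u. pseudo u \<and> r s + 1 < u \<and> u \<le> s'})"
        by (rule less.hyps) (use le gt[of s] ss less.prems st(3) in \<open>auto simp: start_def\<close>)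
      ultimately show ?thesis using start_colour_step[OF less.prems(1) False] by simp
    qed
  qed
qed

end

section \<open>Tilings by cliques, and the edge and vertex colourings they give\<close>

text \<open>The structure that decides the theorem: the members of \<open>S\<close> are the first vertices of
  cliques \<open>{s..r s}\<close> that tile the line, two neighbouring ones overlapping exactly in the
  pseudo-cutvertices. By \<open>S_reach\<close> no vertex of such a clique sees both of its neighbouring cliques.\<close>

locale clique_chain = reach +
  fixes S :: "int set"
  assumes pseudo_S: "pseudo u \<Longrightarrow> u \<in> S"
    and S_reach: "s \<in> S \<Longrightarrow> r (r (s - 1)) \<le> r s"
    and S_less: "s \<in> S \<Longrightarrow> r (s - 1) < r s"
    and S_next: "s \<in> S \<Longrightarrow> \<not> pseudo (r s) \<Longrightarrow> r s + 1 \<in> S \<and> \<not> pseudo (r s + 1)"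
    and S_disjoint: "s \<in> S \<Longrightarrow> s' \<in> S \<Longrightarrow> s < s' \<Longrightarrow> r s < s' \<or> (s' = r s \<and> pseudo s')"
    and S_below: "\<exists>s\<in>S. s \<le> x"
begin

text \<open>The start of the tile of \<open>x\<close>. A pseudo-cutvertex lies in two tiles and is
  assigned to the later one, which it starts itself (\<open>base_pseudo\<close>).\<close>

definition base :: "int \<Rightarrow> int" where
  "base x = (SOME s. s \<in> S \<and> s \<le> x \<and> (\<forall>s'\<in>S. s' \<le> x \<longrightarrow> s' \<le> s))"

lemma base_props: "base x \<in> S" "base x \<le> x" "s' \<in> S \<Longrightarrow> s' \<le> x \<Longrightarrow> s' \<le> base x"
proof -
  obtain s0 where s0: "s0 \<in> S" "s0 \<le> x" using S_below by blast
  let ?A = "{s \<in> S. s0 \<le> s \<and> s \<le> x}"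
  have fin: "finite ?A" by (rule finite_subset[of _ "{s0..x}"]) auto
  have ne: "?A \<noteq> {}" using s0 by auto
  have "Max ?A \<in> ?A" by (rule Max_in[OF fin ne])
  moreover have "\<forall>s'\<in>S. s' \<le> x \<longrightarrow> s' \<le> Max ?A"
  proof (intro ballI impI)
    fix s' assume s': "s' \<in> S" "s' \<le> x"
    show "s' \<le> Max ?A"
    proof (cases "s0 \<le> s'")
      case True then show ?thesis using Max_ge[OF fin, of s'] s' by simp
    next
      case False then show ?thesis using \<open>Max ?A \<in> ?A\<close> by simp
    qed
  qed
  ultimately have "\<exists>s. s \<in> S \<and> s \<le> x \<and> (\<forall>s'\<in>S. s' \<le> x \<longrightarrow> s' \<le> s)" by blast
  then have *: "base x \<in> S \<and> base x \<le> x \<and> (\<forall>s'\<in>S. s' \<le> x \<longrightarrow> s' \<le> base x)"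
    unfolding base_def by (rule someI_ex)
  show "base x \<in> S" "base x \<le> x" "s' \<in> S \<Longrightarrow> s' \<le> x \<Longrightarrow> s' \<le> base x" using * by auto
qed

lemma baseI: "s \<in> S \<Longrightarrow> s \<le> x \<Longrightarrow> (\<And>s'. s' \<in> S \<Longrightarrow> s' \<le> x \<Longrightarrow> s' \<le> s) \<Longrightarrow> base x = s"
  by (rule order_antisym) (simp_all add: base_props)

lemma base_pseudo: "pseudo y \<Longrightarrow> base y = y"
  by (rule baseI) (auto simp: pseudo_S)

lemma le_r_base: "x \<le> r (base x)" "pseudo (r (base x)) \<Longrightarrow> x < r (base x)"
proof -
  have *: "r (base x) \<in> S" if "pseudo (r (base x))" using that by (rule pseudo_S)
  show 2: "x < r (base x)" if "pseudo (r (base x))"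
    using base_props(3)[OF *, of x] that gt[of "base x"] by force
  show "x \<le> r (base x)"
  proof (cases "pseudo (r (base x))")
    case False
    then have "r (base x) + 1 \<in> S" using S_next base_props(1) by blast
    then show ?thesis using base_props(3)[of "r (base x) + 1" x] gt[of "base x"] by force
  qed (use 2 in force)
qed

lemma base_same:
  assumes "base x \<le> y" "y \<le> r (base x)" "\<not> pseudo y"
  shows "base y = base x"
proof (rule baseI)
  fix s' assume s': "s' \<in> S" "s' \<le> y"
  show "s' \<le> base x"
  proof (rule ccontr)
    assume "\<not> s' \<le> base x"
    then have "r (base x) < s' \<or> (s' = r (base x) \<and> pseudo s')"
      using S_disjoint[OF base_props(1) s'(1)] by simp
    then show False using assms s' by auto
  qed
qed (use assms base_props in auto)

text \<open>If the tile of \<open>x\<close> ended before \<open>y\<close>, the next tile would start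
  strictly before \<open>y\<close> and, by \<open>S_less\<close>, reach beyond \<open>y\<close>. No
  vertex before a pseudo-cutvertex does that.\<close>

lemma edge_to_pseudo:
  assumes "x < y" "y \<le> r x" "pseudo y"
  shows "r (base x) = y"
proof -
  let ?t = "r (base x)"
  have le: "?t \<le> y" using pseudo_r_le[OF assms(3)] assms(1) base_props(2)[of x] by simp
  show ?thesis
  proof (rule ccontr)
    assume "?t \<noteq> y"
    then have ty: "?t < y" using le by simp
    have xt: "x \<le> ?t" by (rule le_r_base)
    have np: "\<not> pseudo ?t"
    proof
      assume p: "pseudo ?t"
      have "r x \<le> ?t" using pseudo_r_le[OF p] le_r_base(2)[OF p] by simp
      then show False using assms ty by simp
    qed
    have S': "?t + 1 \<in> S" "\<not> pseudo (?t + 1)" using S_next[OF base_props(1) np] by auto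
    then have "?t + 1 < y" using ty assms(3) by (cases "?t + 1 = y") auto
    then have "r (?t + 1) \<le> y" by (rule pseudo_r_le[OF assms(3)])
    moreover have "r ?t < r (?t + 1)" using S_less[OF S'(1)] by simp
    moreover have "y \<le> r ?t" using r_mono[OF xt] assms(2) by simp
    ultimately show False by simp
  qed
qed

lemma cross_edge:
  assumes "x < y" "y \<le> r x" "\<not> pseudo y" "r (base x) < y"
  shows "base y = r (base x) + 1" "y \<le> r (base y - 1)" "y < r (base y)" "\<not> pseudo (r (base x))"
proof -
  let ?t = "r (base x)"
  have xt: "x \<le> ?t" by (rule le_r_base)
  show np: "\<not> pseudo ?t"
  proof
    assume p: "pseudo ?t"
    have "r x \<le> ?t" using pseudo_r_le[OF p] le_r_base(2)[OF p] by simp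
    then show False using assms by simp
  qed
  have S': "?t + 1 \<in> S" using S_next[OF base_props(1) np] by auto
  have yt: "y \<le> r ?t" using r_mono[OF xt] assms(2) by simp
  have yt': "y < r (?t + 1)" using S_less[OF S'] yt by simp
  show b: "base y = ?t + 1"
  proof (rule baseI)
    fix s' assume s': "s' \<in> S" "s' \<le> y"
    show "s' \<le> ?t + 1" using S_disjoint[OF S' s'(1)] yt' s'(2) by force
  qed (use S' assms in auto)
  show "y \<le> r (base y - 1)" "y < r (base y)" using yt yt' b by auto
qed

text \<open>If \<open>y\<close> shares the tile of \<open>x\<close>, then \<open>z\<close> lies
  beyond \<open>r x\<close> and hence outside this tile. If \<open>y\<close> lies in the next tile,
  it is seen from the previous one, so \<open>S_reach\<close> keeps its forward neighbours inside
  its own tile.\<close>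

lemma chain_alternates:
  assumes "x < y" "y \<le> r x" "r x < z" "z \<le> r y" "\<not> pseudo y"
  shows "y \<le> r (base x) \<longleftrightarrow> \<not> z \<le> r (base y)"
proof (cases "y \<le> r (base x)")
  case True
  have "base x \<le> y" using base_props(2)[of x] assms(1) by linarith
  from base_same[OF this True assms(5)] have "base y = base x" .
  then show ?thesis using True r_mono[OF base_props(2)[of x]] assms by simp
next
  case False
  then have c: "base y = r (base x) + 1" "y \<le> r (base y - 1)"
    using cross_edge[of x y] assms by auto
  have "r y \<le> r (base y)"
    using r_mono[OF c(2)] S_reach[OF base_props(1)[of y]] by simp
  then show ?thesis using False assms by simp
qed

lemma chain_pseudo:
  assumes "x < y" "y \<le> r x" "z \<le> r y" "pseudo y"
  shows "y \<le> r (base x)" "z \<le> r (base y)"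
  using edge_to_pseudo[OF assms(1,2,4)] base_pseudo[OF assms(4)] assms(3) by simp_all

text \<open>\<open>par\<close> is the parity of the number of pseudo-cutvertices passed so far. It
  is kept abstract because only an even number per turn provides a version of it that is
  periodic.\<close>

context
  fixes par :: "int \<Rightarrow> bool"
  assumes par: "par i \<longleftrightarrow> par (i - 1) \<noteq> pseudo i"
begin

lemma par_const: "x \<le> y \<Longrightarrow> (\<And>u. x < u \<Longrightarrow> u \<le> y \<Longrightarrow> \<not> pseudo u) \<Longrightarrow> par y = par x"
proof (induction y rule: int_ge_induct)
  case (step y)
  then show ?case using par[of "y + 1"] by simp
qed simp

lemma par_edge:
  assumes "x < y" "y \<le> r x"
  shows "par y = (par x \<noteq> pseudo y)"
proof -
  have "\<not> pseudo u" if "x < u" "u \<le> y - 1" for u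
    using pseudo_r_le[of u x] that assms by linarith
  then have "par (y - 1) = par x" using par_const[of x "y - 1"] assms(1) by simp
  then show ?thesis using par[of y] by simp
qed

definition edge_colour :: "int \<Rightarrow> int \<Rightarrow> bool" where
  "edge_colour x y \<longleftrightarrow> (y \<le> r (base x)) \<noteq> par x"

lemma edge_colour_alternates:
  assumes "x < y" "y \<le> r x" "r x < z" "z \<le> r y"
  shows "edge_colour x y \<noteq> edge_colour y z"
  using chain_alternates[OF assms] chain_pseudo[OF assms(1,2,4)] par_edge[OF assms(1,2)]
  by (auto simp: edge_colour_def)

context
  fixes U :: "int set" and w :: int
  assumes cl: "\<And>x y. x \<le> y \<Longrightarrow> y \<le> r x \<Longrightarrow> int (card (U \<inter> {x..y})) \<le> w"
begin

text \<open>\<open>U\<close> stands for the vertices of an induced subgraph and \<open>w\<close> for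
  its clique number. Vertices that see nothing beyond their tile are numbered upwards from its
  start; the others are numbered downwards from \<open>w - 1\<close>, beginning at the end of the
  tile.\<close>

definition level :: "int \<Rightarrow> int" where
  "level y = (if r y \<le> r (base y) then int (card (U \<inter> {base y..<y}))
     else w - 1 - int (card (U \<inter> {y<..r (base y)})))"

text \<open>A pseudo-cutvertex has level 0 in the tile it starts. Reversing the palette there gives
  it the opposite extreme, level \<open>w - 1\<close>, from the point of view of the tile that it
  closes.\<close>

definition vertex_colour :: "int \<Rightarrow> int" where
  "vertex_colour y = (if par y then level y else w - 1 - level y)"

lemma card_split:
  assumes "a \<le> x" "x \<le> b" "x \<in> U"
  shows "int (card (U \<inter> {a..b})) = int (card (U \<inter> {a..<x})) + 1 + int (card (U \<inter> {x<..b}))"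
proof -
  have "U \<inter> {a..b} = (U \<inter> {a..<x}) \<union> insert x (U \<inter> {x<..b})" using assms by auto
  moreover have "card ((U \<inter> {a..<x}) \<union> insert x (U \<inter> {x<..b})) =
      card (U \<inter> {a..<x}) + card (insert x (U \<inter> {x<..b}))"
    by (rule card_Un_disjoint) auto
  moreover have "card (insert x (U \<inter> {x<..b})) = Suc (card (U \<inter> {x<..b}))"
    by (rule card_insert_disjoint) auto
  ultimately show ?thesis by simp
qed

lemma card_mono_int: "A \<subseteq> B \<Longrightarrow> finite B \<Longrightarrow> int (card (U \<inter> A)) \<le> int (card (U \<inter> B))"
  using card_mono[of "U \<inter> B" "U \<inter> A"] by auto

lemma level_range:
  assumes "y \<in> U"
  shows "0 \<le> level y" "level y < w"
proof -
  have "int (card (U \<inter> {base y..r (base y)})) \<le> w"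
    using cl[of "base y" "r (base y)"] gt[of "base y"] by simp
  then show "0 \<le> level y" "level y < w"
    using card_split[of "base y" y "r (base y)"] assms base_props(2)[of y] le_r_base(1)[of y]
    by (auto simp: level_def)
qed

lemma vertex_colour_range: "y \<in> U \<Longrightarrow> 0 \<le> vertex_colour y \<and> vertex_colour y < w"
  using level_range[of y] by (auto simp: vertex_colour_def)

lemma vertex_colour_proper:
  assumes x: "x \<in> U" and y: "y \<in> U" and xy: "x < y" "y \<le> r x"
  shows "vertex_colour x \<noteq> vertex_colour y"
proof -
  let ?s = "base x" and ?t = "r (base x)"
  have bx: "?s \<le> x" "x \<le> ?t" using base_props(2) le_r_base(1) by auto
  have clq: "int (card (U \<inter> {?s..?t})) \<le> w" using cl[of ?s ?t] gt[of ?s] by simp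
  have sx: "int (card (U \<inter> {?s..?t})) = int (card (U \<inter> {?s..<x})) + 1 + int (card (U \<inter> {x<..?t}))"
    by (rule card_split[OF bx x])
  show ?thesis
  proof (cases "pseudo y")
    case True
    have t: "?t = y" by (rule edge_to_pseudo[OF xy True])
    have "r x \<le> y" by (rule pseudo_r_le[OF True xy(1)])
    then have lx: "level x = int (card (U \<inter> {?s..<x}))" using t by (simp add: level_def)
    have ly: "level y = 0" using base_pseudo[OF True] by (simp add: level_def)
    have "1 \<le> int (card (U \<inter> {x<..?t}))"
      using card_mono_int[of "{y}" "{x<..?t}"] y xy t by simp
    then have "level x < w - 1" using clq sx lx by simp
    then show ?thesis using ly par_edge[OF xy] True by (auto simp: vertex_colour_def)
  next
    case False
    have p: "par y = par x" using par_edge[OF xy] False by simp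
    have "level x \<noteq> level y"
    proof (cases "y \<le> ?t")
      case True
      have b: "base y = ?s" by (rule base_same) (use bx xy True False in auto)
      have sy: "int (card (U \<inter> {?s..?t})) = int (card (U \<inter> {?s..<y})) + 1 + int (card (U \<inter> {y<..?t}))"
        by (rule card_split) (use bx xy True y in auto)
      have "int (card (U \<inter> {?s..x})) = int (card (U \<inter> {?s..<x})) + 1 + int (card (U \<inter> {x<..x}))"
        by (rule card_split) (use bx x in auto)
      moreover have "{?s..x} \<subseteq> {?s..<y}" using xy by auto
      ultimately have up: "int (card (U \<inter> {?s..<x})) < int (card (U \<inter> {?s..<y}))"
        using card_mono_int[of "{?s..x}" "{?s..<y}"] by simp
      have mono: "r x \<le> r y" using r_mono xy by simp
      show ?thesis using sx sy up clq mono b by (auto simp: level_def)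
    next
      case False
      then have c: "base y = ?t + 1" "y \<le> r (base y - 1)"
        using cross_edge[OF xy \<open>\<not> pseudo y\<close>] by auto
      have "r y \<le> r (base y)"
        using r_mono[OF c(2)] S_reach[OF base_props(1)[of y]] by simp
      then have ly: "level y = int (card (U \<inter> {?t + 1..<y}))" using c by (simp add: level_def)
      have lx: "level x = w - 1 - int (card (U \<inter> {x<..?t}))" using xy False by (simp add: level_def)
      have *: "int (card (U \<inter> {x..y})) = int (card (U \<inter> {x..<y})) + 1 + int (card (U \<inter> {y<..y}))"
        by (rule card_split) (use xy y in auto)
      have **: "int (card (U \<inter> {x..y-1})) = int (card (U \<inter> {x..<x})) + 1 + int (card (U \<inter> {x<..y-1}))"
        by (rule card_split) (use xy x in auto)
      have e: "{x..y-1} = {x..<y}" by auto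
      have "U \<inter> {x<..y-1} = (U \<inter> {x<..?t}) \<union> (U \<inter> {?t+1..<y})" using bx False by auto
      moreover have "card ((U \<inter> {x<..?t}) \<union> (U \<inter> {?t+1..<y})) =
          card (U \<inter> {x<..?t}) + card (U \<inter> {?t+1..<y})"
        by (rule card_Un_disjoint) auto
      ultimately have "int (card (U \<inter> {x..y})) =
          2 + int (card (U \<inter> {x<..?t})) + int (card (U \<inter> {?t+1..<y}))"
        using * ** e by simp
      \<comment> \<open>The clique \<open>{x..y}\<close> consists of \<open>x\<close>,
        \<open>y\<close> and the two counted segments, so the number counted upwards for
        \<open>y\<close> stays below the one counted downwards for \<open>x\<close>.\<close>
      then show ?thesis using cl[of x y] xy lx ly by simp
    qed
    then show ?thesis using p by (auto simp: vertex_colour_def)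
  qed
qed

end
end
end

lemma (in good_reach) clique_chain_start:
  assumes "\<And>x. \<exists>s\<le>x. start s"
  shows "clique_chain r l {s. start s}"
proof
  fix s s' x :: int
  show "pseudo s \<Longrightarrow> s \<in> {s. start s}" by (simp add: start_def)
  show "\<exists>s\<in>{s. start s}. s \<le> x" using assms by blast
  assume s: "s \<in> {s. start s}"
  show "r (r (s - 1)) \<le> r s"
    using start_step(4) start_end(1) s by (cases "pseudo (r s)") auto
  show "r (s - 1) < r s" using start_props(1) s by blast
  show "\<not> pseudo (r s) \<Longrightarrow> r s + 1 \<in> {s. start s} \<and> \<not> pseudo (r s + 1)"
    using start_step(2,3) s by (auto simp: start_def)
  assume "s' \<in> {s. start s}" "s < s'"
  then show "r s < s' \<or> (s' = r s \<and> pseudo s')"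
    using start_step(5)[of s s'] start_end(2)[of s s'] s
    by (cases "pseudo (r s)") force+
qed

text \<open>The witness is the parity of the number of members in \<open>{1..i mod n}\<close>. The
  count drops back to 0 at multiples of \<open>n\<close>, which the even total makes invisible
  modulo 2.\<close>

lemma periodic_parity:
  fixes P :: "int \<Rightarrow> bool"
  assumes n: "0 < n" and per: "\<And>i. P (i + n) = P i" and ev: "even (card {i \<in> {1..n}. P i})"
  shows "\<exists>par. (\<forall>i. par i \<longleftrightarrow> par (i - 1) \<noteq> P i) \<and> (\<forall>i. par (i + n) = par i)"
proof (intro exI conjI allI)
  let ?c = "\<lambda>k. card {j \<in> {1..k}. P j}"
  have pm: "P (i mod n) = P i" for i
  proof -
    have "P (a + int k * n) = P a" for a k
    proof (induction k)
      case (Suc k)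
      then show ?case using per[of "a + int k * n"] by (simp add: algebra_simps)
    qed simp
    note nat = this
    have "P (a + k * n) = P a" for a k
    proof (cases "0 \<le> k")
      case True then show ?thesis using nat[of a "nat k"] by simp
    next
      case False then show ?thesis using nat[of "a + k * n" "nat (- k)"] by simp
    qed
    from this[of "i mod n" "i div n"] show ?thesis by (simp add: mult.commute)
  qed
  have modm: "(a + n * q) mod n = a" if "0 \<le> a" "a < n" for a q
    using that by simp
  have suc: "?c (k + 1) = ?c k + (if P (k + 1) then 1 else 0)" if "0 \<le> k" for k
  proof -
    have "{j \<in> {1..k+1}. P j} = (if P (k + 1) then insert (k + 1) {j \<in> {1..k}. P j} else {j \<in> {1..k}. P j})"
      using that by (auto simp: le_less)
    moreover have "card (insert (k + 1) {j \<in> {1..k}. P j}) = Suc (?c k)"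
      by (rule card_insert_disjoint) (auto intro: finite_subset[of _ "{1..k}"])
    ultimately show ?thesis by (simp del: Collect_conj_eq)
  qed
  fix i
  show "odd (?c (i mod n)) \<longleftrightarrow> odd (?c ((i - 1) mod n)) \<noteq> P i"
  proof (cases "i mod n = 0")
    case True
    then have "i = n * (i div n)" using mult_div_mod_eq[of n i] by simp
    then have e0: "i - 1 = n - 1 + n * (i div n - 1)" by (simp add: algebra_simps)
    have "(i - 1) mod n = n - 1"
      by (subst e0, rule modm) (use n in auto)
    moreover have "P i = P n" using pm[of i] pm[of n] True n by simp
    moreover have "?c n = ?c (n - 1) + (if P n then 1 else 0)" using suc[of "n - 1"] n by simp
    ultimately show ?thesis using True ev by (auto split: if_splits)
  next
    case False
    then have pos: "0 < i mod n" using pos_mod_sign[OF n, of i] by linarith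
    have e0: "i - 1 = i mod n - 1 + n * (i div n)" using mult_div_mod_eq[of n i] by simp
    have e: "(i - 1) mod n = i mod n - 1"
      by (subst e0, rule modm) (use n pos pos_mod_bound[OF n, of i] in auto)
    have "?c (i mod n) = ?c (i mod n - 1) + (if P (i mod n) then 1 else 0)"
      using suc[of "i mod n - 1"] pos by simp
    then show ?thesis using e pm[of i] by auto
  qed
next
  show "odd (card {j \<in> {1..(i + n) mod n}. P j}) = odd (card {j \<in> {1..i mod n}. P j})" for i
    by simp
qed

section \<open>Reach functions on the circle\<close>

locale circ_reach = reach +
  fixes n :: int
  assumes n_pos: "0 < n"
    and r_per: "r (i + n) = r i + n"
    and two: "r (r i + 1) + 1 < i + n"
begin

lemma r_per': "r (i - n) = r i - n"
  using r_per[of "i - n"] by simp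

lemma l_per: "l (i + n) = l i + n"
proof (rule order_antisym)
  show "l (i + n) \<le> l i + n" using gal[of "i + n" "l i + n"] r_per[of "l i"] r_l[of i] by simp
  show "l i + n \<le> l (i + n)" using gal[of i "l (i + n) - n"] r_per' r_l[of "i + n"] by simp
qed

lemma pseudo_per: "pseudo (i + n) = pseudo i"
  using r_per[of "i - 1"] by (simp add: pseudo_def algebra_simps)

lemma type2_per: "type2 (i + n) = type2 i"
  using r_per[of "i - 1"] r_per[of i] r_per[of "i + 1"] l_per[of "i - 1"] l_per[of i]
  by (simp add: type2_def algebra_simps)

lemma start_per: "start (i + n) = start i"
  by (simp add: start_def pseudo_per type2_per)

text \<open>The first later vertex not reached from \<open>i\<close>. Iterating \<open>R\<close>
  therefore walks along non-edges.\<close>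

definition R :: "int \<Rightarrow> int" where "R i = r i + 1"

lemma R_per: "R (i + n) = R i + n" by (simp add: R_def r_per)
lemma R_per': "R (i - n) = R i - n" by (simp add: R_def r_per')
lemma R_mono: "x \<le> y \<Longrightarrow> R x \<le> R y" by (simp add: R_def r_mono)
lemma two_R: "R (R i) < i + n" using two[of i] by (simp add: R_def)

text \<open>Then \<open>i\<close>, \<open>R i\<close>, \<open>R (R i)\<close> are pairwise
  non-adjacent around the circle: \<open>i\<close> has two non-adjacent non-neighbours, found
  greedily. That \<open>R i\<close> misses \<open>i + n\<close> is already part of
  \<open>two_R\<close>.\<close>

definition free :: "int \<Rightarrow> bool" where
  "free i \<longleftrightarrow> R (R (R i)) \<le> i + n"

lemma free_per: "free (i + n) = free i" unfolding free_def R_per by linarith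

lemma free_R: "free i \<Longrightarrow> free (R i)"
  using R_mono[of "R (R (R i))" "i + n"] by (simp add: free_def R_per)

lemma free_mono: "free i \<Longrightarrow> i \<le> k \<Longrightarrow> R k = R i \<Longrightarrow> free k"
  by (simp add: free_def)

lemma free_indep: "free i \<Longrightarrow> r (r i + 1) < l i - 1 + n"
  using gal[of "i + n" "R (R i)"] l_per[of i] by (simp add: free_def R_def)

text \<open>Two steps along non-edges, brought back by one turn. By \<open>two_R\<close> this always
  moves backwards, which gives the descent in the search for an antihole.\<close>

definition D :: "int \<Rightarrow> int" where "D i = R (R i) - n"

lemma D_less: "D i < i" using two_R[of i] by (simp add: D_def)

lemma R_D: "R (D i) = D (R i)" by (simp add: D_def R_per')

lemma R_D_pow: "R ((D ^^ k) i) = (D ^^ k) (R i)"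
  by (induction k) (simp_all add: R_D)

lemma D_pow_le: "(D ^^ k) i \<le> i - int k"
proof (induction k)
  case (Suc k)
  then show ?case using D_less[of "(D ^^ k) i"] by simp
qed simp

lemma D_pow_less: "i < k \<Longrightarrow> (D ^^ k) x < (D ^^ i) x"
proof -
  assume "i < k"
  then obtain d where "k = i + Suc d" using less_iff_Suc_add by auto
  then have "(D ^^ k) x = (D ^^ Suc d) ((D ^^ i) x)" by (simp only: funpow_add[symmetric] comp_def add.commute) (metis add.commute comp_apply funpow_add)
  then show ?thesis using D_pow_le[of "Suc d" "(D ^^ i) x"] by simp
qed

definition circ_adj :: "int \<Rightarrow> int \<Rightarrow> bool" where
  "circ_adj x y \<longleftrightarrow> (x < y \<and> (y \<le> r x \<or> x + n \<le> r y)) \<or> (y < x \<and> (x \<le> r y \<or> y + n \<le> r x))"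

lemma circ_adj_R: "x < y \<Longrightarrow> circ_adj x y \<longleftrightarrow> y < R x \<or> x + n < R y"
  "y < x \<Longrightarrow> circ_adj x y \<longleftrightarrow> x < R y \<or> y + n < R x"
  by (auto simp: circ_adj_def R_def)

text \<open>Alternating \<open>R\<close> and \<open>R - n\<close> yields two interleaved descending sequences of consecutive
  non-neighbours; the first time they meet they close up to an odd cycle of the complement,
  which is induced if its length is minimal.\<close>

lemma antihole_exists:
  assumes nf: "\<And>i. \<not> free i"
  shows "\<exists>(j::nat) g lo. 2 \<le> j \<and> (\<forall>p\<le>2*j. lo \<le> g p \<and> g p < lo + n) \<and>
    (\<forall>p q. p < q \<longrightarrow> q \<le> 2*j \<longrightarrow> g p \<noteq> g q \<and>
       (circ_adj (g p) (g q) \<longleftrightarrow> q \<noteq> p + 1 \<and> \<not> (p = 0 \<and> q = 2*j)))"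
proof -
  define P where "P k \<longleftrightarrow> (\<exists>x. R ((D ^^ k) x) \<le> x)" for k
  have "P (nat (R 0))"
    using D_pow_le[of "nat (R 0)" "R 0"] gt[of 0] unfolding P_def R_D_pow
    by (intro exI[of _ 0]) (simp add: R_def)
  define j where "j = (LEAST k. P k)"
  have Pj: "P j" unfolding j_def by (rule LeastI) fact
  then obtain x where x: "R ((D ^^ j) x) \<le> x" unfolding P_def by blast
  have min: "y < R ((D ^^ k) y)" if "k < j" for k y
  proof -
    have "\<not> P k" using not_less_Least[of k P] that by (simp add: j_def)
    then have "\<not> R ((D ^^ k) y) \<le> y" unfolding P_def by blast
    then show ?thesis by simp
  qed
  have j0: "j \<noteq> 0"
  proof
    assume "j = 0"
    then show False using x gt[of x] by (simp add: R_def)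
  qed
  \<comment> \<open>For \<open>j = 1\<close> the cycle of non-edges would be a triangle of non-edges
    through \<open>x\<close>, making \<open>x\<close> free.\<close>
  have j1: "j \<noteq> 1"
  proof
    assume "j = 1"
    then have "R (D x) \<le> x" using x by simp
    then have "free x" by (simp add: free_def D_def R_per')
    then show False using nf by simp
  qed
  have j2: "2 \<le> j" using j0 j1 by simp
  define a b where "a i = (D ^^ i) x" and "b i = R (a i)" for i
  have b': "b i = (D ^^ i) (R x)" for i by (simp add: a_def b_def R_D_pow)
  have Rb: "R (b i) = a (Suc i) + n" for i by (simp add: a_def b_def D_def)
  have add: "(D ^^ (k + d)) y = (D ^^ d) ((D ^^ k) y)" for k d y
    by (simp add: funpow_add funpow_swap1 add.commute[of k])
  have adec: "i < k \<Longrightarrow> a k < a i" for i k by (simp add: a_def D_pow_less)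
  have bdec: "i < k \<Longrightarrow> b k < b i" for i k by (simp add: b' D_pow_less)
  have aa: "a k < b i" if "k \<le> i" "i - k < j" for i k
    using min[of "i - k" "a k"] add[of k "i - k" x] that by (simp add: a_def b_def)
  have bb: "b k < a (Suc i) + n" if "k \<le> i" "i - k < j" for i k
    using min[of "i - k" "b k"] add[of k "i - k" "R x"] that by (simp add: b' Rb[symmetric])
  have bx: "x < b k" if "k < j" for k using aa[of 0 k] that by (simp add: a_def)
  have ax: "a i \<le> x" for i using adec[of 0 i] by (cases "i = 0") (auto simp: a_def)
  have b0: "b 0 < a j + n" using bb[of 0 "j - 1"] j2 by simp
  have bj: "b j \<le> a 0" using x by (simp add: a_def b_def)
  have bb0: "b k \<le> b 0" for k using bdec[of 0 k] by (cases "k = 0") auto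
  have aaj: "a j \<le> a k" if "k \<le> j" for k using adec[of k j] that by (cases "k = j") auto
  have adj_aa: "circ_adj (a k) (a i) \<longleftrightarrow> \<not> (k = 0 \<and> i = j)" if "k < i" "i \<le> j" for i k
  proof (cases "k = 0 \<and> i = j")
    case True
    then show ?thesis using circ_adj_R(2)[OF adec[OF that(1)]] bj b0 by (simp add: b_def)
  next
    case False
    then have "i - k < j" using that by auto
    then show ?thesis using circ_adj_R(2)[OF adec[OF that(1)]] aa[of k i] that False by (simp add: b_def)
  qed
  have adj_bb: "circ_adj (b k) (b i)" if "k < i" "i < j" for i k
    using circ_adj_R(2)[OF bdec[OF that(1)]] bb[of k i] that by (simp add: Rb)
  have ab: "a i < b k" if "k < j" for i k using ax[of i] bx[OF that] by simp
  have adj_ab: "circ_adj (a i) (b k) \<longleftrightarrow> i \<noteq> k \<and> i \<noteq> Suc k" if "k < j" for i k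
  proof -
    have "b k < b i \<longleftrightarrow> i < k" using bdec[of i k] bdec[of k i] by (cases i k rule: linorder_cases) auto
    moreover have "a i < a (Suc k) \<longleftrightarrow> Suc k < i"
      using adec[of i "Suc k"] adec[of "Suc k" i] by (cases i "Suc k" rule: linorder_cases) auto
    ultimately show ?thesis
      using circ_adj_R(1)[OF ab[OF that, of i]] by (auto simp: b_def[symmetric] Rb)
  qed
  have sym: "circ_adj u v = circ_adj v u" for u v by (auto simp: circ_adj_def)
  define g where "g p = (if even p then a (p div 2) else b (p div 2))" for p
  have win: "a j \<le> g p \<and> g p < a j + n" if "p \<le> 2 * j" for p
  proof (cases "even p")
    case True
    then have "p div 2 \<le> j" using that by simp
    then show ?thesis using aaj[of "p div 2"] ax[of "p div 2"] bx[of 0] b0 j2 True by (simp add: g_def)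
  next
    case False
    then have "p div 2 < j" using that by (auto elim!: oddE)
    then show ?thesis using ab[of "p div 2" j] bb0[of "p div 2"] b0 False by (simp add: g_def)
  qed
  have "g p \<noteq> g q \<and> (circ_adj (g p) (g q) \<longleftrightarrow> q \<noteq> p + 1 \<and> \<not> (p = 0 \<and> q = 2*j))"
    if pq: "p < q" "q \<le> 2 * j" for p q
  proof (cases "even p")
    case p: True
    then obtain i where i: "p = 2 * i" by (auto elim: evenE)
    show ?thesis
    proof (cases "even q")
      case True
      then obtain k where k: "q = 2 * k" by (auto elim: evenE)
      then show ?thesis using adj_aa[of i k] adec[of i k] pq i by (auto simp: g_def)
    next
      case False
      then obtain k where k: "q = 2 * k + 1" by (auto elim: oddE)
      then have "q \<noteq> 2 * j" by presburger
      then show ?thesis using adj_ab[of k i] ab[of k i] pq i k by (auto simp: g_def)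
    qed
  next
    case p: False
    then obtain i where i: "p = 2 * i + 1" by (auto elim: oddE)
    show ?thesis
    proof (cases "even q")
      case True
      then obtain k where k: "q = 2 * k" by (auto elim: evenE)
      then show ?thesis using adj_ab[of i k] ab[of i k] pq i sym[of "a k" "b i"] by (auto simp: g_def)
    next
      case False
      then obtain k where k: "q = 2 * k + 1" by (auto elim: oddE)
      then show ?thesis using adj_bb[of i k] bdec[of i k] pq i by (auto simp: g_def)
    qed
  qed
  then show ?thesis
    using j2 win by (intro exI[of _ j] exI[of _ g] exI[of _ "a j"] conjI allI impI) simp_all
qed

end

text \<open>\<open>step2\<close> expresses that there is no pseudo-cutvertex. Of the forbidden
  patterns only the extremal edges and non-edges are listed, as the remaining ones follow from the
  monotonicity of \<open>r\<close>. For \<open>F1\<close>, \<open>F2\<close>, \<open>F3\<close> the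
  last inequality keeps the seven vertices from meeting around the circle.\<close>

locale pseudo_free = circ_reach +
  assumes step2: "i + 2 \<le> r i"
    and noC5: "\<lbrakk>x1 < x2; x2 \<le> r x1; r x1 < x3; x3 \<le> r x2; r x2 < x4; x4 \<le> r x3; r x3 < x5;
       x5 \<le> r x4; r x4 < x1 + n; x1 + n \<le> r x5; r x5 < x2 + n\<rbrakk> \<Longrightarrow> False"
    and noF1: "\<lbrakk>p1 < p2; p2 \<le> r p1; r p1 < p3; p3 < p4; p4 \<le> r p2; r p2 < p5; p5 \<le> r p3; r p3 < p6;
       p6 \<le> r p4; r p5 < p7; p7 \<le> r p6; r p7 < p1 + n\<rbrakk> \<Longrightarrow> False"
    and noF2: "\<lbrakk>p1 < p2; p2 < p3; p3 \<le> r p1; r p1 < p4; p4 \<le> r p2; r p2 < p5; p5 \<le> r p3; r p3 < p6;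
       p6 \<le> r p4; r p4 < p7; p7 \<le> r p5; r p7 < p1 + n\<rbrakk> \<Longrightarrow> False"
    and noF3: "\<lbrakk>p1 < p2; p2 < p3; p3 \<le> r p1; r p1 < p4; p4 < p5; p5 \<le> r p2; r p2 < p6; p6 \<le> r p3;
       r p4 < p7; p7 \<le> r p5; r p7 < p1 + n\<rbrakk> \<Longrightarrow> False"
begin

text \<open>The triangle is completed to \<open>F2\<close> by vertices just outside the reaches
  involved. The outermost two, \<open>l y - 1\<close> and \<open>r y + 1\<close>, flank the
  neighbourhood of \<open>y\<close>, and freeness of \<open>y\<close> makes them non-adjacent around
  the circle.\<close>

lemma free_triangle:
  assumes f: "free y" and xy: "incomp x y" and yz: "incomp y z" and xz: "z \<le> r x"
  shows False
proof (rule noF2[of "l y - 1" "l z - 1" x y z "r x + 1" "r y + 1"])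
  have lz: "l z \<le> x" using gal xz by simp
  show "x \<le> r (l y - 1)" using gal[of x "l y - 1"] xy by (simp add: incomp_def)
  show "r (l y - 1) < y" using gal[of y "l y - 1"] by linarith
  show "y \<le> r (l z - 1)" using gal[of y "l z - 1"] yz by (simp add: incomp_def)
  show "r (l z - 1) < z" using gal[of z "l z - 1"] by linarith
  show "r (r y + 1) < l y - 1 + n" by (rule free_indep[OF f])
qed (use xy yz xz gal[of z x] in \<open>auto simp: incomp_def\<close>)

text \<open>The failure of the conclusion supplies the sixth vertex of \<open>F3\<close>:
  \<open>r (l i) + 1\<close> is missed by \<open>l i\<close> but seen by
  \<open>i - 1\<close>.\<close>

lemma free_LR:
  assumes f: "free i" and i: "r (i - 1) = r i" "l i = l (i + 1)"
  shows "r (l i) = r i"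
proof (rule ccontr)
  assume "r (l i) \<noteq> r i"
  then have ns: "r (l i) < r i" using r_mono[of "l i" i] l_lt[of i] by simp
  have r1: "r i < r (i + 1)" using red[of i] i by simp
  have l1: "l (i - 1) < l i" using red[of "i - 1"] i by simp
  have "l i \<noteq> i - 1" using ns i by auto
  then have l2: "l i < i - 1" using l_lt[of i] by simp
  show False
  proof (rule noF3[of "l i - 1" "l i" "i - 1" i "i + 1" "r (l i) + 1" "r i + 1"])
    show "i - 1 \<le> r (l i - 1)" using gal[of "i - 1" "l i - 1"] l1 by simp
    show "r (l i - 1) < i" using gal[of i "l i - 1"] by linarith
    show "i + 1 \<le> r (l i)" using gal[of "i + 1" "l i"] i by simp
    show "r (r i + 1) < l i - 1 + n" by (rule free_indep[OF f])
  qed (use l2 ns r1 i in auto)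
qed

text \<open>The pendant vertices 1 and 7 of \<open>F1\<close> are \<open>l i - 1\<close> and
  \<open>r i + 1\<close>, attached to \<open>l i\<close> and \<open>r i\<close>.\<close>

lemma free_RL:
  assumes f: "free i" and i: "l (i - 1) = l i" "r i = r (i + 1)"
  shows False
proof (rule noF1[of "l i - 1" "l i" "i - 1" i "i + 1" "r i" "r i + 1"])
  show "l i \<le> r (l i - 1)" using gt[of "l i - 1"] by simp
  show "r (l i - 1) < i - 1" using gal[of "i - 1" "l i - 1"] i by linarith
  show "i \<le> r (l i)" by (rule r_l)
  show "r (l i) < i + 1" using gal[of "i + 1" "l i"] red[of i] i by linarith
  show "i + 1 \<le> r (i - 1)" using step2[of "i - 1"] by simp
  show "r (i - 1) < r i" using red[of "i - 1"] i by simp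
  show "r i + 1 \<le> r (r i)" using gt[of "r i"] by simp
  show "r (r i + 1) < l i - 1 + n" by (rule free_indep[OF f])
qed (use i in auto)

text \<open>With \<open>w = l t\<close>, the claim \<open>const\<close> turns the step after
  \<open>w\<close> into an L step. The step before \<open>w - 1\<close> is L as well, so the word
  around the free vertex \<open>w - 1\<close> is LRL or LBL; \<open>free_LR\<close> excludes one and
  \<open>free_triangle\<close> the other.\<close>

lemma free_apex:
  assumes ft: "free t" and fw: "free (l t - 1)" and rw: "r (l t - 1) = t - 1"
    and tw: "t + 1 \<le> r (l t)" and rw2: "r (l t - 2) = r (l t - 1)"
  shows False
proof -
  define w where "w = l t"
  have lt1: "l (t + 1) = w" using gal[of "t + 1" w] tw l_mono[of t "t + 1"] by (simp add: w_def)
  have rt1: "r t < r (t + 1)" using red[of t] lt1 by (simp add: w_def)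
  have wt: "w + 1 \<le> t - 1" using step2[of "w - 1"] rw by (simp add: w_def)
  have const: "r u = r w" if u: "w \<le> u" "u \<le> t - 1" for u
  proof (rule ccontr)
    assume "r u \<noteq> r w"
    then have ru: "r w < r u" using r_mono[OF u(1)] by simp
    have tru: "t + 1 < r u" using tw ru by (simp add: w_def)
    have lu: "l u < w" using gal[of u "w - 1"] rw u by (simp add: w_def)
    show False
    proof (cases "r u < r t")
      case True
      have "incomp u t" using u tru lu True by (auto simp: incomp_def w_def)
      moreover have "incomp t (r u)"
        using tru True gal[of "r u" w] ru rt1 r_mono[of "t + 1" "r u"] by (auto simp: incomp_def w_def)
      ultimately show False using free_triangle[OF ft] by blast
    next
      case False
      then have "r (t - 1) = r t" using r_mono[of u "t - 1"] r_mono[of "t - 1" t] u by simp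
      then have "r (l t) = r t" using free_LR[OF ft] lt1 by (simp add: w_def)
      then show False using ru r_mono[of u t] u by (simp add: w_def)
    qed
  qed
  have rww: "r w = r (w + 1)" using const[of "w + 1"] wt by simp
  have lww: "l w < l (w + 1)" using red[of w] rww by simp
  have r1: "r (w - 2) = t - 1" "r (w - 1) = t - 1" using rw rw2 by (simp_all add: w_def)
  have l1: "l (w - 2) < l (w - 1)" using red[of "w - 2"] r1 by (simp add: add.commute)
  have f: "free (w - 1)" using fw by (simp add: w_def)
  have rinc: "r (w - 1) < r w" using r1 tw by (simp add: w_def)
  show False
  proof (cases "l (w - 1) = l w")
    case True
    have s: "r (l (w - 1)) = r (w - 1)"
      using free_LR[OF f] r1 True by simp
    let ?c = "l (w + 1) - 1"
    have "r ?c < w + 1" using gal[of "w + 1" ?c] by linarith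
    moreover have "r (l (w - 1)) \<le> r ?c" using lww True by (intro r_mono) simp
    ultimately show False using s r1 wt by simp
  next
    case False
    then have lw: "l (w - 1) < l w" using l_mono[of "w - 1" w] by simp
    have c: "l w \<le> w - 2" using gal[of w "w - 2"] r1 wt by simp
    have rc: "r (l w) < w + 1" using gal[of "w + 1" "l w"] lww by linarith
    have "l (l w) < l (w - 1)" using l_mono[OF c] l1 by simp
    then have "incomp (l w) (w - 1)"
      using c rc r_l[of w] r1 wt by (auto simp: incomp_def)
    moreover have "incomp (w - 1) w" using lw rinc r1 wt by (auto simp: incomp_def)
    ultimately show False using free_triangle[OF f] r_l[of w] by blast
  qed
qed

text \<open>If freeness ended at \<open>x\<close>, the greedy sequences from \<open>x\<close> and
  \<open>x + 1\<close> would interleave as \<open>y < y' \<le> z < z' \<le> x + n\<close>, where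
  \<open>z\<close> misses \<open>x + n\<close> but \<open>z'\<close> reaches
  \<open>x + 1 + n\<close>. This tight interleaving leaves either an induced 5-cycle or the
  situation of \<open>free_apex\<close>.\<close>

lemma free_step:
  assumes fx: "free x"
  shows "free (x + 1)"
proof (rule ccontr)
  assume nf: "\<not> free (x + 1)"
  define y z y' z' where "y = R x" and "z = R y" and "y' = R (x + 1)" and "z' = R y'"
  define w where "w = l z'"
  have fy: "free y" and fz: "free z" using fx free_R by (auto simp: y_def z_def)
  have rz: "r z < x + n" using fx by (simp add: free_def y_def z_def R_def)
  have rz': "x + 1 + n \<le> r z'" using nf by (simp add: free_def y'_def z'_def R_def)
  have defs: "r x = y - 1" "r y = z - 1" "r (x + 1) = y' - 1" "r y' = z' - 1"
    by (simp_all add: y_def z_def y'_def z'_def R_def)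
  have zz': "z < z'" using r_mono[of z' z] rz rz' by linarith
  have yy': "y < y'" using r_mono[of x "x + 1"] defs zz' by (cases "y = y'") auto
  have xy: "x + 3 \<le> y" using step2[of x] defs by simp
  have y'z: "y' \<le> z" using r_mono[of "x + 1" y] defs xy by simp
  have z'x: "z' \<le> x + n" using r_mono[OF y'z] rz defs by simp
  have rz'y: "r z' < y + n" using r_mono[OF z'x] r_per[of x] defs by simp
  have lz': "r (w - 1) < z'" using gal[of z' "w - 1"] by (simp add: w_def)
  have rw: "z' \<le> r w" by (simp add: w_def r_l)
  \<comment> \<open>All vertices from \<open>y'\<close> to \<open>w - 1\<close> stop just before
    \<open>z'\<close>, so \<open>free_apex\<close> applies with \<open>t = z'\<close>.\<close>
  have apex: False if zw: "z \<le> w - 1" and rw2: "x + 1 + n \<le> r w" and two: "y' \<le> w - 2"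
  proof -
    have e: "r u = z' - 1" if "y' \<le> u" "u \<le> w - 1" for u
      using r_mono[OF that(1)] r_mono[OF that(2)] lz' defs by simp
    have "R z = z'" using e[OF y'z zw] by (simp add: R_def)
    then have f: "free z'" using free_R[OF fz] by simp
    have "free (w - 1)"
      by (rule free_mono[OF fz zw]) (use e[of z] e[of "w - 1"] y'z zw in \<open>simp add: R_def\<close>)
    then show False
      using free_apex[OF f] e[of "w - 1"] e[of "w - 2"] two rw2 z'x by (simp add: w_def)
  qed
  show False
  proof (cases "y' < z")
    case True
    \<comment> \<open>Otherwise \<open>x + 1\<close>, \<open>y\<close>, \<open>y'\<close>,
      \<open>u\<close>, \<open>z'\<close> is an induced 5-cycle.\<close>
    have star: "r u < z'" if "z \<le> u" "r u \<le> x + n" for u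
    proof (rule ccontr)
      assume c: "\<not> r u < z'"
      have ub: "u < z'" using r_mono[of z' u] that rz' by linarith
      show False
        by (rule noC5[of "x + 1" y y' u z'])
          (use that c defs rz' rz'y xy yy' True y'z r_mono[of z u] r_mono[of y' u] ub in auto)
    qed
    have "r z < z'" using star[of z] rz by simp
    then have zw: "z \<le> w - 1" using gal[of z' z] by (simp add: w_def)
    have "x + 1 + n \<le> r w" using star[of w] zw rw by force
    then show False using apex zw True by simp
  next
    case False
    then have eq: "y' = z" using y'z by simp
    \<comment> \<open>When \<open>y'\<close> and \<open>z\<close> coincide, \<open>v0\<close>, the
      first vertex that sees \<open>z\<close>, takes over: all vertices from \<open>x + 1\<close> to
      \<open>v0 - 1\<close> stop just before \<open>z\<close>.\<close>
    define v0 where "v0 = l z"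
    have rv1: "r (v0 - 1) < z" using gal[of z "v0 - 1"] by (simp add: v0_def)
    have rv0: "z \<le> r v0" by (simp add: v0_def r_l)
    have yv: "y < v0" using gal[of z y] defs by (simp add: v0_def)
    have vz: "v0 < z" by (simp add: v0_def l_lt)
    have e: "r u = z - 1" if "x + 1 \<le> u" "u \<le> v0 - 1" for u
      using r_mono[OF that(1)] r_mono[OF that(2)] rv1 defs eq by simp
    show False
    proof (cases "z + 1 \<le> r v0")
      case True
      have "free (v0 - 1)"
        by (rule free_mono[OF fy]) (use e[of y] e[of "v0 - 1"] yv xy in \<open>auto simp: R_def\<close>)
      then show False
        using free_apex[OF fz] e[of "v0 - 1"] e[of "v0 - 2"] True yv xy by (simp add: v0_def)
    next
      case False
      then have rv: "r v0 = z" using rv0 by simp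
      have zw: "z \<le> w - 1" using gal[of z' z] defs eq by (simp add: w_def)
      have wz': "w \<le> r z" using l_lt[of z'] defs eq by (simp add: w_def)
      show False
      proof (cases "r w \<le> x + n")
        case True
        show False
          by (rule noC5[of "x + 1" v0 z w z'])
            (use True rw rv zw wz' yv vz xy defs eq rz' rz'y in auto)
      next
        case False
        then have rw2: "x + 1 + n \<le> r w" by simp
        show False
        proof (cases "z \<le> w - 2")
          case True
          then show False using apex[OF zw rw2] eq by simp
        next
          case c: False
          then have wz: "w = z + 1" using zw by simp
          \<comment> \<open>One turn back, this is the first vertex that \<open>w\<close> does not
            reach. \<open>ne\<close> puts it within the reach of \<open>x\<close>, so that
            \<open>x\<close>, \<open>v\<close>, \<open>v0\<close>, \<open>z\<close>,
            \<open>w\<close> is an induced 5-cycle.\<close>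
          define v where "v = r w + 1 - n"
          have lx: "l (x + 1 + n) \<le> w" using gal rw2 by blast
          have lx': "w \<le> l (x + 1 + n)" using l_mono[of z' "x + 1 + n"] z'x by (simp add: w_def)
          have lx1: "l (x + 1) = w - n" using lx lx' l_per[of "x + 1"] by simp
          have "w \<le> x + n" using l_lt[of z'] z'x by (simp add: w_def)
          then have rwx: "r w \<le> r x + n" using r_mono[of w "x + n"] r_per[of x] by simp
          have ne: "r w \<noteq> r x + n"
          proof
            assume a: "r w = r x + n"
            have "r (x + 1) = r (x + 2)" using e[of "x + 1"] e[of "x + 2"] xy yv by simp
            then have l2: "l (x + 1) < l (x + 2)" using red[of "x + 1"] by (simp add: add.assoc)
            have "r (l (x + 2) - 1) < x + 2" using gal[of "x + 2" "l (x + 2) - 1"] by linarith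
            moreover have "r (w - n) \<le> r (l (x + 2) - 1)" using l2 lx1 by (intro r_mono) simp
            ultimately show False using r_per'[of w] a xy defs by simp
          qed
          have vx: "v \<le> r x" "x + 2 \<le> v" using rwx ne rw2 by (auto simp: v_def)
          have rvv: "r v = z - 1" using e[of v] vx yv defs by simp
          show False
            by (rule noC5[of x v v0 z w])
              (use vx rvv yv vz rv wz defs rz rw2 gt[of z] in \<open>auto simp: v_def\<close>)
        qed
      qed
    qed
  qed
qed

lemma all_free: "free x \<Longrightarrow> free i"
proof -
  assume fx: "free x"
  have up: "free (x + int k)" for k
  proof (induction k)
    case (Suc k)
    then show ?case using free_step[of "x + int k"] by (simp add: algebra_simps)
  qed (simp add: fx)
  have per: "free (i + int k * n) = free i" for k
  proof (induction k)
    case (Suc k)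
    then show ?case using free_per[of "i + int k * n"] by (simp add: algebra_simps)
  qed simp
  have "x \<le> i + int (nat (x - i)) * n"
  proof -
    have "int (nat (x - i)) * 1 \<le> int (nat (x - i)) * n" using n_pos by (intro mult_left_mono) auto
    moreover have "x - i \<le> int (nat (x - i))" by simp
    ultimately show ?thesis by linarith
  qed
  then have "free (i + int (nat (x - i)) * n)"
    using up[of "nat (i + int (nat (x - i)) * n - x)"] by simp
  then show "free i" using per by blast
qed

lemma good_if_free:
  assumes f: "\<And>i. free i"
  shows "good_reach r l"
proof
  show "\<lbrakk>incomp x y; incomp y z; z \<le> r x\<rbrakk> \<Longrightarrow> False" for x y z
    using free_triangle f by blast
  show "\<lbrakk>\<not> pseudo i; l (i - 1) = l i; r i = r (i + 1)\<rbrakk> \<Longrightarrow> False" for i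
    using free_RL f by blast
  show "\<lbrakk>r (i - 1) = r i; l i = l (i + 1)\<rbrakk> \<Longrightarrow> r (l i) = r i" for i
    using free_LR f by blast
qed

end

lemma (in circ_reach) start_below:
  assumes "start s"
  shows "\<exists>s\<le>x. start s"
proof -
  have "start (s - int k * n)" for k
  proof (induction k)
    case (Suc k)
    then show ?case using start_per[of "s - int (Suc k) * n"] by (simp add: algebra_simps)
  qed (simp add: assms)
  moreover have "s - int (nat (s - x)) * n \<le> x"
  proof -
    have "int (nat (s - x)) * 1 \<le> int (nat (s - x)) * n" using n_pos by (intro mult_left_mono) auto
    moreover have "s - x \<le> int (nat (s - x))" by simp
    ultimately show ?thesis by linarith
  qed
  ultimately show ?thesis by blast
qed

section \<open>Graph-theoretic preliminaries\<close>

lemma adj_sym: "adj G u v \<longleftrightarrow> adj G v u"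
  by (simp add: adj_def insert_commute)

lemma adj_irrefl: "simple_graph G \<Longrightarrow> \<not> adj G u u"
  unfolding simple_graph_def adj_def by (metis card_1_singleton_iff insert_absorb2 numeral_eq_one_iff
      One_nat_def semiring_norm(85) is_singletonI is_singleton_altdef)

lemma adj_verts: "simple_graph G \<Longrightarrow> adj G u v \<Longrightarrow> u \<in> verts G \<and> v \<in> verts G"
  unfolding simple_graph_def adj_def by blast

lemma adj_induced: "adj (induced_subgraph G U) u v \<longleftrightarrow> adj G u v \<and> u \<in> U \<and> v \<in> U"
  by (auto simp: adj_def induced_subgraph_def)

lemma verts_induced: "verts (induced_subgraph G U) = verts G \<inter> U"
  by (simp add: induced_subgraph_def)

lemma locally_complete_iff:
  assumes "simple_graph G"
  shows "locally_complete_colouring G c \<longleftrightarrow> (\<forall>e\<in>edges G. c e \<in> {1, 2}) \<and>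
    (\<forall>x y z. adj G y x \<longrightarrow> adj G y z \<longrightarrow> x \<noteq> z \<longrightarrow> \<not> adj G x z \<longrightarrow> c {y, x} \<noteq> c {y, z})"
    (is "?L \<longleftrightarrow> ?E \<and> ?R")
proof
  assume L: ?L
  have "c {y, x} \<noteq> c {y, z}" if a: "adj G y x" "adj G y z" "x \<noteq> z" "\<not> adj G x z" for x y z
  proof
    assume eq: "c {y, x} = c {y, z}"
    let ?S = "{u \<in> verts G. adj G y u \<and> c {y, u} = c {y, x}}"
    have "c {y, x} \<in> {1, 2}" using L a unfolding locally_complete_colouring_def adj_def by blast
    then have "complete_graph (induced_subgraph G ?S)"
      using L a adj_verts[OF assms] unfolding locally_complete_colouring_def by blast
    moreover have S: "x \<in> ?S" "z \<in> ?S" using a eq adj_verts[OF assms] by auto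
    ultimately have "adj (induced_subgraph G ?S) x z"
      using a(3) unfolding complete_graph_def clique_def verts_induced by (metis (no_types, lifting) IntI mem_Collect_eq)
    then show False using a(4) by (simp add: adj_induced)
  qed
  moreover have ?E using L by (simp add: locally_complete_colouring_def)
  ultimately show "?E \<and> ?R" by simp
next
  assume R: "?E \<and> ?R"
  then have "adj G x z" if "adj G y x" "adj G y z" "x \<noteq> z" "c {y, x} = c {y, z}" for x y z
    using that by blast
  note R' = this
  have "complete_graph (induced_subgraph G {u \<in> verts G. adj G v u \<and> c {v, u} = k})" for v k
    unfolding complete_graph_def clique_def verts_induced adj_induced
  proof (intro conjI ballI impI)
    fix x z assume "x \<in> verts G \<inter> {u \<in> verts G. adj G v u \<and> c {v, u} = k}"
      "z \<in> verts G \<inter> {u \<in> verts G. adj G v u \<and> c {v, u} = k}" "x \<noteq> z"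
    then show "adj G x z" "x \<in> {u \<in> verts G. adj G v u \<and> c {v, u} = k}"
      "z \<in> {u \<in> verts G. adj G v u \<and> c {v, u} = k}"
      using R'[of v x z] by simp_all
  qed auto
  then show ?L using R by (simp add: locally_complete_colouring_def)
qed

lemma two_cliques_cover:
  assumes "clique G A" "clique G B" "A \<union> B = verts G"
  shows "clique_cover_number G \<le> 2"
proof -
  have "clique_cover_number G \<le> card {A, B}"
    unfolding clique_cover_number_def by (rule Least_le) (use assms in \<open>auto intro!: exI[of _ "{A, B}"]\<close>)
  also have "\<dots> \<le> 2" by (simp add: card_insert_if)
  finally show ?thesis .
qed

text \<open>The interval of \<open>u\<close> runs from \<open>pos u\<close> to
  \<open>f (pos u)\<close> plus an amount in \<open>(0, 1)\<close> that grows strictly with the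
  position. Where \<open>f\<close> is constant, this amount prevents proper containment, and it is
  too small to create intersections.\<close>

lemma proper_interval_graph_reach:
  fixes pos :: "'a \<Rightarrow> int" and f :: "int \<Rightarrow> int"
  assumes inj: "inj_on pos (verts G)" and mono: "\<And>x y. x \<le> y \<Longrightarrow> f x \<le> f y"
    and ge: "\<And>x. x \<le> f x"
    and adj: "\<And>u w. u \<in> verts G \<Longrightarrow> w \<in> verts G \<Longrightarrow> pos u < pos w \<Longrightarrow> adj G u w \<longleftrightarrow> pos w \<le> f (pos u)"
  shows "proper_interval_graph G"
proof -
  define \<theta> where "\<theta> x = arctan (real_of_int x) / pi + 1/2" for x
  have th: "0 < \<theta> x" "\<theta> x < 1" for x
    using arctan_lbound[of x] arctan_ubound[of x] by (auto simp: \<theta>_def field_simps)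
  have th_mono: "\<theta> x < \<theta> y" if "x < y" for x y
    using that divide_strict_right_mono[of "arctan x" "arctan y" pi] by (simp add: \<theta>_def arctan_less_iff)
  define L where "L u = real_of_int (pos u)" for u
  define Rt where "Rt u = real_of_int (f (pos u)) + \<theta> (pos u)" for u
  have LR: "L u \<le> Rt u" for u
    using ge[of "pos u"] th(1)[of "pos u"] by (simp add: L_def Rt_def)
  have meet: "{L u..Rt u} \<inter> {L w..Rt w} \<noteq> {} \<longleftrightarrow> pos w \<le> f (pos u)" if "pos u < pos w" for u w
  proof -
    have "{L u..Rt u} \<inter> {L w..Rt w} \<noteq> {} \<longleftrightarrow> L w \<le> Rt u"
      using LR[of u] LR[of w] that by (auto simp: L_def)
    also have "\<dots> \<longleftrightarrow> pos w \<le> f (pos u)"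
      using th[of "pos u"] by (simp add: L_def Rt_def) linarith
    finally show ?thesis .
  qed
  have not_sub: "\<not> {L u..Rt u} \<subset> {L w..Rt w}" for u w
  proof
    assume s: "{L u..Rt u} \<subset> {L w..Rt w}"
    then have le: "L w \<le> L u" "Rt u \<le> Rt w" using LR[of u] by auto
    show False
    proof (cases "pos w < pos u")
      case True
      then have "Rt w < Rt u"
        using mono[of "pos w" "pos u"] th_mono[OF True] by (simp add: Rt_def)
      then show False using le by simp
    next
      case False
      then have "pos w = pos u" using le by (simp add: L_def)
      then show False using s by (simp add: L_def Rt_def)
    qed
  qed
  have "adj G u w \<longleftrightarrow> {L u..Rt u} \<inter> {L w..Rt w} \<noteq> {}"
    if "u \<in> verts G" "w \<in> verts G" "u \<noteq> w" for u w
  proof (cases "pos u < pos w")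
    case True then show ?thesis using adj meet that by simp
  next
    case False
    then have "pos w < pos u" using inj that by (metis inj_on_def linorder_neqE)
    then show ?thesis using adj[of w u] meet[of w u] that adj_sym[of G u w] by (simp add: Int_commute)
  qed
  then have "proper_intersection_rep G (\<lambda>u. {L u..Rt u})"
    unfolding proper_intersection_rep_def using not_sub by blast
  then show ?thesis unfolding proper_interval_graph_def using LR by blast
qed

section \<open>Forbidden subgraphs\<close>

lemma pull_back_colouring:
  assumes "simple_graph G" "locally_complete_colouring G c" "contains_induced G H"
  obtains d where "\<And>x y z. \<lbrakk>x \<in> verts H; y \<in> verts H; z \<in> verts H; adj H x y; adj H y z; x \<noteq> z; \<not> adj H x z\<rbrakk>
     \<Longrightarrow> d x y \<longleftrightarrow> \<not> d y z"
proof -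
  obtain f where f0: "inj_on f (verts H) \<and> f ` verts H \<subseteq> verts G \<and>
      (\<forall>u\<in>verts H. \<forall>v\<in>verts H. adj H u v \<longleftrightarrow> adj G (f u) (f v))"
    using assms(3) unfolding contains_induced_def by (elim exE)
  then have f: "inj_on f (verts H)" "f ` verts H \<subseteq> verts G"
    "\<And>u v. u \<in> verts H \<Longrightarrow> v \<in> verts H \<Longrightarrow> adj H u v \<longleftrightarrow> adj G (f u) (f v)"
    by simp_all
  have c: "\<And>u w. adj G u w \<Longrightarrow> c {u, w} \<in> {1, 2}"
    and alt: "\<And>x y z. adj G y x \<Longrightarrow> adj G y z \<Longrightarrow> x \<noteq> z \<Longrightarrow> \<not> adj G x z \<Longrightarrow> c {y, x} \<noteq> c {y, z}"
    using assms(2) unfolding locally_complete_iff[OF assms(1)] adj_def by blast+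
  show ?thesis
  proof (rule that[of "\<lambda>u w. c {f u, f w} = 1"])
    fix x y z assume v: "x \<in> verts H" "y \<in> verts H" "z \<in> verts H"
      and a: "adj H x y" "adj H y z" "x \<noteq> z" "\<not> adj H x z"
    have ne: "f x \<noteq> f z" using f(1) v a(3) by (meson inj_onD)
    have e: "adj G (f x) (f y)" "adj G (f y) (f z)" "\<not> adj G (f x) (f z)"
      using f(3)[OF v(1,2)] f(3)[OF v(2,3)] f(3)[OF v(1,3)] a by auto
    have e': "adj G (f y) (f x)" using e(1) adj_sym[of G "f x"] by simp
    have "c {f y, f x} \<noteq> c {f y, f z}" by (rule alt[OF e' e(2) ne e(3)])
    moreover have "c {f y, f x} \<in> {1, 2}" "c {f y, f z} \<in> {1, 2}"
      using c[OF e'] c[OF e(2)] by auto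
    ultimately show "(c {f x, f y} = 1) \<longleftrightarrow> \<not> (c {f y, f z} = 1)"
      by (auto simp: insert_commute)
  qed
qed

lemma verts_F: "verts F1 = {1,2,3,4,5,6,7}" "verts F2 = {1,2,3,4,5,6,7}" "verts F3 = {1,2,3,4,5,6,7}"
proof -
  have "{1..7::nat} = {1,2,3,4,5,6,7}" by auto
  then show "verts F1 = {1,2,3,4,5,6,7}" "verts F2 = {1,2,3,4,5,6,7}" "verts F3 = {1,2,3,4,5,6,7}"
    by (simp_all add: F1_def F2_def F3_def)
qed

lemma F_adj_irrefl: "\<not> adj F1 u u" "\<not> adj F2 u u" "\<not> adj F3 u u"
  by (auto simp: adj_def F1_def F2_def F3_def doubleton_eq_iff)

text \<open>In each graph, edges that must differ in colour form an odd closed chain: seven edges in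
  \<open>F1\<close> and in \<open>F2\<close>, nine in \<open>F3\<close>.\<close>

lemma F_not_colourable:
  assumes G: "simple_graph G" "locally_complete_2_edge_colourable G"
  shows "\<not> contains_induced G F1" "\<not> contains_induced G F2" "\<not> contains_induced G F3"
proof -
  obtain c where c: "locally_complete_colouring G c"
    using G(2) unfolding locally_complete_2_edge_colourable_def by blast
  show "\<not> contains_induced G F1"
  proof
    assume "contains_induced G F1"
    obtain d where d: "\<And>x y z. \<lbrakk>x \<in> verts F1; y \<in> verts F1; z \<in> verts F1;
        adj F1 x y; adj F1 y z; x \<noteq> z; \<not> adj F1 x z\<rbrakk> \<Longrightarrow> d x y \<longleftrightarrow> \<not> d y z"
      using pull_back_colouring[OF G(1) c \<open>contains_induced G F1\<close>] by metis
    note a = d[unfolded verts_F adj_def F1_def, simplified doubleton_eq_iff snd_conv]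
    have "d 1 2 \<longleftrightarrow> \<not> d 2 3" "d 2 3 \<longleftrightarrow> \<not> d 3 5" "d 3 5 \<longleftrightarrow> \<not> d 5 6" "d 5 6 \<longleftrightarrow> \<not> d 6 7"
      "d 1 2 \<longleftrightarrow> \<not> d 2 4" "d 2 4 \<longleftrightarrow> \<not> d 4 6" "d 4 6 \<longleftrightarrow> \<not> d 6 7"
      by (rule a; simp add: doubleton_eq_iff)+
    then show False by argo
  qed
  show "\<not> contains_induced G F2"
  proof
    assume "contains_induced G F2"
    obtain d where d: "\<And>x y z. \<lbrakk>x \<in> verts F2; y \<in> verts F2; z \<in> verts F2;
        adj F2 x y; adj F2 y z; x \<noteq> z; \<not> adj F2 x z\<rbrakk> \<Longrightarrow> d x y \<longleftrightarrow> \<not> d y z"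
      using pull_back_colouring[OF G(1) c \<open>contains_induced G F2\<close>] by metis
    note a = d[unfolded verts_F adj_def F2_def, simplified doubleton_eq_iff snd_conv]
    have "d 1 3 \<longleftrightarrow> \<not> d 3 4" "d 1 3 \<longleftrightarrow> \<not> d 3 5" "d 3 4 \<longleftrightarrow> \<not> d 4 6" "d 2 4 \<longleftrightarrow> \<not> d 4 6"
      "d 2 4 \<longleftrightarrow> \<not> d 4 5" "d 4 5 \<longleftrightarrow> \<not> d 5 7" "d 3 5 \<longleftrightarrow> \<not> d 5 7"
      by (rule a; simp add: doubleton_eq_iff)+
    then show False by argo
  qed
  show "\<not> contains_induced G F3"
  proof
    assume "contains_induced G F3"
    obtain d where d: "\<And>x y z. \<lbrakk>x \<in> verts F3; y \<in> verts F3; z \<in> verts F3;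
        adj F3 x y; adj F3 y z; x \<noteq> z; \<not> adj F3 x z\<rbrakk> \<Longrightarrow> d x y \<longleftrightarrow> \<not> d y z"
      using pull_back_colouring[OF G(1) c \<open>contains_induced G F3\<close>] by metis
    note a = d[unfolded verts_F adj_def F3_def, simplified doubleton_eq_iff snd_conv]
    have "d 1 2 \<longleftrightarrow> \<not> d 2 4" "d 1 2 \<longleftrightarrow> \<not> d 2 5" "d 2 4 \<longleftrightarrow> \<not> d 4 6" "d 4 6 \<longleftrightarrow> \<not> d 6 7"
      "d 3 6 \<longleftrightarrow> \<not> d 6 7" "d 1 3 \<longleftrightarrow> \<not> d 3 5" "d 1 3 \<longleftrightarrow> \<not> d 3 6" "d 3 5 \<longleftrightarrow> \<not> d 5 7" "d 2 5 \<longleftrightarrow> \<not> d 5 7"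
      by (rule a; simp add: doubleton_eq_iff)+
    then show False by argo
  qed
qed

text \<open>\<open>g\<close> lists the vertices along the complementary cycle, which has
  \<open>2 * j + 1\<close> vertices.\<close>

definition odd_antihole :: "'a graph \<Rightarrow> nat \<Rightarrow> (nat \<Rightarrow> 'a) \<Rightarrow> bool" where
  "odd_antihole G j g \<longleftrightarrow> 2 \<le> j \<and> inj_on g {..2*j} \<and> g ` {..2*j} \<subseteq> verts G \<and>
     (\<forall>p q. p < q \<longrightarrow> q \<le> 2*j \<longrightarrow> (adj G (g p) (g q) \<longleftrightarrow> q \<noteq> p + 1 \<and> \<not> (p = 0 \<and> q = 2*j)))"

text \<open>Around a fixed vertex \<open>t\<close> the edges to the vertices \<open>t + 2, t + 3, \<dots>, t - 2\<close> alternate, and their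
  number is even. Hence the edges \<open>{t, t + 2}\<close> and \<open>{t - 2, t}\<close> get different colours
  for all \<open>t\<close>, which is impossible around the odd cycle formed by these edges.\<close>

lemma odd_antihole_not_colourable:
  assumes G: "simple_graph G" and c: "locally_complete_colouring G c" and ah: "odd_antihole G j g"
  shows False
proof -
  define m where "m = 2 * j + 1"
  define h where "h t = g (t mod m)" for t
  have j: "2 \<le> j" and inj: "inj_on g {..2*j}"
    and ga: "\<And>p q. p < q \<Longrightarrow> q \<le> 2*j \<Longrightarrow> adj G (g p) (g q) \<longleftrightarrow> q \<noteq> p + 1 \<and> \<not> (p = 0 \<and> q = 2*j)"
    using ah by (auto simp: odd_antihole_def)
  have m: "5 \<le> m" using j by (simp add: m_def)
  have hper: "h (t + m) = h t" for t by (simp add: h_def)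
  have hadj: "adj G (h t) (h (t + d)) \<longleftrightarrow> 2 \<le> d \<and> d \<le> m - 2" if d: "1 \<le> d" "d < m" for t d
  proof -
    let ?p = "t mod m"
    have pm: "?p < m" using m by simp
    have q: "(t + d) mod m = (if ?p + d < m then ?p + d else ?p + d - m)"
    proof -
      have "(t + d) mod m = (?p + d) mod m" by (simp add: mod_add_left_eq)
      moreover have "(?p + d) mod m = (?p + d - m) mod m" if "m \<le> ?p + d" using that by (simp add: le_mod_geq)
      ultimately show ?thesis using pm d by simp
    qed
    show ?thesis
    proof (cases "?p + d < m")
      case True
      have "?p + d \<le> 2 * j" using True by (simp add: m_def)
      then have "adj G (g ?p) (g (?p + d)) \<longleftrightarrow> d \<noteq> 1 \<and> \<not> (?p = 0 \<and> ?p + d = 2*j)"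
        using ga[of ?p "?p + d"] d by auto
      also have "\<dots> \<longleftrightarrow> 2 \<le> d \<and> d \<le> m - 2" using d True by (auto simp: m_def)
      finally show ?thesis using q True by (simp add: h_def)
    next
      case False
      let ?q = "?p + d - m"
      have "?q < ?p" "?p \<le> 2 * j" using False pm d by (auto simp: m_def)
      then have "adj G (g ?q) (g ?p) \<longleftrightarrow> ?p \<noteq> ?q + 1 \<and> \<not> (?q = 0 \<and> ?p = 2*j)"
        using ga[of ?q ?p] by auto
      also have "\<dots> \<longleftrightarrow> 2 \<le> d \<and> d \<le> m - 2" using d False pm unfolding m_def by linarith
      finally show ?thesis using q False adj_sym[of G "g ?q"] by (simp add: h_def)
    qed
  qed
  have hne: "h t \<noteq> h (t + 1)" for t
  proof
    assume a: "h t = h (t + 1)"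
    have "t mod m \<in> {..2*j}" "(t+1) mod m \<in> {..2*j}" using m
      by (auto simp: m_def less_Suc_eq_le[symmetric])
    then have "t mod m = (t + 1) mod m" using a inj unfolding h_def by (meson inj_onD)
    then show False using m mod_Suc[of t m] by (simp split: if_splits)
  qed
  have val: "\<And>u w. adj G u w \<Longrightarrow> c {u, w} \<in> {1, 2}"
    and alt: "\<And>x y z. adj G y x \<Longrightarrow> adj G y z \<Longrightarrow> x \<noteq> z \<Longrightarrow> \<not> adj G x z \<Longrightarrow> c {y, x} \<noteq> c {y, z}"
    using c unfolding locally_complete_iff[OF G] adj_def by blast+
  define e where "e t d \<longleftrightarrow> c {h t, h (t + d)} = 1" for t d
  have step: "e t d \<longleftrightarrow> \<not> e t (d + 1)" if d: "2 \<le> d" "d + 1 \<le> m - 2" for t d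
  proof -
    have a1: "adj G (h t) (h (t + d))" using hadj[of d t] d m by simp
    have a2: "adj G (h t) (h (t + (d + 1)))" using hadj[of "d + 1" t] d m by simp
    have a3: "\<not> adj G (h (t + d)) (h (t + d + 1))" using hadj[of 1 "t + d"] m by simp
    have "c {h t, h (t + d)} \<noteq> c {h t, h (t + (d + 1))}"
      using alt[OF a1 a2] a3 hne[of "t + d"] by (simp add: add.assoc)
    then show ?thesis using val[OF a1] val[OF a2] by (auto simp: e_def)
  qed
  have par: "d \<le> m - 2 \<Longrightarrow> e t d = (e t 2 = even d)" if "2 \<le> d" for t d
    using that
  proof (induction d rule: dec_induct)
    case (step d)
    have "e t d \<longleftrightarrow> \<not> e t (d + 1)" by (rule \<open>\<And>t d. 2 \<le> d \<Longrightarrow> d + 1 \<le> m - 2 \<Longrightarrow> e t d \<longleftrightarrow> \<not> e t (d + 1)\<close>) (use step in auto)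
    then show ?case using step by auto
  qed simp
  have flip: "e (t + (m - 2)) 2 \<longleftrightarrow> \<not> e t 2" for t
  proof -
    have "t + (m - 2) + 2 = t + m" using m by simp
    then have "h (t + (m - 2) + 2) = h t" using hper[of t] by (simp only:)
    then have "e (t + (m - 2)) 2 = e t (m - 2)" by (simp add: e_def insert_commute)
    also have "\<dots> = (e t 2 = even (m - 2))" using par[of "m - 2" t] m by simp
    finally show ?thesis using j by (simp add: m_def)
  qed
  have "e (t + k * (m - 2)) 2 = (e t 2 = even k)" for t k
  proof (induction k)
    case (Suc k)
    have "t + Suc k * (m - 2) = t + k * (m - 2) + (m - 2)" by simp
    then show ?case using flip[of "t + k * (m - 2)"] Suc by (simp only: even_Suc) argo
  qed simp
  from this[of 0 m] have "e (m * (m - 2)) 2 = (e 0 2 = even m)" by simp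
  moreover have "h (m * (m - 2) + d) = h d" for d by (simp add: h_def)
  from this[of 0] this[of 2] have "e (m * (m - 2)) 2 = e 0 2" by (simp only: e_def add_0 add_0_right)
  moreover have "odd m" by (simp add: m_def)
  ultimately show False by auto
qed

text \<open>A colour class is a clique of the complementary cycle and has at most 2 vertices, so
  more than \<open>j\<close> colours are needed. A clique is independent in that cycle and has at
  most \<open>j\<close> vertices.\<close>

lemma odd_antihole_not_perfect:
  assumes G: "simple_graph G" and pf: "perfect_graph G" and ah: "odd_antihole G j g"
  shows False
proof -
  have j: "2 \<le> j" and inj: "inj_on g {..2*j}" and sub: "g ` {..2*j} \<subseteq> verts G"
    and ga: "\<And>p q. p < q \<Longrightarrow> q \<le> 2*j \<Longrightarrow> adj G (g p) (g q) \<longleftrightarrow> q \<noteq> p + 1 \<and> \<not> (p = 0 \<and> q = 2*j)"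
    using ah by (auto simp: odd_antihole_def)
  define H where "H = induced_subgraph G (g ` {..2*j})"
  have vH: "verts H = g ` {..2*j}" using sub by (auto simp: H_def verts_induced)
  have aH: "adj H u w \<longleftrightarrow> adj G u w \<and> u \<in> g ` {..2*j} \<and> w \<in> g ` {..2*j}" for u w
    by (simp add: H_def adj_induced)
  have eq: "chromatic_number H = clique_number H"
    using pf sub by (simp add: perfect_graph_def H_def)
  have fin: "finite (verts H)" by (simp add: vH)
  let ?Q = "\<lambda>k f. (\<forall>v\<in>verts H. f v < k) \<and> (\<forall>u\<in>verts H. \<forall>v\<in>verts H. adj H u v \<longrightarrow> f u \<noteq> f v)"
  obtain f0 :: "'a \<Rightarrow> nat" and N where f0: "f0 ` verts H = {i. i < N}" "inj_on f0 (verts H)"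
    using finite_imp_inj_to_nat_seg[OF fin] by blast
  have "\<exists>f :: 'a \<Rightarrow> nat. ?Q N f"
  proof (intro exI[of _ f0] conjI ballI impI)
    show "f0 v < N" if "v \<in> verts H" for v using f0(1) that by blast
    show "f0 u \<noteq> f0 v" if "u \<in> verts H" "v \<in> verts H" "adj H u v" for u v
    proof
      assume "f0 u = f0 v"
      then have "u = v" using f0(2) that by (meson inj_onD)
      then show False using that(3) adj_irrefl[OF G] by (simp add: aH)
    qed
  qed
  then have "\<exists>f :: 'a \<Rightarrow> nat. ?Q (chromatic_number H) f"
    unfolding chromatic_number_def by (rule LeastI)
  then obtain f :: "'a \<Rightarrow> nat" where f: "\<And>v. v \<in> verts H \<Longrightarrow> f v < chromatic_number H"
    "\<And>u v. u \<in> verts H \<Longrightarrow> v \<in> verts H \<Longrightarrow> adj H u v \<Longrightarrow> f u \<noteq> f v" by blast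
  define cls where "cls k = {p \<in> {..2*j}. f (g p) = k}" for k
  have nonadj: "\<not> adj G (g p) (g q)" if "p \<in> cls k" "q \<in> cls k" for p q k
    using f(2)[of "g p" "g q"] that by (auto simp: cls_def vH aH)
  have cls2: "card (cls k) \<le> 2" for k
  proof (rule ccontr)
    assume a: "\<not> card (cls k) \<le> 2"
    have fc: "finite (cls k)" by (simp add: cls_def)
    have ne: "cls k \<noteq> {}" using a by auto
    let ?a = "Min (cls k)" and ?b = "Max (cls k)"
    have ab: "?a \<in> cls k" "?b \<in> cls k" using fc ne by auto
    have "cls k \<noteq> {?a, ?b}"
    proof
      assume e: "cls k = {?a, ?b}"
      have "card {?a, ?b} \<le> 2" by (simp add: card_insert_if)
      then show False using a e by simp
    qed
    then obtain q where q: "q \<in> cls k" "q \<noteq> ?a" "q \<noteq> ?b" using ab by blast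
    have lt: "?a < q" "q < ?b" using q Min_le[OF fc q(1)] Max_ge[OF fc q(1)] by auto
    have b: "?b \<le> 2 * j" using ab by (simp add: cls_def)
    have "q = ?a + 1" using ga[of ?a q] nonadj[OF ab(1) q(1)] lt b by auto
    moreover have "?b = q + 1" using ga[of q ?b] nonadj[OF q(1) ab(2)] lt b by auto
    ultimately show False using ga[of ?a ?b] nonadj[OF ab] b j by auto
  qed
  have "{..2*j} = (\<Union>k<chromatic_number H. cls k)"
    using f(1) by (auto simp: cls_def vH)
  then have "card {..2*j} \<le> (\<Sum>k<chromatic_number H. card (cls k))"
    by (metis card_UN_le finite_lessThan)
  also have "\<dots> \<le> (\<Sum>k<chromatic_number H. 2)" by (rule sum_mono) (rule cls2)
  finally have chi: "j < chromatic_number H" by simp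
  have "card K \<le> j" if K: "clique H K" for K
  proof -
    define P where "P = {p \<in> {..2*j}. g p \<in> K}"
    have KP: "K = g ` P" using K by (auto simp: P_def clique_def vH)
    have injP: "inj_on g P" by (rule inj_on_subset[OF inj]) (auto simp: P_def)
    have cK: "card K = card P" unfolding KP by (rule card_image[OF injP])
    \<comment> \<open>One step along the complementary cycle: the index set of a clique is disjoint
      from its image.\<close>
    let ?s = "\<lambda>p. if p = 2*j then 0 else p + 1"
    have "inj_on ?s P" by (auto simp: inj_on_def P_def split: if_splits)
    then have cs: "card (?s ` P) = card P" by (rule card_image)
    have cl: "adj G (g p) (g q)" if "p \<in> P" "q \<in> P" "p \<noteq> q" for p q
    proof -
      have "g p \<noteq> g q" using injP that by (meson inj_onD)
      then show ?thesis using K that unfolding clique_def P_def aH by blast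
    qed
    have "P \<inter> ?s ` P = {}"
    proof (rule ccontr)
      assume "P \<inter> ?s ` P \<noteq> {}"
      then obtain p where p: "p \<in> P" "?s p \<in> P" by blast
      show False
      proof (cases "p = 2 * j")
        case True
        then show False using cl[of 0 "2*j"] p ga[of 0 "2*j"] j by auto
      next
        case False
        then show False using cl[of p "p+1"] p ga[of p "p+1"] by (auto simp: P_def)
      qed
    qed
    moreover have "finite P" by (simp add: P_def)
    ultimately have "card (P \<union> ?s ` P) = card P + card P" using cs by (simp add: card_Un_disjoint)
    moreover have "P \<union> ?s ` P \<subseteq> {..2*j}" by (auto simp: P_def)
    then have "card (P \<union> ?s ` P) \<le> card {..2*j}" by (rule card_mono[rotated]) simp
    ultimately show ?thesis using cK by simp
  qed
  moreover have "finite {K. clique H K}"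
    by (rule finite_subset[of _ "Pow (verts H)"]) (auto simp: clique_def fin)
  moreover have "clique H {}" by (simp add: clique_def)
  ultimately have "clique_number H \<le> j"
    unfolding clique_number_def by (subst Max_le_iff) auto
  then show False using chi eq by simp
qed

section \<open>The reach function of a round ordering\<close>

lemma periodic_mult:
  fixes f :: "int \<Rightarrow> 'b"
  assumes "\<And>i. f (i + m) = f i"
  shows "f (i + k * m) = f i"
proof -
  have nat: "f (a + int j * m) = f a" for a j
  proof (induction j)
    case (Suc j)
    then show ?case using assms[of "a + int j * m"] by (simp add: algebra_simps)
  qed simp
  show ?thesis
  proof (cases "0 \<le> k")
    case True then show ?thesis using nat[of i "nat k"] by simp
  next
    case False then show ?thesis using nat[of "i + k * m" "nat (- k)"] by simp
  qed
qed

locale round_graph =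
  fixes G :: "'a graph" and n :: nat and v :: "int \<Rightarrow> 'a"
  assumes simple: "simple_graph G"
    and reduced: "reduced G"
    and not_interval: "\<not> proper_interval_graph G"
    and cc3: "clique_cover_number G \<ge> 3"
    and ro: "round_ordering G n v"
begin

abbreviation N :: int where "N \<equiv> int n"

lemma bij: "bij_betw v {1..N} (verts G)" and v_per: "v (i + N) = v i"
  using ro by (auto simp: round_ordering_def)

lemma v_per_k: "v (i + k * N) = v i"
  by (rule periodic_mult) (rule v_per)

lemma no_two_cliques: "clique G A \<Longrightarrow> clique G B \<Longrightarrow> verts G \<subseteq> A \<union> B \<Longrightarrow> False"
  using two_cliques_cover[of G A B] cc3 by (force simp: clique_def)

lemma n_pos: "0 < N"
proof (rule ccontr)
  assume "\<not> 0 < N"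
  then have "verts G = {}" using bij by (simp add: bij_betw_def)
  then show False using no_two_cliques[of "{}" "{}"] by (simp add: clique_def)
qed

lemma v_reduce: "v i = v ((i - 1) mod N + 1)"
proof -
  have "i = (i - 1) mod N + 1 + ((i - 1) div N) * N"
    using div_mult_mod_eq[of "i - 1" N] by linarith
  then show ?thesis using v_per_k[of "(i - 1) mod N + 1" "(i - 1) div N"] by simp
qed

lemma v_in: "v i \<in> verts G"
proof -
  have "(i - 1) mod N + 1 \<in> {1..N}" using pos_mod_bound[OF n_pos, of "i - 1"] pos_mod_sign[OF n_pos, of "i - 1"] by simp
  then show ?thesis using bij v_reduce[of i] by (auto simp: bij_betw_def)
qed

lemma v_eq: "v i = v j \<longleftrightarrow> (\<exists>k. j = i + k * N)"
proof
  assume "v i = v j"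
  then have "v ((i - 1) mod N + 1) = v ((j - 1) mod N + 1)" using v_reduce by metis
  moreover have "(x - 1) mod N + 1 \<in> {1..N}" for x
    using pos_mod_bound[OF n_pos, of "x - 1"] pos_mod_sign[OF n_pos, of "x - 1"] by simp
  ultimately have "(i - 1) mod N + 1 = (j - 1) mod N + 1"
    using bij by (meson bij_betw_def inj_onD)
  then have "(j - 1) mod N = (i - 1) mod N" by simp
  then have "N dvd (j - 1) - (i - 1)" by (rule mod_eq_dvd_iff[THEN iffD1])
  then obtain k where "j - i = N * k" by (auto elim: dvdE)
  then show "\<exists>k. j = i + k * N" by (intro exI[of _ k]) (simp add: algebra_simps)
qed (auto simp: v_per_k)

lemma v_window: "a \<le> i \<Longrightarrow> i < a + N \<Longrightarrow> a \<le> j \<Longrightarrow> j < a + N \<Longrightarrow> v i = v j \<Longrightarrow> i = j"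
proof -
  assume a: "a \<le> i" "i < a + N" "a \<le> j" "j < a + N" "v i = v j"
  then obtain k where k: "j = i + k * N" using v_eq by blast
  have "k < 1"
  proof (rule ccontr)
    assume "\<not> k < 1"
    then have "1 * N \<le> k * N" using n_pos by (intro mult_right_mono) auto
    then show False using k a by linarith
  qed
  moreover have "- 1 < k"
  proof (rule ccontr)
    assume "\<not> - 1 < k"
    then have "k * N \<le> (- 1) * N" using n_pos by (intro mult_right_mono) auto
    then show False using k a by linarith
  qed
  ultimately show "i = j" using k by simp
qed

lemma v_neq: "a < b \<Longrightarrow> b < a + N \<Longrightarrow> v a \<noteq> v b"
  using v_window[of a a b] n_pos by auto

lemma inj_window: "b < a + N \<Longrightarrow> inj_on v {a..b}"
  by (rule inj_onI) (use v_window[of a] in force)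

lemma window_rep:
  assumes "u \<in> verts G"
  obtains i where "a \<le> i" "i < a + N" "v i = u"
proof -
  have "u \<in> v ` {1..N}" using assms bij by (simp add: bij_betw_def)
  then obtain j where j: "v j = u" by blast
  have "v (a + (j - a) mod N) = v j"
    using v_per_k[of "a + (j - a) mod N" "(j - a) div N"] div_mult_mod_eq[of "j - a" N]
    by (simp add: algebra_simps)
  moreover have "0 \<le> (j - a) mod N" "(j - a) mod N < N" using n_pos by simp_all
  ultimately show ?thesis using that[of "a + (j - a) mod N"] j by simp
qed

lemma clique_subset: "clique G K \<Longrightarrow> K' \<subseteq> K \<Longrightarrow> clique G K'"
  unfolding clique_def by blast

lemma v_shift: "v ` {a + k * N..b + k * N} = v ` {a..b}"
proof -
  have "{a + k * N..b + k * N} = (\<lambda>x. x + k * N) ` {a..b}" by simp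
  then have "v ` {a + k * N..b + k * N} = (\<lambda>x. v (x + k * N)) ` {a..b}" by (simp only: image_image)
  then show ?thesis by (simp only: v_per_k)
qed

lemma round:
  obtains lo hi where "lo \<le> i" "i \<le> hi" "closed_nbhd G (v i) = v ` {lo..hi}"
    "clique G (v ` {lo..i})" "clique G (v ` {i..hi})" "hi < lo + N - 1"
proof -
  obtain j where j: "1 \<le> j" "j < 1 + N" "v j = v i" using window_rep[OF v_in, of 1] by blast
  then have jm: "j \<in> {1..N}" by simp
  obtain p q :: nat where pq: "closed_nbhd G (v j) = v ` {j - int p..j + int q}"
    "clique G (v ` {j - int p..j})" "clique G (v ` {j..j + int q})"
    using ro jm unfolding round_ordering_def by blast
  obtain k where k: "i = j + k * N" using v_eq j(3) by blast
  have s: "v ` {i - int p..i + int q} = v ` {j - int p..j + int q}"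
    "v ` {i - int p..i} = v ` {j - int p..j}" "v ` {i..i + int q} = v ` {j..j + int q}"
    using v_shift[of "j - int p" k "j + int q"] v_shift[of "j - int p" k j] v_shift[of j k "j + int q"]
    by (simp_all add: k algebra_simps)
  have "i + int q < i - int p + N - 1"
  proof (rule ccontr)
    assume c: "\<not> ?thesis"
    have "verts G \<subseteq> v ` {i - int p..i} \<union> v ` {i..i + int q}"
    proof
      fix u assume "u \<in> verts G"
      then obtain x where "i - int p \<le> x" "x < i - int p + N" "v x = u" by (rule window_rep)
      then show "u \<in> v ` {i - int p..i} \<union> v ` {i..i + int q}" using c by (cases "x \<le> i") force+
    qed
    then show False using no_two_cliques pq s by metis
  qed
  then show ?thesis using that[of "i - int p" "i + int q"] pq s j(3) by simp
qed

text \<open>Arcs are bounded by one turn, where \<open>v\<close> is injective; the maximum therefore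
  ranges over a finite set.\<close>

definition fwd :: "int \<Rightarrow> int" where
  "fwd i = Max {k \<in> {i..<i + N}. clique G (v ` {i..k})}"

definition bwd :: "int \<Rightarrow> int" where
  "bwd j = Min {x \<in> {j - N<..j}. j \<le> fwd x}"

lemma fwd_in: "i \<le> fwd i" "fwd i < i + N" "clique G (v ` {i..fwd i})"
  and fwd_max: "i \<le> k \<Longrightarrow> k < i + N \<Longrightarrow> clique G (v ` {i..k}) \<Longrightarrow> k \<le> fwd i"
proof -
  let ?A = "{k \<in> {i..<i + N}. clique G (v ` {i..k})}"
  have fin: "finite ?A" by (rule finite_subset[of _ "{i..<i+N}"]) auto
  have "i \<in> ?A" using n_pos v_in by (auto simp: clique_def)
  then have "fwd i \<in> ?A" unfolding fwd_def using Max_in[OF fin] by blast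
  then show "i \<le> fwd i" "fwd i < i + N" "clique G (v ` {i..fwd i})" by auto
  show "i \<le> k \<Longrightarrow> k < i + N \<Longrightarrow> clique G (v ` {i..k}) \<Longrightarrow> k \<le> fwd i"
    unfolding fwd_def by (rule Max_ge[OF fin]) simp
qed

lemma fwd_clique: "k \<le> fwd i \<Longrightarrow> clique G (v ` {i..k})"
  by (rule clique_subset[OF fwd_in(3)[of i]]) auto

lemma fwd_per: "fwd (i + N) = fwd i + N"
proof (rule order_antisym)
  have "clique G (v ` {i + 1 * N..fwd i + 1 * N})" unfolding v_shift by (rule fwd_in)
  then show "fwd i + N \<le> fwd (i + N)" using fwd_max[of "i + N" "fwd i + N"] fwd_in[of i] by simp
  have "clique G (v ` {i..fwd (i + N) - N})"
    using v_shift[of i 1 "fwd (i + N) - N"] fwd_in(3)[of "i + N"] by simp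
  then show "fwd (i + N) \<le> fwd i + N"
    using fwd_max[of i "fwd (i + N) - N"] fwd_in[of "i + N"] by simp
qed

lemma fwd_mono: "i \<le> j \<Longrightarrow> fwd i \<le> fwd j"
proof (cases "fwd i < j")
  case False
  assume "i \<le> j"
  then show ?thesis using False fwd_in[of i]
    by (intro fwd_max clique_subset[OF fwd_in(3)[of i]]) auto
qed (use fwd_in[of j] in simp)

lemma bwd_iff: "bwd j \<le> x \<longleftrightarrow> j \<le> fwd x"
proof -
  let ?A = "{x \<in> {j - N<..j}. j \<le> fwd x}"
  have fin: "finite ?A" by (rule finite_subset[of _ "{j-N<..j}"]) auto
  have jA: "j \<in> ?A" using fwd_in[of j] n_pos by simp
  have inA: "bwd j \<in> ?A" unfolding bwd_def using Min_in[OF fin] jA by blast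
  show ?thesis
  proof
    show "bwd j \<le> x \<Longrightarrow> j \<le> fwd x" using inA fwd_mono[of "bwd j" x] by simp
    assume a: "j \<le> fwd x"
    have "\<not> x \<le> j - N"
    proof
      assume "x \<le> j - N"
      then have "fwd x + N \<le> fwd j" using fwd_mono[of x "j - N"] fwd_per[of "j - N"] by simp
      then show False using a fwd_in(2)[of j] by simp
    qed
    then show "bwd j \<le> x"
      using inA Min_le[OF fin, of x] a unfolding bwd_def by (cases "x \<le> j") auto
  qed
qed

text \<open>Within one turn the neighbourhood of \<open>v a\<close> meets \<open>v b\<close> either
  on its forward side, as \<open>b\<close>, or on its backward side, as \<open>b - N\<close>. The
  cliques of the round ordering turn this into a forward clique from \<open>a\<close> or from
  \<open>b\<close>.\<close>

lemma adj_iff: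
  assumes "a < b" "b < a + N"
  shows "adj G (v a) (v b) \<longleftrightarrow> b \<le> fwd a \<or> a + N \<le> fwd b"
proof
  assume "b \<le> fwd a \<or> a + N \<le> fwd b"
  then show "adj G (v a) (v b)"
  proof
    assume "b \<le> fwd a"
    then show ?thesis using fwd_clique[of b a] v_neq[OF assms] assms by (auto simp: clique_def)
  next
    assume "a + N \<le> fwd b"
    then have "clique G (v ` {b..a + N})" by (rule fwd_clique)
    moreover have "v a \<in> v ` {b..a + N}" using v_per[of a, symmetric] assms by auto
    ultimately show ?thesis using v_neq[OF assms] assms by (auto simp: clique_def)
  qed
next
  assume adj: "adj G (v a) (v b)"
  obtain lo hi where R: "lo \<le> a" "a \<le> hi" "closed_nbhd G (v a) = v ` {lo..hi}"
    "clique G (v ` {lo..a})" "clique G (v ` {a..hi})" "hi < lo + N - 1" by (rule round)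
  have "v b \<in> closed_nbhd G (v a)" using adj v_in adj_sym[of G "v a"] by (simp add: closed_nbhd_def)
  then obtain c where c: "lo \<le> c" "c \<le> hi" "v c = v b" using R(3) by auto
  show "b \<le> fwd a \<or> a + N \<le> fwd b"
  proof (cases "a \<le> c")
    case True
    then have "c = b" using v_window[of a c b] c R assms by simp
    then have "v ` {a..b} \<subseteq> v ` {a..hi}" using c by (intro image_mono) auto
    then have "clique G (v ` {a..b})" by (rule clique_subset[OF R(5)])
    then show ?thesis using fwd_max[of a b] assms by simp
  next
    case False
    have "v (c + N) = v b" using c v_per by simp
    then have "c + N = b" using v_window[of a "c + N" b] c R assms False by simp
    then have "v ` {b..a + N} = v ` {c..a}" using v_shift[of c 1 a] by simp
    moreover have "v ` {c..a} \<subseteq> v ` {lo..a}" using c by (intro image_mono) auto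
    ultimately have "clique G (v ` {b..a + N})" using clique_subset[OF R(4)] by metis
    then show ?thesis using fwd_max[of b "a + N"] assms by simp
  qed
qed

lemma fwd_two: "fwd (fwd i + 1) + 1 < i + N"
proof (rule ccontr)
  assume c: "\<not> ?thesis"
  have "verts G \<subseteq> v ` {i..fwd i} \<union> v ` {fwd i + 1..fwd (fwd i + 1)}"
  proof
    fix u assume "u \<in> verts G"
    then obtain x where "i \<le> x" "x < i + N" "v x = u" by (rule window_rep)
    then show "u \<in> v ` {i..fwd i} \<union> v ` {fwd i + 1..fwd (fwd i + 1)}"
      using c by (cases "x \<le> fwd i") force+
  qed
  then show False using no_two_cliques fwd_in(3) by metis
qed

lemma N3: "2 < N"
  using fwd_two[of 0] fwd_in(1)[of 0] fwd_in(1)[of "fwd 0 + 1"] by simp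

text \<open>If \<open>i\<close> reached nothing, no forward clique would cross the gap after
  \<open>i\<close>. The circle could be cut open there, making \<open>G\<close> a proper interval
  graph.\<close>

lemma fwd_gt: "i < fwd i"
proof (rule ccontr)
  assume "\<not> i < fwd i"
  then have fi: "fwd i = i" using fwd_in[of i] by simp
  define pos where "pos = the_inv_into {i + 1..i + N} v"
  have inj: "inj_on v {i + 1..i + N}" by (rule inj_window) simp
  have im: "v ` {i + 1..i + N} = verts G"
  proof
    show "verts G \<subseteq> v ` {i + 1..i + N}"
    proof
      fix u assume "u \<in> verts G"
      then obtain x where "i + 1 \<le> x" "x < i + 1 + N" "v x = u" by (rule window_rep)
      then show "u \<in> v ` {i + 1..i + N}" by auto
    qed
  qed (auto simp: v_in)
  have pos: "pos u \<in> {i + 1..i + N}" "v (pos u) = u" if "u \<in> verts G" for u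
    using that the_inv_into_into[OF inj, of u, OF _ subset_refl] f_the_inv_into_f[OF inj, of u] im
    by (simp_all add: pos_def)
  have "proper_interval_graph G"
  proof (rule proper_interval_graph_reach[of pos G fwd])
    show "inj_on pos (verts G)" by (rule inj_onI) (metis pos(2))
    fix u w assume u: "u \<in> verts G" and w: "w \<in> verts G" and lt: "pos u < pos w"
    have "fwd (pos w) < pos u + N"
      using fwd_mono[of "pos w" "i + N"] fwd_per[of i] fi pos(1)[OF u] pos(1)[OF w] by simp
    then show "adj G u w \<longleftrightarrow> pos w \<le> fwd (pos u)"
      using adj_iff[OF lt] pos[OF u] pos[OF w] by simp
  qed (use fwd_mono fwd_in(1) in auto)
  then show False using not_interval by simp
qed

lemma closed_nbhd_eq: "closed_nbhd G (v i) = v ` {bwd i..fwd i}"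
proof
  have b: "i - N < bwd i"
    using bwd_iff[of i "i - N"] fwd_per[of "i - N"] fwd_in(2)[of i] by auto
  have bi: "bwd i \<le> i" using bwd_iff fwd_in(1) by blast
  show "v ` {bwd i..fwd i} \<subseteq> closed_nbhd G (v i)"
  proof
    fix u assume "u \<in> v ` {bwd i..fwd i}"
    then obtain x where x: "bwd i \<le> x" "x \<le> fwd i" "u = v x" by auto
    consider "x = i" | "i < x" | "x < i" by linarith
    then show "u \<in> closed_nbhd G (v i)"
    proof cases
      case 1 then show ?thesis using x v_in by (simp add: closed_nbhd_def)
    next
      case 2 then show ?thesis using x v_in adj_iff[of i x] fwd_in(2)[of i] adj_sym[of G "v x"] by (simp add: closed_nbhd_def)
    next
      case 3 then show ?thesis
        using x b v_in adj_iff[of x i] bwd_iff[of i x] by (simp add: closed_nbhd_def)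
    qed
  qed
  show "closed_nbhd G (v i) \<subseteq> v ` {bwd i..fwd i}"
  proof
    fix u assume u: "u \<in> closed_nbhd G (v i)"
    then have "u \<in> verts G" by (simp add: closed_nbhd_def)
    then obtain x where x: "i \<le> x" "x < i + N" "v x = u" by (rule window_rep)
    show "u \<in> v ` {bwd i..fwd i}"
    proof (cases "x = i")
      case True then show ?thesis using x bi fwd_in(1)[of i] by auto
    next
      case False
      then have "adj G (v i) (v x)" using u x v_neq[of i x] adj_sym[of G "v i"] by (auto simp: closed_nbhd_def)
      then have "x \<le> fwd i \<or> i + N \<le> fwd x" using adj_iff[of i x] x False by simp
      then show ?thesis
      proof
        assume "x \<le> fwd i" then show ?thesis using x bi by auto
      next
        assume a: "i + N \<le> fwd x"
        then have "bwd i \<le> x - N" using bwd_iff[of i "x - N"] fwd_per[of "x - N"] by simp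
        moreover have "v (x - N) = u" using v_per[of "x - N"] x by simp
        ultimately show ?thesis using x fwd_in(1)[of i] by (intro image_eqI[of _ _ "x - N"]) auto
      qed
    qed
  qed
qed

sublocale circ_reach fwd bwd N
proof
  show "bwd j \<le> x \<longleftrightarrow> j \<le> fwd x" for j x by (rule bwd_iff)
  show "i < fwd i" for i by (rule fwd_gt)
  show "0 < N" by (rule n_pos)
  show "fwd (i + N) = fwd i + N" for i by (rule fwd_per)
  show "fwd (fwd i + 1) + 1 < i + N" for i by (rule fwd_two)
  fix i
  show "fwd i < fwd (i + 1) \<or> bwd i < bwd (i + 1)"
  proof (rule ccontr)
    assume c: "\<not> ?thesis"
    have bm: "bwd i \<le> bwd (i + 1)" using bwd_iff[of i "bwd (i + 1)"] bwd_iff[of "i + 1" "bwd (i + 1)"] by simp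
    have "closed_nbhd G (v i) = closed_nbhd G (v (i + 1))"
      using c fwd_mono[of i "i + 1"] bm unfolding closed_nbhd_eq by simp
    then show False
      using reduced v_in v_neq[of i "i + 1"] N3 unfolding reduced_def by auto
  qed
qed

lemma circ_adj_iff:
  assumes "lo \<le> x" "x < lo + N" "lo \<le> y" "y < lo + N" "x \<noteq> y"
  shows "adj G (v x) (v y) \<longleftrightarrow> circ_adj x y"
proof (cases "x < y")
  case True then show ?thesis using assms adj_iff[of x y] by (simp add: circ_adj_def)
next
  case False then show ?thesis
    using assms adj_iff[of y x] adj_sym[of G "v x" "v y"] by (simp add: circ_adj_def)
qed

text \<open>The neighbours \<open>k - 1\<close> and \<open>k + 1\<close> on the circle are never
  joined around the far side, because two forward cliques do not close the circle.\<close>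

lemma pseudo_cutvertex_iff: "pseudo_cutvertex G v (v i) \<longleftrightarrow> pseudo i"
proof -
  have *: "adj G (v (k - 1)) (v (k + 1)) \<longleftrightarrow> \<not> pseudo k" for k
  proof -
    have "fwd (k + 1) < k - 1 + N"
      using fwd_two[of k] fwd_mono[of "k + 1" "fwd k + 1"] fwd_gt[of k] by simp
    then have "adj G (v (k - 1)) (v (k + 1)) \<longleftrightarrow> k + 1 \<le> fwd (k - 1)"
      using adj_iff[of "k - 1" "k + 1"] N3 by simp
    then show ?thesis using fwd_gt[of "k - 1"] by (auto simp: pseudo_def)
  qed
  have "pseudo (i + k * N) = pseudo i" for k
    by (rule periodic_mult) (rule pseudo_per)
  then show ?thesis unfolding pseudo_cutvertex_def by (auto simp: * v_eq)
qed

lemma card_pseudo: "card {x \<in> verts G. pseudo_cutvertex G v x} = card {i \<in> {1..N}. pseudo i}"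
proof -
  have "{x \<in> verts G. pseudo_cutvertex G v x} = v ` {i \<in> {1..N}. pseudo i}"
  proof
    show "{x \<in> verts G. pseudo_cutvertex G v x} \<subseteq> v ` {i \<in> {1..N}. pseudo i}"
    proof
      fix x assume x: "x \<in> {x \<in> verts G. pseudo_cutvertex G v x}"
      then obtain i where "1 \<le> i" "i < 1 + N" "v i = x" by (blast intro: window_rep)
      then show "x \<in> v ` {i \<in> {1..N}. pseudo i}" using x pseudo_cutvertex_iff[of i] by auto
    qed
  qed (use v_in pseudo_cutvertex_iff in auto)
  moreover have "inj_on v {i \<in> {1..N}. pseudo i}"
    using bij by (auto simp: bij_betw_def inj_on_def)
  ultimately show ?thesis by (simp add: card_image)
qed

text \<open>If an edge ran forward from both of its ends, the two arcs between them would be two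
  cliques covering the whole circle.\<close>

lemma same_edge:
  assumes "x < y" "y \<le> fwd x" "x' < y'" "y' \<le> fwd x'" "{v x, v y} = {v x', v y'}"
  shows "\<exists>k. x' = x + k * N \<and> y' = y + k * N"
proof -
  have yx: "y < x + N" "y' < x' + N" using assms fwd_in(2) less_trans le_less_trans by blast+
  consider "v x = v x'" "v y = v y'" | "v x = v y'" "v y = v x'"
    using assms(5) by (auto simp: doubleton_eq_iff)
  then show ?thesis
  proof cases
    case 1
    then obtain k where k: "x' = x + k * N" using v_eq by blast
    have "v (y' - k * N) = v y" using 1 v_per_k[of "y' - k * N" k] by simp
    then have "y' - k * N = y" using v_window[of x "y' - k * N" y] assms yx k by simp
    then show ?thesis using k by auto
  next
    case 2
    then obtain k where k: "x' = y + k * N" using v_eq by metis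
    have "v (y' - k * N) = v (x + N)" using 2 v_per_k[of "y' - k * N" k] v_per by simp
    then have "y' - k * N = x + N" using v_window[of y "y' - k * N" "x + N"] assms yx k n_pos by simp
    then have "x + N + k * N \<le> fwd (y + k * N)" using assms k by simp
    moreover have "fwd (y + k * N) - (y + k * N) = fwd y - y"
      by (rule periodic_mult[of "\<lambda>i. fwd i - i"]) (simp add: fwd_per)
    ultimately have "x + N \<le> fwd y" by simp
    then show ?thesis using fwd_two[of x] fwd_mono[of y "fwd x + 1"] assms by simp
  qed
qed

text \<open>By \<open>same_edge\<close> and periodicity every edge inherits one colour. Two edges
  that leave \<open>y\<close> in the same direction end in a common clique, so an induced path
  through \<open>y\<close> always has the form
  \<open>x \<rightarrow> y \<rightarrow> z\<close>.\<close>

lemma colourable_if_alternating: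
  fixes e :: "int \<Rightarrow> int \<Rightarrow> bool"
  assumes per: "\<And>x y. e (x + N) (y + N) = e x y"
    and alt: "\<And>x y z. \<lbrakk>x < y; y \<le> fwd x; fwd x < z; z \<le> fwd y\<rbrakk> \<Longrightarrow> e x y \<noteq> e y z"
  shows "locally_complete_2_edge_colourable G"
proof -
  define c :: "'a set \<Rightarrow> nat" where
    "c E = (if \<exists>x y. x < y \<and> y \<le> fwd x \<and> E = {v x, v y} \<and> e x y then 1 else 2)" for E
  have perk: "e (x + k * N) (y + k * N) = e x y" for x y k
    using periodic_mult[of "\<lambda>i. e (x + i) (y + i)" N 0 k] per by (simp add: add.assoc[symmetric])
  have c1: "c {v x, v y} = 1 \<longleftrightarrow> e x y" if xy: "x < y" "y \<le> fwd x" for x y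
  proof -
    have "(\<exists>x' y'. x' < y' \<and> y' \<le> fwd x' \<and> {v x, v y} = {v x', v y'} \<and> e x' y') \<longleftrightarrow> e x y"
    proof
      assume "\<exists>x' y'. x' < y' \<and> y' \<le> fwd x' \<and> {v x, v y} = {v x', v y'} \<and> e x' y'"
      then obtain x' y' where s: "x' < y'" "y' \<le> fwd x'" "{v x, v y} = {v x', v y'}" "e x' y'" by blast
      then obtain k where "x' = x + k * N" "y' = y + k * N" using same_edge[OF xy] by blast
      then show "e x y" using s(4) perk by simp
    qed (use xy in blast)
    then show ?thesis by (simp add: c_def)
  qed
  have main: "c {v y, v x} \<noteq> c {v y, v z}" if "x < y" "y \<le> fwd x" "y < z" "z \<le> fwd y" "\<not> adj G (v x) (v z)" for x y z
  proof -
    have "fwd x < z"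
    proof (rule ccontr)
      assume "\<not> fwd x < z"
      then have "adj G (v x) (v z)" using adj_iff[of x z] that fwd_in(2)[of x] by simp
      then show False using that by simp
    qed
    then show ?thesis using c1[of x y] c1[of y z] alt[of x y z] that by (auto simp: insert_commute)
  qed
  have "c {b, a} \<noteq> c {b, d}" if a: "adj G b a" "adj G b d" "a \<noteq> d" "\<not> adj G a d" for a b d
  proof -
    have V: "b \<in> verts G" "a \<in> verts G" "d \<in> verts G" using adj_verts[OF simple] a by blast+
    obtain y where y: "v y = b" using window_rep[OF V(1)] by metis
    have "a \<in> closed_nbhd G b" "d \<in> closed_nbhd G b" using a V adj_sym[of G b] by (auto simp: closed_nbhd_def)
    then obtain x z where x: "bwd y \<le> x" "x \<le> fwd y" "v x = a" and z: "bwd y \<le> z" "z \<le> fwd y" "v z = d"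
      unfolding y[symmetric] closed_nbhd_eq by auto
    have xy: "x \<noteq> y" "z \<noteq> y" using a adj_irrefl[OF simple] x z y by auto
    have q: "y \<le> fwd x" "y \<le> fwd z" using x z gal by auto
    have lo: "a' = d'" if "v a' = a" "v d' = d" "a' \<in> K" "d' \<in> K" "clique G (v ` K)" for a' d' K
      using that a unfolding clique_def by blast
    consider "x < y" "y < z" | "z < y" "y < x" | "x < y" "z < y" | "y < x" "y < z" using xy by linarith
    then show ?thesis
    proof cases
      case 1 then show ?thesis using main[of x y z] q x z y a by simp
    next
      case 2 then show ?thesis using main[of z y x] q x z y a adj_sym[of G a d] by simp
    next
      case 3
      have "clique G (v ` {bwd y..y})" by (rule fwd_clique) (rule r_l)
      then show ?thesis using lo[of x z "{bwd y..y}"] x z 3 a by auto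
    next
      case 4
      have "clique G (v ` {y..fwd y})" by (rule fwd_clique) simp
      then show ?thesis using lo[of x z "{y..fwd y}"] x z 4 a by auto
    qed
  qed
  moreover have "c E \<in> {1, 2}" for E by (simp add: c_def)
  ultimately have "locally_complete_colouring G c" unfolding locally_complete_iff[OF simple] by blast
  then show ?thesis unfolding locally_complete_2_edge_colourable_def by blast
qed

end

section \<open>From a tiling to a colouring and to perfection\<close>

lemma clique_le_clique_number:
  assumes "finite (verts H)" "clique H K"
  shows "card K \<le> clique_number H"
proof -
  have "finite {K. clique H K}"
    by (rule finite_subset[of _ "Pow (verts H)"]) (use assms in \<open>auto simp: clique_def\<close>)
  then show ?thesis unfolding clique_number_def using assms(2) by (intro Max_ge) auto
qed

lemma chromatic_eq_clique_number:
  assumes fin: "finite (verts H)"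
    and f: "\<And>u. u \<in> verts H \<Longrightarrow> f u < clique_number H"
      "\<And>u w. u \<in> verts H \<Longrightarrow> w \<in> verts H \<Longrightarrow> adj H u w \<Longrightarrow> f u \<noteq> f w"
  shows "chromatic_number H = clique_number H"
proof (rule order_antisym)
  let ?P = "\<lambda>k. \<exists>f :: 'a \<Rightarrow> nat. (\<forall>v\<in>verts H. f v < k) \<and>
    (\<forall>u\<in>verts H. \<forall>v\<in>verts H. adj H u v \<longrightarrow> f u \<noteq> f v)"
  have P: "?P (clique_number H)" using f by blast
  then show "chromatic_number H \<le> clique_number H"
    unfolding chromatic_number_def by (rule Least_le)
  have "?P (chromatic_number H)" unfolding chromatic_number_def by (rule LeastI) (rule P)
  then obtain g :: "'a \<Rightarrow> nat" where g: "\<And>u. u \<in> verts H \<Longrightarrow> g u < chromatic_number H"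
    "\<And>u w. u \<in> verts H \<Longrightarrow> w \<in> verts H \<Longrightarrow> adj H u w \<Longrightarrow> g u \<noteq> g w" by blast
  have "finite {K. clique H K}"
    by (rule finite_subset[of _ "Pow (verts H)"]) (use fin in \<open>auto simp: clique_def\<close>)
  moreover have "clique H {}" by (simp add: clique_def)
  ultimately have "clique_number H \<in> card ` {K. clique H K}"
    unfolding clique_number_def by (intro Max_in) auto
  then obtain K where K: "clique H K" "card K = clique_number H" by auto
  have "inj_on g K"
    by (rule inj_onI) (use K(1) g(2) in \<open>unfold clique_def, blast\<close>)
  moreover have "g ` K \<subseteq> {..<chromatic_number H}" using K(1) g(1) by (auto simp: clique_def)
  ultimately show "clique_number H \<le> chromatic_number H"
    using card_inj_on_le[of g K "{..<chromatic_number H}"] K(2) by simp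
qed

context round_graph
begin

context
  fixes S :: "int set"
  assumes chain: "clique_chain fwd bwd S"
    and S_per: "\<And>s. s \<in> S \<longleftrightarrow> s + N \<in> S"
    and even_pseudo: "even (card {i \<in> {1..N}. pseudo i})"
begin

interpretation ch: clique_chain fwd bwd S by (rule chain)

lemma base_per: "ch.base (x + N) = ch.base x + N"
proof (rule ch.baseI)
  show "ch.base x + N \<in> S" using ch.base_props(1)[of x] S_per by blast
  show "ch.base x + N \<le> x + N" using ch.base_props(2)[of x] by simp
  fix s' assume s: "s' \<in> S" "s' \<le> x + N"
  then have "s' - N \<in> S" using S_per[of "s' - N"] by simp
  then show "s' \<le> ch.base x + N" using ch.base_props(3)[of "s' - N" x] s by simp
qed

lemma parity_exists: "\<exists>par. (\<forall>i. par i \<longleftrightarrow> par (i - 1) \<noteq> pseudo i) \<and> (\<forall>i. par (i + N) = par i)"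
  by (rule periodic_parity[OF n_pos pseudo_per even_pseudo])

lemma chain_colourable: "locally_complete_2_edge_colourable G"
proof -
  obtain par where par: "\<And>i. par i \<longleftrightarrow> par (i - 1) \<noteq> pseudo i" "\<And>i. par (i + N) = par i"
    using parity_exists by blast
  show ?thesis
  proof (rule colourable_if_alternating[of "ch.edge_colour par"])
    show "ch.edge_colour par (x + N) (y + N) = ch.edge_colour par x y" for x y
      by (simp add: ch.edge_colour_def[OF par(1)] base_per par(2) fwd_per)
    show "\<lbrakk>x < y; y \<le> fwd x; fwd x < z; z \<le> fwd y\<rbrakk> \<Longrightarrow> ch.edge_colour par x y \<noteq> ch.edge_colour par y z" for x y z
      by (rule ch.edge_colour_alternates[OF par(1)])
  qed
qed

text \<open>For every induced subgraph, the colouring of its vertices from both ends of each tile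
  uses as many colours as its largest clique has vertices.\<close>

lemma chain_perfect: "perfect_graph G"
  unfolding perfect_graph_def
proof (intro allI impI)
  fix U assume U: "U \<subseteq> verts G"
  define H where "H = induced_subgraph G U"
  have vH: "verts H = U" using U by (auto simp: H_def verts_induced)
  have aH: "adj H a b \<longleftrightarrow> adj G a b \<and> a \<in> U \<and> b \<in> U" for a b by (simp add: H_def adj_induced)
  have fin: "finite (verts H)" using U simple unfolding vH simple_graph_def by (meson finite_subset)
  obtain par where par: "\<And>i. par i \<longleftrightarrow> par (i - 1) \<noteq> pseudo i" "\<And>i. par (i + N) = par i"
    using parity_exists by blast
  define W where "W = {x. v x \<in> U}"
  define w where "w = int (clique_number H)"
  have cl: "int (card (W \<inter> {x..y})) \<le> w" if xy: "x \<le> y" "y \<le> fwd x" for x y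
  proof -
    have inj: "inj_on v (W \<inter> {x..y})"
      by (rule inj_on_subset[OF inj_window[of y x]]) (use fwd_in(2)[of x] xy in auto)
    have "clique G (v ` {x..y})" by (rule fwd_clique) (rule xy)
    then have "clique H (v ` (W \<inter> {x..y}))"
      unfolding clique_def vH aH by (auto simp: W_def)
    then show ?thesis
      using clique_le_clique_number[OF fin] card_image[OF inj] by (simp add: w_def) metis
  qed
  define lev where "lev = ch.level W w"
  define vc where "vc = ch.vertex_colour par W w"
  have W_per: "x + N \<in> W \<longleftrightarrow> x \<in> W" for x by (simp add: W_def v_per)
  have shift: "card (W \<inter> ((\<lambda>x. x + N) ` A)) = card (W \<inter> A)" for A
  proof -
    have "W \<inter> ((\<lambda>x. x + N) ` A) = (\<lambda>x. x + N) ` (W \<inter> A)" using W_per by auto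
    then show ?thesis by (simp add: card_image)
  qed
  have im: "(\<lambda>x. x + N) ` {a<..b} = {a + N<..b + N}" for a b
    by (auto intro: image_eqI[of _ _ "_ - N"])
  have lev_per: "lev (y + N) = lev y" for y
    using shift[of "{ch.base y..<y}"] shift[of "{y<..fwd (ch.base y)}"]
    by (simp add: im lev_def ch.level_def[OF par(1) cl] base_per fwd_per)
  have vc_per: "vc (y + N) = vc y" for y
    using lev_per[of y] by (simp add: vc_def ch.vertex_colour_def[OF par(1) cl] par(2) lev_def)
  have vc_perk: "vc (y + k * N) = vc y" for y k by (rule periodic_mult) (rule vc_per)
  have rng: "0 \<le> vc y \<and> vc y < w" if "y \<in> W" for y
    unfolding vc_def by (rule ch.vertex_colour_range[OF par(1) cl that])
  have ne: "vc x \<noteq> vc y" if "x \<in> W" "y \<in> W" "x < y" "y \<le> fwd x" for x y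
    unfolding vc_def by (rule ch.vertex_colour_proper[OF par(1) cl that])
  \<comment> \<open>Any preimage on the line will do, since \<open>vc\<close> is periodic.\<close>
  define f where "f u = nat (vc (SOME x. v x = u))" for u
  have fv: "f (v x) = nat (vc x)" for x
  proof -
    have "v (SOME y. v y = v x) = v x" by (rule someI[of "\<lambda>y. v y = v x" x]) simp
    then obtain k where "x = (SOME y. v y = v x) + k * N" using v_eq by blast
    then show ?thesis unfolding f_def by (metis vc_perk)
  qed
  have "chromatic_number H = clique_number H"
  proof (rule chromatic_eq_clique_number[OF fin])
    fix u assume "u \<in> verts H"
    then have u: "u \<in> U" by (simp add: vH)
    then obtain x where x: "v x = u" using U window_rep by (metis subsetD)
    then have "x \<in> W" using u by (simp add: W_def)
    then show "f u < clique_number H" using rng[of x] fv[of x] x by (auto simp: w_def nat_less_iff)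
    fix b assume "b \<in> verts H" "adj H u b"
    then have b: "b \<in> U" "adj G u b" by (simp_all add: vH aH)
    obtain y where y: "x \<le> y" "y < x + N" "v y = b" using U b window_rep[of b x] by blast
    have "y \<noteq> x" using b adj_irrefl[OF simple] x y by auto
    then have xy: "x < y" using y by simp
    have W: "y \<in> W" using b y by (simp add: W_def)
    have "vc x \<noteq> vc y"
    proof (cases "y \<le> fwd x")
      case True then show ?thesis using ne \<open>x \<in> W\<close> W xy by blast
    next
      case False
      then have "x + N \<le> fwd y" using adj_iff[OF xy y(2)] b x y by simp
      then have "vc y \<noteq> vc (x + N)" using ne[of y "x + N"] W \<open>x \<in> W\<close> W_per y by simp
      then show ?thesis using vc_per[of x] by simp
    qed
    then show "f u \<noteq> f b" using fv[of x] fv[of y] x y rng[OF W] rng[OF \<open>x \<in> W\<close>] by (simp add: eq_nat_nat_iff)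
  qed
  then show "chromatic_number (induced_subgraph G U) = clique_number (induced_subgraph G U)"
    by (simp add: H_def)
qed

end

lemma good_clique_chain:
  assumes "good_reach fwd bwd" and "start s0"
  shows "clique_chain fwd bwd {s. start s}"
proof -
  interpret good_reach fwd bwd by fact
  show ?thesis by (rule clique_chain_start) (rule start_below[OF assms(2)])
qed

section \<open>No pseudo-cutvertices\<close>

lemma contains_seven:
  assumes H: "verts H = {1,2,3,4,5,6,7::nat}" "\<And>u. \<not> adj H u u"
    and P: "\<And>i j. 1 \<le> i \<Longrightarrow> i < j \<Longrightarrow> j \<le> 7 \<Longrightarrow> P i < P j \<and> (adj H i j \<longleftrightarrow> P j \<le> fwd (P i))"
    and wrap: "fwd (P 7) < P 1 + N"
  shows "contains_induced G H"
proof -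
  have lt: "P i < P j" if "1 \<le> i" "i < j" "j \<le> 7" for i j using P that by blast
  have le: "P i \<le> P j" if "1 \<le> i" "i \<le> j" "j \<le> 7" for i j using lt[of i j] that by (cases "i = j") auto
  have win: "P j < P i + N" if "1 \<le> i" "i \<le> 7" "1 \<le> j" "j \<le> 7" for i j
    using le[of 1 i] le[of j 7] that wrap fwd_gt[of "P 7"] by simp
  have a: "adj H i j \<longleftrightarrow> adj G (v (P i)) (v (P j))" if "1 \<le> i" "i < j" "j \<le> 7" for i j
  proof -
    have "fwd (P j) < P i + N" using fwd_mono[OF le[of j 7]] le[of 1 i] wrap that by simp
    then show ?thesis using adj_iff[OF lt[OF that] win[of i j]] P[OF that] that by simp
  qed
  have ne: "v (P i) \<noteq> v (P j)" if "1 \<le> i" "i < j" "j \<le> 7" for i j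
    using v_neq[OF lt[OF that] win[of i j]] that by simp
  have V: "i \<in> verts H \<longleftrightarrow> 1 \<le> i \<and> i \<le> 7" for i unfolding H(1) by auto
  show ?thesis
    unfolding contains_induced_def
  proof (intro exI[of _ "\<lambda>i. v (P i)"] conjI ballI)
    show "inj_on (\<lambda>i. v (P i)) (verts H)"
    proof (rule inj_onI)
      fix i j assume "i \<in> verts H" "j \<in> verts H" "v (P i) = v (P j)"
      then show "i = j" using ne[of i j] ne[of j i] V by (cases i j rule: linorder_cases) auto
    qed
    fix i j assume ij: "i \<in> verts H" "j \<in> verts H"
    show "adj H i j \<longleftrightarrow> adj G (v (P i)) (v (P j))"
    proof (cases i j rule: linorder_cases)
      case less then show ?thesis using a ij V by blast
    next
      case equal then show ?thesis using H(2) adj_irrefl[OF simple] by simp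
    next
      case greater then show ?thesis using a[of j i] ij V adj_sym[of H i] adj_sym[of G "v (P i)"] by simp
    qed
  qed (use v_in in auto)
qed

lemma seven_cases:
  assumes "(1::nat) \<le> i" "i < j" "j \<le> 7"
  shows "i \<in> {1,2,3,4,5,6}" "j \<in> {2,3,4,5,6,7}"
proof -
  have e: "{1..6::nat} = {1,2,3,4,5,6}" "{2..7::nat} = {2,3,4,5,6,7}" by auto
  have "i \<in> {1..6}" "j \<in> {2..7}" using assms by simp_all
  then show "i \<in> {1,2,3,4,5,6}" "j \<in> {2,3,4,5,6,7}" by (simp_all only: e)
qed

text \<open>The premises fix only the extremal pairs. The monotonicity facts collected in
  \<open>m\<close> decide the other pairs among the seven vertices.\<close>

lemma contains_F:
  assumes "p1 < p2" "p2 < p3" "p3 < p4" "p4 < p5" "p5 < p6" "p6 < p7" "fwd p7 < p1 + N"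
  shows "\<lbrakk>p2 \<le> fwd p1; fwd p1 < p3; p4 \<le> fwd p2; fwd p2 < p5; p5 \<le> fwd p3; fwd p3 < p6;
       p6 \<le> fwd p4; fwd p5 < p7; p7 \<le> fwd p6\<rbrakk> \<Longrightarrow> contains_induced G F1"
    and "\<lbrakk>p3 \<le> fwd p1; fwd p1 < p4; p4 \<le> fwd p2; fwd p2 < p5; p5 \<le> fwd p3; fwd p3 < p6;
       p6 \<le> fwd p4; fwd p4 < p7; p7 \<le> fwd p5\<rbrakk> \<Longrightarrow> contains_induced G F2"
    and "\<lbrakk>p3 \<le> fwd p1; fwd p1 < p4; p5 \<le> fwd p2; fwd p2 < p6; p6 \<le> fwd p3;
       fwd p4 < p7; p7 \<le> fwd p5\<rbrakk> \<Longrightarrow> contains_induced G F3"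
proof -
  define P where "P k = [0, p1, p2, p3, p4, p5, p6, p7] ! k" for k
  have P: "P 1 = p1" "P 2 = p2" "P 3 = p3" "P 4 = p4" "P 5 = p5" "P 6 = p6" "P 7 = p7"
    by (simp_all add: P_def eval_nat_numeral)
  note m = fwd_mono[of p1 p2] fwd_mono[of p2 p3] fwd_mono[of p3 p4] fwd_mono[of p4 p5]
    fwd_mono[of p5 p6] fwd_mono[of p6 p7]
  { assume a: "p2 \<le> fwd p1" "fwd p1 < p3" "p4 \<le> fwd p2" "fwd p2 < p5" "p5 \<le> fwd p3" "fwd p3 < p6"
       "p6 \<le> fwd p4" "fwd p5 < p7" "p7 \<le> fwd p6"
    have "P i < P j \<and> (adj F1 i j \<longleftrightarrow> P j \<le> fwd (P i))" if "1 \<le> i" "i < j" "j \<le> 7" for i j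
      using seven_cases[OF that] that(2) assms a m
      by (elim insertE emptyE) (simp_all only: P, simp_all add: adj_def F1_def doubleton_eq_iff)
    from contains_seven[OF verts_F(1) F_adj_irrefl(1) this] show "contains_induced G F1"
      using assms(7) by (simp only: P) }
  { assume a: "p3 \<le> fwd p1" "fwd p1 < p4" "p4 \<le> fwd p2" "fwd p2 < p5" "p5 \<le> fwd p3" "fwd p3 < p6"
       "p6 \<le> fwd p4" "fwd p4 < p7" "p7 \<le> fwd p5"
    have "P i < P j \<and> (adj F2 i j \<longleftrightarrow> P j \<le> fwd (P i))" if "1 \<le> i" "i < j" "j \<le> 7" for i j
      using seven_cases[OF that] that(2) assms a m
      by (elim insertE emptyE) (simp_all only: P, simp_all add: adj_def F2_def doubleton_eq_iff)
    from contains_seven[OF verts_F(2) F_adj_irrefl(2) this] show "contains_induced G F2"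
      using assms(7) by (simp only: P) }
  { assume a: "p3 \<le> fwd p1" "fwd p1 < p4" "p5 \<le> fwd p2" "fwd p2 < p6" "p6 \<le> fwd p3"
       "fwd p4 < p7" "p7 \<le> fwd p5"
    have "P i < P j \<and> (adj F3 i j \<longleftrightarrow> P j \<le> fwd (P i))" if "1 \<le> i" "i < j" "j \<le> 7" for i j
      using seven_cases[OF that] that(2) assms a m
      by (elim insertE emptyE) (simp_all only: P, simp_all add: adj_def F3_def doubleton_eq_iff)
    from contains_seven[OF verts_F(3) F_adj_irrefl(3) this] show "contains_induced G F3"
      using assms(7) by (simp only: P) }
qed

text \<open>A 5-cycle is its own complement; \<open>x1\<close>, \<open>x3\<close>,
  \<open>x5\<close>, \<open>x2\<close>, \<open>x4\<close> runs along the complementary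
  cycle.\<close>

lemma C5_antihole:
  assumes "x1 < x2" "x2 \<le> fwd x1" "fwd x1 < x3" "x3 \<le> fwd x2" "fwd x2 < x4" "x4 \<le> fwd x3" "fwd x3 < x5"
    "x5 \<le> fwd x4" "fwd x4 < x1 + N" "x1 + N \<le> fwd x5" "fwd x5 < x2 + N"
  shows "\<exists>g. odd_antihole G 2 g"
proof -
  define g where "g k = [v x1, v x3, v x5, v x2, v x4] ! k" for k
  have g: "g 0 = v x1" "g 1 = v x3" "g 2 = v x5" "g 3 = v x2" "g 4 = v x4"
    by (simp_all add: g_def eval_nat_numeral)
  have o: "x1 < x2" "x2 < x3" "x3 < x4" "x4 < x5" "x5 < x1 + N"
    using assms fwd_gt[of x4] fwd_gt[of x5] by linarith+
  have A: "adj G (v x1) (v x2)" "\<not> adj G (v x1) (v x3)" "\<not> adj G (v x1) (v x4)" "adj G (v x1) (v x5)"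
    "adj G (v x2) (v x3)" "\<not> adj G (v x2) (v x4)" "\<not> adj G (v x2) (v x5)"
    "adj G (v x3) (v x4)" "\<not> adj G (v x3) (v x5)" "adj G (v x4) (v x5)"
    using assms o by (simp_all add: adj_iff)
  note A = A adj_sym[of G "v x3" "v x2"] adj_sym[of G "v x5" "v x2"] adj_sym[of G "v x5" "v x4"]
  have ne: "v x1 \<noteq> v x2" "v x1 \<noteq> v x3" "v x1 \<noteq> v x4" "v x1 \<noteq> v x5" "v x2 \<noteq> v x3" "v x2 \<noteq> v x4"
    "v x2 \<noteq> v x5" "v x3 \<noteq> v x4" "v x3 \<noteq> v x5" "v x4 \<noteq> v x5"
    by (rule v_neq; use o in simp)+
  have idx: "{..2*2::nat} = {0,1,2,3,4}" by auto
  have "odd_antihole G 2 g"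
    unfolding odd_antihole_def
  proof (intro conjI allI impI)
    show "inj_on g {..2*2}" unfolding idx using ne ne[symmetric] by (simp add: g g[unfolded One_nat_def])
    show "g ` {..2*2} \<subseteq> verts G" unfolding idx by (simp add: g g[unfolded One_nat_def] v_in)
    fix p q :: nat assume pq: "p < q" "q \<le> 2 * 2"
    then have "p \<in> {..2*2}" "q \<in> {..2*2}" by simp_all
    then have "p \<in> {0,1,2,3,4}" "q \<in> {0,1,2,3,4}" by (simp_all only: idx)
    then show "adj G (g p) (g q) \<longleftrightarrow> q \<noteq> p + 1 \<and> \<not> (p = 0 \<and> q = 2 * 2)"
      using A pq(1) by (elim insertE emptyE) (simp_all add: g g[unfolded One_nat_def])
  qed simp
  then show ?thesis by blast
qed

lemma pseudo_free_good:
  assumes np: "\<And>i. \<not> pseudo i" and ah: "\<And>j g. \<not> odd_antihole G j g"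
    and F: "\<not> contains_induced G F1" "\<not> contains_induced G F2" "\<not> contains_induced G F3"
  shows "good_reach fwd bwd"
proof -
  interpret pseudo_free fwd bwd N
  proof
    show "i + 2 \<le> fwd i" for i using np[of "i + 1"] fwd_gt[of i] by (simp add: pseudo_def)
  next
    fix x1 x2 x3 x4 x5
    assume "x1 < x2" "x2 \<le> fwd x1" "fwd x1 < x3" "x3 \<le> fwd x2" "fwd x2 < x4" "x4 \<le> fwd x3" "fwd x3 < x5"
      "x5 \<le> fwd x4" "fwd x4 < x1 + N" "x1 + N \<le> fwd x5" "fwd x5 < x2 + N"
    from C5_antihole[OF this] show False using ah by blast
  next
    fix p1 p2 p3 p4 p5 p6 p7
    assume a: "p1 < p2" "p2 \<le> fwd p1" "fwd p1 < p3" "p3 < p4" "p4 \<le> fwd p2" "fwd p2 < p5" "p5 \<le> fwd p3"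
      "fwd p3 < p6" "p6 \<le> fwd p4" "fwd p5 < p7" "p7 \<le> fwd p6" "fwd p7 < p1 + N"
    then have "p2 < p3" "p4 < p5" "p5 < p6" "p6 < p7" using fwd_mono[of p4 p5] by linarith+
    then show False using contains_F(1)[of p1 p2 p3 p4 p5 p6 p7] a F(1) by blast
  next
    fix p1 p2 p3 p4 p5 p6 p7
    assume a: "p1 < p2" "p2 < p3" "p3 \<le> fwd p1" "fwd p1 < p4" "p4 \<le> fwd p2" "fwd p2 < p5" "p5 \<le> fwd p3"
      "fwd p3 < p6" "p6 \<le> fwd p4" "fwd p4 < p7" "p7 \<le> fwd p5" "fwd p7 < p1 + N"
    then have "p3 < p4" "p4 < p5" "p5 < p6" "p6 < p7" by linarith+
    then show False using contains_F(2)[of p1 p2 p3 p4 p5 p6 p7] a F(2) by blast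
  next
    fix p1 p2 p3 p4 p5 p6 p7
    assume a: "p1 < p2" "p2 < p3" "p3 \<le> fwd p1" "fwd p1 < p4" "p4 < p5" "p5 \<le> fwd p2" "fwd p2 < p6"
      "p6 \<le> fwd p3" "fwd p4 < p7" "p7 \<le> fwd p5" "fwd p7 < p1 + N"
    then have "p3 < p4" "p5 < p6" "p6 < p7" using fwd_mono[of p3 p4] by linarith+
    then show False using contains_F(3)[of p1 p2 p3 p4 p5 p6 p7] a F(3) by blast
  qed
  show ?thesis
  proof (cases "\<exists>i. free i")
    case True
    then show ?thesis using good_if_free all_free by blast
  next
    case False
    then obtain j :: nat and g lo where j: "2 \<le> j"
      and win: "\<And>p. p \<le> 2*j \<Longrightarrow> lo \<le> g p \<and> g p < lo + N"
      and g: "\<And>p q. p < q \<Longrightarrow> q \<le> 2*j \<Longrightarrow> g p \<noteq> g q \<and>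
       (circ_adj (g p) (g q) \<longleftrightarrow> q \<noteq> p + 1 \<and> \<not> (p = 0 \<and> q = 2*j))"
      using antihole_exists by blast
    have "odd_antihole G j (\<lambda>p. v (g p))"
      unfolding odd_antihole_def
    proof (intro conjI allI impI)
      show "inj_on (\<lambda>p. v (g p)) {..2*j}"
      proof (rule inj_onI)
        fix p q assume "p \<in> {..2*j}" "q \<in> {..2*j}" "v (g p) = v (g q)"
        then show "p = q"
          using v_window[of lo "g p" "g q"] win[of p] win[of q] g[of p q] g[of q p]
          by (cases p q rule: linorder_cases) auto
      qed
      fix p q assume pq: "p < q" "q \<le> 2 * j"
      then show "adj G (v (g p)) (v (g q)) \<longleftrightarrow> q \<noteq> p + 1 \<and> \<not> (p = 0 \<and> q = 2 * j)"
        using circ_adj_iff[of lo "g p" "g q"] win[of p] win[of q] g[OF pq] by simp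
    qed (use j v_in in auto)
    then show ?thesis using ah by blast
  qed
qed

lemma pseudo_shift:
  assumes "pseudo p"
  obtains q where "pseudo q" "x \<le> q" "q < x + N"
proof -
  have per: "pseudo (i + k * N) = pseudo i" for i k by (rule periodic_mult) (rule pseudo_per)
  have "x + (p - x) mod N = p + (- ((p - x) div N)) * N"
    using div_mult_mod_eq[of "p - x" N] by (simp add: algebra_simps)
  then have "pseudo (x + (p - x) mod N)" using per assms by metis
  moreover have "0 \<le> (p - x) mod N" "(p - x) mod N < N" using n_pos by simp_all
  ultimately show ?thesis using that[of "x + (p - x) mod N"] by simp
qed

lemma card_pseudo_window: "card {u. pseudo u \<and> a \<le> u \<and> u < a + N} = card {i \<in> {1..N}. pseudo i}"
proof -
  have im: "v ` {u. pseudo u \<and> a \<le> u \<and> u < a + N} = {x \<in> verts G. pseudo_cutvertex G v x}"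
  proof
    show "{x \<in> verts G. pseudo_cutvertex G v x} \<subseteq> v ` {u. pseudo u \<and> a \<le> u \<and> u < a + N}"
    proof
      fix x assume x: "x \<in> {x \<in> verts G. pseudo_cutvertex G v x}"
      then obtain i where "a \<le> i" "i < a + N" "v i = x" by (blast intro: window_rep)
      then show "x \<in> v ` {u. pseudo u \<and> a \<le> u \<and> u < a + N}" using x pseudo_cutvertex_iff[of i] by auto
    qed
  qed (use v_in pseudo_cutvertex_iff in auto)
  have "inj_on v {u. pseudo u \<and> a \<le> u \<and> u < a + N}"
    by (rule inj_on_subset[OF inj_window[of "a + N - 1" a]]) auto
  then have "card {u. pseudo u \<and> a \<le> u \<and> u < a + N} = card {x \<in> verts G. pseudo_cutvertex G v x}"
    using card_image im by metis
  then show ?thesis by (simp add: card_pseudo)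
qed

section \<open>Colourings in the presence of a pseudo-cutvertex\<close>

context
  fixes c :: "'a set \<Rightarrow> nat"
  assumes c: "locally_complete_colouring G c"
begin

definition C :: "int \<Rightarrow> int \<Rightarrow> bool" where "C x y \<longleftrightarrow> c {v x, v y} = 1"

lemma C_per: "C (x + N) (y + N) = C x y" by (simp add: C_def v_per)

text \<open>The last premise rules out an edge between \<open>v x\<close> and \<open>v z\<close>
  around the other side, the one way in which the path could fail to be induced.\<close>

lemma alternates_far:
  assumes "x < y" "y \<le> fwd x" "fwd x < z" "z \<le> fwd y" "fwd z < x + N"
  shows "C x y \<noteq> C y z"
proof -
  have yz: "y < z" using assms by simp
  have zx: "z < x + N" using assms fwd_gt[of z] by simp
  have a: "adj G (v x) (v y)" "adj G (v y) (v z)" "\<not> adj G (v x) (v z)"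
    using adj_iff[of x y] adj_iff[of y z] adj_iff[of x z] assms yz zx by auto
  have ne: "v x \<noteq> v z" using v_neq[of x z] yz zx assms by simp
  have "c {v y, v x} \<noteq> c {v y, v z}" "c {v y, v x} \<in> {1, 2}" "c {v y, v z} \<in> {1, 2}"
    using c a ne adj_sym[of G "v x" "v y"] unfolding locally_complete_iff[OF simple] adj_def by blast+
  then show ?thesis by (auto simp: C_def insert_commute)
qed

text \<open>A closed walk of three steps around the circle has to step on every pseudo-cutvertex. Although
  its three vertices are pairwise adjacent, the sides of the triangle would need three
  different colours, because the other vertices cannot be covered by too few cliques.\<close>

lemma no_triangle_at_pseudo:
  assumes p: "pseudo p" and j: "p < j" "j \<le> fwd p" and k: "j < k" "k \<le> fwd j" and t: "p + N \<le> fwd k"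
  shows False
proof -
  have pN: "pseudo (p + N)" using p pseudo_per by simp
  have tw: "fwd (fwd i + 1) < i + N - 1" for i using fwd_two[of i] by simp
  have jp: "fwd j < p + N - 1" using fwd_mono[of j "fwd p + 1"] tw[of p] j by simp
  have kp: "k < p + N - 1" using k jp by simp
  have fk: "fwd k = p + N" using pseudo_r_le[OF pN, of k] kp t by simp
  have fp: "fwd (p - 1) = p" using p by (simp add: pseudo_def)
  have fpN: "fwd (p + N - 1) = p + N" using pN by (simp add: pseudo_def algebra_simps)
  have p1k: "fwd (p + 1) < k"
    using fwd_mono[of k "fwd (p + 1) + 1"] tw[of "p + 1"] t by force
  have p1j: "p + 1 < j" using j k p1k fwd_mono[of j "p + 1"] by force
  \<comment> \<open>The last vertex that does not reach \<open>p + N\<close>: at the corner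
    \<open>j\<close> it is a substitute for \<open>k\<close> that is not joined to
    \<open>p\<close>.\<close>
  define z where "z = bwd (p + N) - 1"
  have fz: "fwd z < p + N" using gal[of "p + N" z] by (simp add: z_def)
  have zlt: "x < z" if "fwd (x + 1) < p + N" for x using gal[of "p + N" "x + 1"] that by (simp add: z_def)
  have jz: "j < z" using zlt[of j] fwd_mono[of "j + 1" "fwd p + 1"] tw[of p] j by simp
  have zk: "z < k" using gal[of "p + N" k] t by (simp add: z_def)
  have pz: "fwd p < z" using zlt[of "fwd p"] tw[of p] by simp
  have p1z: "fwd (p + 1) < z" using zlt[of "fwd (p + 1)"] tw[of "p + 1"] by simp
  have j1: "j \<le> fwd (p + 1)" using j fwd_mono[of p "p + 1"] by simp
  \<comment> \<open>\<open>I\<close>, \<open>II\<close> and \<open>III\<close> each compare the two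
    sides meeting at one corner. Three changes of colour along auxiliary edges at that corner
    separate them, where the auxiliary ends are chosen to satisfy the last premise of
    \<open>alternates_far\<close>.\<close>
  have I: "C p j \<noteq> C j k"
  proof -
    have "C p j \<noteq> C j z" by (rule alternates_far) (use j pz zk k fz in auto)
    moreover have "C (p + 1) j \<noteq> C j z" by (rule alternates_far) (use p1j j1 p1z zk k fz in auto)
    moreover have "C (p + 1) j \<noteq> C j k" by (rule alternates_far) (use p1j j1 p1k k fk in auto)
    ultimately show ?thesis by auto
  qed
  define y where "y = fwd p + 1"
  have yj: "j < y" using j by (simp add: y_def)
  have yk: "y < k"
    using tw[of p] fwd_mono[of k y] t by (cases "y < k") (auto simp: y_def)
  have ky: "k \<le> fwd y" using k fwd_mono[of j y] yj by simp
  have fy: "fwd y < p + N - 1" using tw[of p] by (simp add: y_def)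
  have per1: "fwd (p + N) = fwd p + N" "fwd (p + 1 + N) = fwd (p + 1) + N" "fwd (j + N) = fwd j + N"
    by (rule fwd_per)+
  have III: "C j k \<noteq> C k (p + N)"
  proof -
    have "C y k \<noteq> C k (p + N)" by (rule alternates_far) (use yk ky fy fk per1 in \<open>auto simp: y_def\<close>)
    moreover have "C y k \<noteq> C k (p + N - 1)"
      by (rule alternates_far) (use yk ky fy fk kp fpN yj j in auto)
    moreover have "C j k \<noteq> C k (p + N - 1)"
      by (rule alternates_far) (use k jp fk kp fpN yj j in auto)
    ultimately show ?thesis by auto
  qed
  have II: "C k (p + N) \<noteq> C (p + N) (j + N)"
  proof -
    have p1: "p + 1 + N \<le> fwd (p + N)" using fwd_gt[of "p + N"] by simp
    have "C k (p + N) \<noteq> C (p + N) (p + 1 + N)"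
      by (rule alternates_far) (use kp fk p1 per1 p1k in auto)
    moreover have "C (p + N - 1) (p + N) \<noteq> C (p + N) (p + 1 + N)"
      by (rule alternates_far) (use fpN p1 per1 p1k kp in auto)
    moreover have "C (p + N - 1) (p + N) \<noteq> C (p + N) (j + N)"
      by (rule alternates_far) (use fpN per1 j jp in auto)
    ultimately show ?thesis by auto
  qed
  show False using I II III C_per[of p j] by argo
qed

lemma no_triangle_around:
  assumes p: "pseudo p" and "x < y" "y \<le> fwd x" "y < z" "z \<le> fwd y"
  shows "fwd z < x + N"
proof (rule ccontr)
  assume t: "\<not> fwd z < x + N"
  obtain q where q: "pseudo q" "x \<le> q" "q < x + N" using pseudo_shift[OF p] by blast
  have zx: "z < x + N" using fwd_two[of x] fwd_mono[of y "fwd x + 1"] assms by simp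
  consider "q = x" | "x < q" "q < y" | "q = y" | "y < q" "q < z" | "q = z" | "z < q" using q by linarith
  then show False
  proof cases
    case 1 then show ?thesis using no_triangle_at_pseudo[of x y z] q assms t by simp
  next
    case 2 then show ?thesis using pseudo_r_le[OF q(1), of x] assms by simp
  next
    case 3
    then show ?thesis
      using no_triangle_at_pseudo[of y z "x + N"] q assms t zx fwd_per[of x] by simp
  next
    case 4 then show ?thesis using pseudo_r_le[OF q(1), of y] assms by simp
  next
    case 5
    then show ?thesis
      using no_triangle_at_pseudo[of z "x + N" "y + N"] q assms t zx fwd_per[of x] fwd_per[of y] by simp
  next
    case 6 then show ?thesis using pseudo_r_le[OF q(1), of z] q t by simp
  qed
qed

lemma coloured_if_pseudo:
  assumes "pseudo p"
  shows "coloured_reach fwd bwd C"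
proof
  fix x y z assume a: "x < y" "y \<le> fwd x" "fwd x < z" "z \<le> fwd y"
  then have "fwd z < x + N" using no_triangle_around[OF assms, of x y z] by simp
  then show "C x y \<noteq> C y z" using alternates_far a by blast
qed

text \<open>Following the colour of the starts for one turn from a pseudo-cutvertex returns to the
  same edge, so the number of swaps is even.\<close>

lemma even_pseudo_if_coloured: "even (card {i \<in> {1..N}. pseudo i})"
proof (cases "\<exists>p. pseudo p")
  case False
  then show ?thesis by simp
next
  case True
  then obtain p where p: "pseudo p" "1 \<le> p" "p < 1 + N" using pseudo_shift by metis
  interpret coloured_reach fwd bwd C by (rule coloured_if_pseudo[OF p(1)])
  have "C (p + N) (fwd (p + N)) = C p (fwd p)" by (simp add: fwd_per C_per)
  moreover have "start p" "start (p + N)" using p pseudo_per by (auto simp: start_def)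
  ultimately have "even (card {u. pseudo u \<and> p < u \<and> u \<le> p + N})"
    using start_colour_parity[of p "p + N"] n_pos by simp
  moreover have "{u. pseudo u \<and> p < u \<and> u \<le> p + N} = {u. pseudo u \<and> p + 1 \<le> u \<and> u < p + 1 + N}"
    by auto
  ultimately show ?thesis using card_pseudo_window[of "p + 1"] by simp
qed

end

end

section \<open>Straight orderings and greedy clique covers\<close>

text \<open>The finite, linear counterpart of a reach function. It is instantiated both by the
  reduced weak blocks and by arbitrary straight orderings.\<close>

locale line_graph =
  fixes H :: "'b graph" and m :: nat and w :: "nat \<Rightarrow> 'b" and \<rho> :: "nat \<Rightarrow> nat"
  assumes simple_H: "simple_graph H"
    and bij_w: "bij_betw w {1..m} (verts H)"
    and adj_w: "\<lbrakk>1 \<le> a; a < b; b \<le> m\<rbrakk> \<Longrightarrow> adj H (w a) (w b) \<longleftrightarrow> b \<le> \<rho> a"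
    and \<rho>_mono: "\<lbrakk>1 \<le> a; a \<le> b; b \<le> m\<rbrakk> \<Longrightarrow> \<rho> a \<le> \<rho> b"
    and \<rho>_ge: "\<lbrakk>1 \<le> a; a \<le> m\<rbrakk> \<Longrightarrow> a \<le> \<rho> a"
    and \<rho>_le: "\<lbrakk>1 \<le> a; a \<le> m\<rbrakk> \<Longrightarrow> \<rho> a \<le> m"
begin

lemma w_in: "1 \<le> a \<Longrightarrow> a \<le> m \<Longrightarrow> w a \<in> verts H"
  using bij_w by (auto simp: bij_betw_def)

lemma w_inj: "w a = w b \<Longrightarrow> 1 \<le> a \<Longrightarrow> a \<le> m \<Longrightarrow> 1 \<le> b \<Longrightarrow> b \<le> m \<Longrightarrow> a = b"
  by (rule inj_onD[OF bij_betw_imp_inj_on[OF bij_w]]) simp_all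

lemma w_surj:
  assumes "u \<in> verts H"
  obtains a where "1 \<le> a" "a \<le> m" "w a = u"
proof -
  have "u \<in> w ` {1..m}" using assms bij_w by (simp add: bij_betw_def)
  then show ?thesis using that by auto
qed

lemma near_iff:
  assumes "1 \<le> a" "a \<le> m" "1 \<le> b" "b \<le> m"
  shows "w b \<in> closed_nbhd H (w a) \<longleftrightarrow> a \<le> \<rho> b \<and> b \<le> \<rho> a"
proof (cases a b rule: linorder_cases)
  case less
  then have "a \<le> \<rho> b" using \<rho>_ge[of b] assms by simp
  then show ?thesis
    using less assms adj_w[of a b] w_in[of b] w_inj[of a b] adj_sym[of H "w a" "w b"]
    by (auto simp: closed_nbhd_def)
next
  case equal
  then show ?thesis using assms \<rho>_ge w_in by (simp add: closed_nbhd_def)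
next
  case greater
  then have "b \<le> \<rho> a" using \<rho>_ge[of a] assms by simp
  then show ?thesis
    using greater assms adj_w[of b a] w_in[of b] w_inj[of a b] by (auto simp: closed_nbhd_def)
qed

lemma last_nbr_eq:
  assumes "1 \<le> a" "a \<le> m"
  shows "last_nbr H m w a = \<rho> a"
  unfolding last_nbr_def
proof (rule Max_eqI)
  have r: "a \<le> \<rho> a" "\<rho> a \<le> m" using \<rho>_ge \<rho>_le assms by auto
  then have "a \<le> \<rho> (\<rho> a)" using \<rho>_ge[of "\<rho> a"] assms by simp
  then show "\<rho> a \<in> {q \<in> {1..m}. w q \<in> closed_nbhd H (w a)}"
    using near_iff[of a "\<rho> a"] r assms by simp
  show "y \<le> \<rho> a" if "y \<in> {q \<in> {1..m}. w q \<in> closed_nbhd H (w a)}" for y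
    using near_iff[of a y] that assms by simp
qed simp

lemma first_nbr_in:
  assumes "1 \<le> b" "b \<le> m"
  shows "1 \<le> first_nbr H m w b" "first_nbr H m w b \<le> b" "b \<le> \<rho> (first_nbr H m w b)"
    "\<And>a. 1 \<le> a \<Longrightarrow> a \<le> m \<Longrightarrow> first_nbr H m w b \<le> a \<longleftrightarrow> b \<le> \<rho> a"
proof -
  let ?A = "{q \<in> {1..m}. w q \<in> closed_nbhd H (w b)}"
  have A: "?A = {q \<in> {1..m}. b \<le> \<rho> q \<and> q \<le> \<rho> b}" using near_iff assms by auto
  have fin: "finite ?A" by simp
  have b: "b \<in> ?A" using A assms \<rho>_ge by simp
  have i: "first_nbr H m w b \<in> ?A" unfolding first_nbr_def using Min_in[OF fin] b by blast
  then show 1: "1 \<le> first_nbr H m w b" "b \<le> \<rho> (first_nbr H m w b)" using A by auto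
  show 2: "first_nbr H m w b \<le> b" unfolding first_nbr_def using Min_le[OF fin b] .
  fix a assume a: "1 \<le> a" "a \<le> m"
  show "first_nbr H m w b \<le> a \<longleftrightarrow> b \<le> \<rho> a"
  proof
    show "first_nbr H m w b \<le> a \<Longrightarrow> b \<le> \<rho> a"
      using \<rho>_mono[of "first_nbr H m w b" a] 1 a by simp
    assume ba: "b \<le> \<rho> a"
    show "first_nbr H m w b \<le> a"
    proof (cases "a \<le> b")
      case True
      then have "a \<in> ?A" using A a ba assms \<rho>_ge[of b] by auto
      then show ?thesis unfolding first_nbr_def using Min_le[OF fin] by blast
    qed (use 2 in simp)
  qed
qed

lemma straight: "straight_ordering H m w"
  unfolding straight_ordering_def
proof (intro conjI ballI)
  fix x assume "x \<in> verts H"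
  then obtain a where a: "1 \<le> a" "a \<le> m" "w a = x" by (rule w_surj)
  have "closed_nbhd H x = w ` {first_nbr H m w a..\<rho> a}"
  proof
    show "closed_nbhd H x \<subseteq> w ` {first_nbr H m w a..\<rho> a}"
    proof
      fix u assume u: "u \<in> closed_nbhd H x"
      then obtain b where b: "1 \<le> b" "b \<le> m" "w b = u" using w_surj by (auto simp: closed_nbhd_def)
      then show "u \<in> w ` {first_nbr H m w a..\<rho> a}"
        using near_iff[of a b] u a first_nbr_in(4)[of a b] by auto
    qed
    show "w ` {first_nbr H m w a..\<rho> a} \<subseteq> closed_nbhd H x"
    proof
      fix u assume "u \<in> w ` {first_nbr H m w a..\<rho> a}"
      then obtain b where b: "first_nbr H m w a \<le> b" "b \<le> \<rho> a" "u = w b" by auto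
      then have "1 \<le> b" "b \<le> m" using first_nbr_in(1)[of a] \<rho>_le[of a] a by auto
      then show "u \<in> closed_nbhd H x" using near_iff[of a b] a b first_nbr_in(4)[of a b] by auto
    qed
  qed
  then show "\<exists>p q. 1 \<le> p \<and> q \<le> m \<and> closed_nbhd H x = w ` {p..q}"
    using first_nbr_in(1)[of a] \<rho>_le[of a] a by blast
qed (rule bij_w)

text \<open>The last index of the \<open>i\<close>-th clique in the greedy clique cover, staying at
  \<open>m\<close> once everything is covered.\<close>

primrec T :: "nat \<Rightarrow> nat" where
  "T 0 = 0"
| "T (Suc i) = (if T i < m then \<rho> (T i + 1) else m)"

declare T.simps(2) [simp del]

lemma T_Suc: "T i < m \<Longrightarrow> T (Suc i) = \<rho> (T i + 1)"
  by (simp add: T.simps(2))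

lemma T_le: "T i \<le> m"
  by (induction i) (auto simp: T.simps(2) intro: \<rho>_le)

lemma T_less_Suc: "T i < m \<Longrightarrow> T i < T (Suc i)"
  using \<rho>_ge[of "T i + 1"] by (simp add: T_Suc)

lemma T_mono: "i \<le> j \<Longrightarrow> T i \<le> T j"
proof (induction j rule: dec_induct)
  case (step j)
  then show ?case using T_less_Suc[of j] T_le[of j] by (cases "T j < m") (auto simp: T.simps(2))
qed simp

lemma T_strict: "i < j \<Longrightarrow> T i < m \<Longrightarrow> T i < T j"
  using T_less_Suc[of i] T_mono[of "Suc i" j] by simp

lemma T_reaches: "T m = m"
proof -
  have "min i m \<le> T i" for i
  proof (induction i)
    case (Suc i)
    then show ?case using T_less_Suc[of i] T_le[of i] by (cases "T i < m") (auto simp: T.simps(2))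
  qed simp
  from this[of m] show ?thesis using T_le[of m] by simp
qed

text \<open>The number of the greedy clique that contains \<open>w t\<close>, counted from 1; the
  value 0 belongs to the empty prefix \<open>t = 0\<close>.\<close>

definition rank :: "nat \<Rightarrow> nat" where
  "rank t = (LEAST i. t \<le> T i)"

lemma rank_props:
  assumes "t \<le> m"
  shows "t \<le> T (rank t)" "\<And>i. t \<le> T i \<longleftrightarrow> rank t \<le> i"
proof -
  have ex: "t \<le> T m" using assms T_reaches by simp
  show *: "t \<le> T (rank t)" unfolding rank_def by (rule LeastI) (rule ex)
  show "t \<le> T i \<longleftrightarrow> rank t \<le> i" for i
  proof
    show "t \<le> T i \<Longrightarrow> rank t \<le> i" unfolding rank_def by (rule Least_le)
    show "rank t \<le> i \<Longrightarrow> t \<le> T i" using * T_mono[of "rank t" i] by simp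
  qed
qed

lemma clique_range:
  assumes "1 \<le> a" "b \<le> \<rho> a" "b \<le> m"
  shows "clique H (w ` {a..b})"
  unfolding clique_def
proof (intro conjI ballI impI)
  show "w ` {a..b} \<subseteq> verts H" using assms w_in by auto
  fix u u' assume u: "u \<in> w ` {a..b}" "u' \<in> w ` {a..b}" "u \<noteq> u'"
  then obtain x y where x: "a \<le> x" "x \<le> b" "u = w x" and y: "a \<le> y" "y \<le> b" "u' = w y" by auto
  have r: "b \<le> \<rho> x" "b \<le> \<rho> y"
    using \<rho>_mono[of a x] \<rho>_mono[of a y] x y assms by auto
  show "adj H u u'"
  proof (cases x y rule: linorder_cases)
    case less then show ?thesis using adj_w[of x y] x y r assms by simp
  next
    case equal then show ?thesis using u x y by simp
  next
    case greater then show ?thesis using adj_w[of y x] x y r assms adj_sym[of H u u'] by simp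
  qed
qed

text \<open>Greedy cliques give the upper bound. Their first vertices \<open>w (T j + 1)\<close> are
  pairwise non-adjacent, so any clique cover needs a separate clique for each of them.\<close>

lemma cover_number_prefix:
  assumes t: "t \<le> m"
  shows "clique_cover_number (induced_subgraph H (w ` {1..t})) = rank t"
proof -
  let ?P = "induced_subgraph H (w ` {1..t})"
  have VP: "verts ?P = w ` {1..t}" using w_in t by (auto simp: verts_induced)
  have cP: "clique ?P K \<longleftrightarrow> clique H K \<and> K \<subseteq> w ` {1..t}" for K
    using w_in t unfolding clique_def VP adj_induced by auto
  let ?Q = "\<lambda>k. \<exists>\<C>. finite \<C> \<and> card \<C> = k \<and> (\<forall>K\<in>\<C>. clique ?P K) \<and> \<Union>\<C> = verts ?P"
  define F where "F j = w ` {T j + 1..min (T (Suc j)) t}" for j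
  have Fc: "clique ?P (F j)" if "j < rank t" for j
  proof -
    have "T j < t" using rank_props(2)[OF t, of j] that by simp
    then have "clique H (w ` {T j + 1..min (T (Suc j)) t})"
      using t T_Suc[of j] by (intro clique_range) auto
    then show ?thesis unfolding cP F_def by auto
  qed
  have Fu: "\<Union> (F ` {..<rank t}) = verts ?P"
  proof
    show "\<Union> (F ` {..<rank t}) \<subseteq> verts ?P" unfolding VP F_def by auto
    show "verts ?P \<subseteq> \<Union> (F ` {..<rank t})"
    proof
      fix u assume "u \<in> verts ?P"
      then obtain x where x: "1 \<le> x" "x \<le> t" "u = w x" unfolding VP by auto
      have xm: "x \<le> m" using x t by simp
      have r0: "rank x \<noteq> 0" using rank_props(1)[OF xm] x by (cases "rank x") auto
      then obtain j where j: "rank x = Suc j" using not0_implies_Suc by blast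
      have "T j < x" using rank_props(2)[OF xm, of j] j by simp
      moreover have "x \<le> T (Suc j)" using rank_props(1)[OF xm] j by simp
      moreover have "rank x \<le> rank t" using rank_props(2)[OF xm, of "rank t"] rank_props(1)[OF t] x by simp
      ultimately show "u \<in> \<Union> (F ` {..<rank t})" using x j unfolding F_def by (intro UN_I[of j]) auto
    qed
  qed
  have QF: "?Q (card (F ` {..<rank t}))"
    using Fc Fu by (intro exI[of _ "F ` {..<rank t}"]) auto
  have "clique_cover_number ?P \<le> card (F ` {..<rank t})"
    unfolding clique_cover_number_def by (rule Least_le) (rule QF)
  also have "\<dots> \<le> rank t" using card_image_le[of "{..<rank t}" F] by simp
  finally have up: "clique_cover_number ?P \<le> rank t" .
  have "?Q (clique_cover_number ?P)"
    unfolding clique_cover_number_def by (rule LeastI) (rule QF)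
  then obtain \<C> where \<C>: "finite \<C>" "card \<C> = clique_cover_number ?P" "\<And>K. K \<in> \<C> \<Longrightarrow> clique ?P K"
    "\<Union>\<C> = w ` {1..t}" unfolding VP by blast
  have Tj: "T j < t" if "j < rank t" for j using rank_props(2)[OF t, of j] that by simp
  have "\<forall>j\<in>{..<rank t}. \<exists>K. K \<in> \<C> \<and> w (T j + 1) \<in> K"
  proof
    fix j assume "j \<in> {..<rank t}"
    then have "w (T j + 1) \<in> \<Union>\<C>" unfolding \<C>(4) using Tj[of j] by auto
    then show "\<exists>K. K \<in> \<C> \<and> w (T j + 1) \<in> K" by blast
  qed
  then obtain f where f: "\<And>j. j < rank t \<Longrightarrow> f j \<in> \<C> \<and> w (T j + 1) \<in> f j"
    by (auto dest!: bchoice)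
  have neq: "f i \<noteq> f j" if ij: "i < j" "j < rank t" for i j
  proof
    assume e: "f i = f j"
    have lt: "T i + 1 < T j + 1" using T_strict[of i j] Tj[of i] t ij by simp
    have jm: "T j + 1 \<le> m" using Tj[of j] ij t by simp
    have ne: "w (T i + 1) \<noteq> w (T j + 1)" using w_inj[of "T i + 1" "T j + 1"] lt jm by auto
    have "clique H (f j)" using \<C>(3) f ij unfolding cP by blast
    then have "adj H (w (T i + 1)) (w (T j + 1))"
      using f[of i] f[of j] ij e ne unfolding clique_def by auto
    then have "T j + 1 \<le> \<rho> (T i + 1)" using adj_w[OF _ lt jm] by simp
    then have "T j + 1 \<le> T (Suc i)" using lt jm T_Suc[of i] by simp
    then show False using T_mono[of "Suc i" j] ij by simp
  qed
  have "inj_on f {..<rank t}"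
  proof (rule inj_onI)
    fix i j assume "i \<in> {..<rank t}" "j \<in> {..<rank t}" "f i = f j"
    then show "i = j" using neq[of i j] neq[of j i] by (cases i j rule: linorder_cases) auto
  qed
  then have "rank t \<le> card \<C>"
    using card_inj_on_le[of f "{..<rank t}" \<C>] f \<C>(1) by force
  then show ?thesis using up \<C>(2) by simp
qed

lemma whole: "induced_subgraph H (w ` {1..m}) = H"
proof -
  have "w ` {1..m} = verts H" using bij_w by (simp add: bij_betw_def)
  then show ?thesis
    using simple_H unfolding induced_subgraph_def simple_graph_def by (intro prod_eqI) auto
qed

lemma cover_number: "clique_cover_number H = rank m"
  using cover_number_prefix[of m] whole by simp

lemma T_below: "i < rank m \<longleftrightarrow> T i < m"
  using rank_props(2)[of m i] by auto

lemma rank_T: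
  assumes "i \<le> rank m"
  shows "rank (T i) = i"
proof (rule order_antisym)
  show "rank (T i) \<le> i" using rank_props(2)[OF T_le, of i i] by simp
  show "i \<le> rank (T i)"
  proof (rule ccontr)
    assume "\<not> i \<le> rank (T i)"
    then have lt: "rank (T i) < i" by simp
    then have "T (rank (T i)) < m" using T_below[of "rank (T i)"] assms by simp
    then have "T (rank (T i)) < T i" using T_strict lt by blast
    then show False using rank_props(1)[OF T_le, of i] by simp
  qed
qed

lemma t_index_eq:
  assumes "1 \<le> i" "i \<le> rank m"
  shows "t_index H m w i = T i"
  unfolding t_index_def
proof (rule Max_eqI)
  have "T 0 < m" using T_below[of 0] assms by simp
  then have "1 \<le> T i" using T_strict[of 0 i] assms by simp
  then show "T i \<in> {t \<in> {1..m}. clique_cover_number (induced_subgraph H (w ` {1..t})) = i}"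
    using T_le rank_T[OF assms(2)] cover_number_prefix[OF T_le, of i] by simp
  show "y \<le> T i" if "y \<in> {t \<in> {1..m}. clique_cover_number (induced_subgraph H (w ` {1..t})) = i}" for y
    using that cover_number_prefix[of y] rank_props(1)[of y] by auto
qed simp

lemma T_pos: "1 \<le> i \<Longrightarrow> 1 \<le> m \<Longrightarrow> 1 \<le> T i"
  using T_strict[of 0 i] by simp

lemma s_index_eq:
  assumes "1 \<le> i" "i \<le> rank m"
  shows "s_index H m w i = first_nbr H m w (T i)"
  using t_index_eq[OF assms] by (simp add: s_index_def)

text \<open>Both sides express that the last vertex of one greedy clique does not see the last
  vertex of the next.\<close>

lemma s_index_iff:
  assumes i: "1 \<le> i" "i < rank m"
  shows "t_index H m w i = s_index H m w (i + 1) - 1 \<longleftrightarrow> \<rho> (T i) < \<rho> (T i + 1)"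
proof -
  have lt: "T i < m" using T_below[of i] i by simp
  have T1: "1 \<le> T i" "1 \<le> T (i + 1)" "T (i + 1) \<le> m" using T_pos[of i] T_pos[of "i + 1"] lt i T_le by auto
  have Ts: "T (i + 1) = \<rho> (T i + 1)" using T_Suc[OF lt] by simp
  note fn = first_nbr_in[OF T1(2,3)]
  have le: "first_nbr H m w (T (i + 1)) \<le> T i + 1" using fn(4)[of "T i + 1"] lt Ts by simp
  have "first_nbr H m w (T (i + 1)) \<le> T i \<longleftrightarrow> T (i + 1) \<le> \<rho> (T i)" using fn(4)[of "T i"] lt T1 by simp
  then have "T i = first_nbr H m w (T (i + 1)) - 1 \<longleftrightarrow> \<not> T (i + 1) \<le> \<rho> (T i)"
    using le fn(1) by linarith
  then show ?thesis using i Ts by (simp add: t_index_eq s_index_eq not_le)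
qed

text \<open>Under \<open>A\<close>, the vertex before the \<open>i\<close>-th greedy clique is
  \<open>T (i - 1)\<close>, and \<open>B\<close> says that whatever it sees reaches no further than
  that clique: the analogue of \<open>S_reach\<close>.\<close>

lemma type_4_iff:
  assumes "two_connected H" "reduced H" "proper_interval_graph H" "rank m \<ge> 2"
    and A: "\<And>i. 1 \<le> i \<Longrightarrow> i < rank m \<Longrightarrow> \<rho> (T i) < \<rho> (T i + 1)"
    and B: "\<And>i. 2 \<le> i \<Longrightarrow> i < rank m \<Longrightarrow> \<rho> (\<rho> (T (i - 1))) \<le> T i"
  shows "type_4 H"
  unfolding type_4_def cover_number
proof (intro conjI exI ballI)
  fix i assume "i \<in> {1..rank m - 1}"
  then show "t_index H m w i = s_index H m w (i + 1) - 1"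
    using s_index_iff[of i] A[of i] assms(4) by auto
next
  fix i assume "i \<in> {2..rank m - 1}"
  then have i: "2 \<le> i" "i < rank m" using assms(4) by auto
  have "t_index H m w (i - 1) = s_index H m w i - 1"
    using s_index_iff[of "i - 1"] A[of "i - 1"] i by simp
  then have s: "s_index H m w i - 1 = T (i - 1)" using t_index_eq[of "i - 1"] i by simp
  have lt: "T i < m" "T (i - 1) < m" using T_below[of i] T_below[of "i - 1"] i by auto
  have T1: "1 \<le> T (i - 1)" using T_pos[of "i - 1"] lt i by simp
  have r: "1 \<le> \<rho> (T (i - 1))" "\<rho> (T (i - 1)) \<le> m"
    using \<rho>_ge[of "T (i - 1)"] \<rho>_le[of "T (i - 1)"] T1 lt by auto
  have "\<not> first_nbr H m w (T i + 1) \<le> \<rho> (T (i - 1))"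
    using first_nbr_in(4)[of "T i + 1" "\<rho> (T (i - 1))"] B[OF i] r lt by simp
  then show "last_nbr H m w (s_index H m w i - 1) < first_nbr H m w (t_index H m w i + 1)"
    using s last_nbr_eq[of "T (i - 1)"] T1 lt t_index_eq[of i] i by simp
qed (use assms straight in auto)

lemma connected_line:
  assumes D: "\<And>a. a \<in> D \<Longrightarrow> 1 \<le> a \<and> a \<le> m"
    and step: "\<And>a b. \<lbrakk>a \<in> D; b \<in> D; a < b; \<And>x. a < x \<Longrightarrow> x < b \<Longrightarrow> x \<notin> D\<rbrakk> \<Longrightarrow> b \<le> \<rho> a"
  shows "connected_graph (induced_subgraph H (w ` D))"
proof -
  let ?E = "{(x, y). adj (induced_subgraph H (w ` D)) x y}"
  have sym: "(x, y) \<in> ?E\<^sup>* \<Longrightarrow> (y, x) \<in> ?E\<^sup>*" for x y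
  proof -
    have "?E\<inverse> = {(x, y). adj (induced_subgraph H (w ` D)) y x}" by auto
    also have "\<dots> = ?E" by (subst adj_sym) (rule refl)
    finally have "?E\<inverse> = ?E" .
    then show "(x, y) \<in> ?E\<^sup>* \<Longrightarrow> (y, x) \<in> ?E\<^sup>*" by (metis rtrancl_converseI)
  qed
  have path: "(w a, w b) \<in> ?E\<^sup>*" if "a \<in> D" "b \<in> D" "a \<le> b" for a b
    using that
  proof (induction "b - a" arbitrary: a rule: less_induct)
    case less
    show ?case
    proof (cases "a = b")
      case False
      then have ab: "a < b" using less.prems by simp
      define y where "y = (LEAST x. a < x \<and> x \<in> D)"
      have y: "a < y \<and> y \<in> D" unfolding y_def by (rule LeastI[of _ b]) (use ab less.prems in simp)
      have yb: "y \<le> b" unfolding y_def by (rule Least_le) (use ab less.prems in simp)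
      have "x \<notin> D" if "a < x" "x < y" for x using not_less_Least[of x] that unfolding y_def by blast
      then have "y \<le> \<rho> a" using step[of a y] less.prems y by blast
      then have "adj H (w a) (w y)" using adj_w[of a y] D less.prems y by auto
      then have "(w a, w y) \<in> ?E" using less.prems y by (simp add: adj_induced)
      moreover have "(w y, w b) \<in> ?E\<^sup>*" by (rule less.hyps) (use y yb less.prems in auto)
      ultimately show ?thesis by (rule converse_rtrancl_into_rtrancl)
    qed simp
  qed
  show ?thesis
    unfolding connected_graph_def
  proof (intro ballI)
    fix u u' assume "u \<in> verts (induced_subgraph H (w ` D))" "u' \<in> verts (induced_subgraph H (w ` D))"
    then obtain a b where "a \<in> D" "b \<in> D" "u = w a" "u' = w b" by (auto simp: verts_induced)
    then show "(u, u') \<in> ?E\<^sup>*" using path[of a b] path[of b a] sym by (cases "a \<le> b") auto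
  qed
qed

text \<open>Deleting one vertex leaves consecutive indices at distance at most 2, which the reach
  bridges.\<close>

lemma two_connected_line:
  assumes "3 \<le> m" and step: "\<And>a. 1 \<le> a \<Longrightarrow> a + 2 \<le> m \<Longrightarrow> a + 2 \<le> \<rho> a"
  shows "two_connected H"
  unfolding two_connected_def
proof (intro conjI ballI)
  have s1: "b \<le> \<rho> a" if "1 \<le> a" "a < b" "b \<le> m" "b \<le> a + 2" for a b
  proof (cases "a + 2 \<le> m")
    case True then show ?thesis using step[of a] that by simp
  next
    case False
    then have b: "b = a + 1" "b = m" using that by auto
    have "b \<le> \<rho> (a - 1)" using step[of "a - 1"] b assms(1) by (cases "a = 1") auto
    moreover have "1 \<le> a - 1" "a \<le> m" using b assms(1) by auto
    ultimately show ?thesis using \<rho>_mono[of "a - 1" a] by simp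
  qed
  have "card (verts H) = m" using bij_w bij_betw_same_card by fastforce
  then show "3 \<le> card (verts H)" using assms by simp
  have "connected_graph (induced_subgraph H (w ` {1..m}))"
  proof (rule connected_line)
    fix a b assume a: "a \<in> {1..m}" "b \<in> {1..m}" "a < b" "\<And>x. a < x \<Longrightarrow> x < b \<Longrightarrow> x \<notin> {1..m}"
    then have "\<not> a + 1 < b" using a(4)[of "a + 1"] by auto
    then show "b \<le> \<rho> a" using s1[of a b] a by auto
  qed auto
  then show "connected_graph H" by (simp only: whole)
  fix u assume "u \<in> verts H"
  then obtain d where d: "1 \<le> d" "d \<le> m" "w d = u" by (rule w_surj)
  have "w ` ({1..m} - {d}) = w ` {1..m} - w ` {d}"
    by (rule inj_on_image_set_diff[OF bij_betw_imp_inj_on[OF bij_w]]) (use d in auto)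
  then have e: "verts H - {u} = w ` ({1..m} - {d})"
    using bij_w d by (simp add: bij_betw_def)
  show "connected_graph (induced_subgraph H (verts H - {u}))"
    unfolding e
  proof (rule connected_line)
    fix a b assume a: "a \<in> {1..m} - {d}" "b \<in> {1..m} - {d}" "a < b" "\<And>x. a < x \<Longrightarrow> x < b \<Longrightarrow> x \<notin> {1..m} - {d}"
    have "b \<le> a + 2"
    proof (rule ccontr)
      assume "\<not> b \<le> a + 2"
      then show False using a(4)[of "a + 1"] a(4)[of "a + 2"] a(1,2) by auto
    qed
    then show "b \<le> \<rho> a" using s1[of a b] a by auto
  qed auto
qed

lemma consecutive_adjacent:
  assumes con: "connected_graph H" and a: "1 \<le> a" "a < m"
  shows "a + 1 \<le> \<rho> a"
proof (rule ccontr)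
  assume c: "\<not> a + 1 \<le> \<rho> a"
  let ?E = "{(x, y). adj H x y}"
  have "(w a, w (a + 1)) \<in> ?E\<^sup>*" using con w_in[of a] w_in[of "a + 1"] a unfolding connected_graph_def by simp
  moreover have "y \<in> w ` {1..a}" if "(w a, y) \<in> ?E\<^sup>*" for y
    using that
  proof (induction rule: rtrancl_induct)
    case (step y z)
    then obtain x where x: "1 \<le> x" "x \<le> a" "y = w x" by auto
    have "z \<in> verts H" using step adj_verts[OF simple_H] by auto
    then obtain x' where x': "1 \<le> x'" "x' \<le> m" "z = w x'" using w_surj by metis
    have "x' \<le> a"
    proof (rule ccontr)
      assume "\<not> x' \<le> a"
      then have "x' \<le> \<rho> x" using adj_w[of x x'] step x x' by simp
      then show False using \<rho>_mono[of x a] x a c \<open>\<not> x' \<le> a\<close> by simp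
    qed
    then show ?case using x' by simp
  qed (use a in auto)
  ultimately have "w (a + 1) \<in> w ` {1..a}" by blast
  then obtain x where "x \<le> a" "1 \<le> x" "w x = w (a + 1)" by auto
  then show False using w_inj[of x "a + 1"] a by simp
qed

lemma rank_greedy:
  assumes "1 \<le> b" "b \<le> m" "1 \<le> i"
  shows "rank b = i \<longleftrightarrow> T (i - 1) < b \<and> b \<le> T i"
proof -
  have "rank b = i \<longleftrightarrow> rank b \<le> i \<and> \<not> rank b \<le> i - 1" using assms by auto
  then show ?thesis using rank_props(2)[OF assms(2), of i] rank_props(2)[OF assms(2), of "i - 1"] by auto
qed

context
  assumes t4A: "\<And>i. 1 \<le> i \<Longrightarrow> i < rank m \<Longrightarrow> \<rho> (T i) < \<rho> (T i + 1)"
    and t4B: "\<And>i. 2 \<le> i \<Longrightarrow> i < rank m \<Longrightarrow> \<rho> (\<rho> (T (i - 1))) \<le> T i"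
begin

text \<open>The counterpart of \<open>chain_alternates\<close> for greedy cliques:
  \<open>t4A\<close> keeps an edge from skipping a clique, and \<open>t4B\<close> takes the place of
  \<open>S_reach\<close>. The last clique needs no such bound since nothing follows it.\<close>

lemma rank_alternates_less:
  assumes "1 \<le> a" "a < b" "b \<le> \<rho> a" "\<rho> a < c" "c \<le> \<rho> b" "c \<le> m"
  shows "rank a = rank b \<longleftrightarrow> rank b \<noteq> rank c"
proof -
  have m: "a \<le> m" "b \<le> m" using assms \<rho>_le[of a] by auto
  have r0: "rank x \<noteq> 0" if "1 \<le> x" "x \<le> m" for x
    using rank_props(1)[OF that(2)] that(1) by (cases "rank x") auto
  have low: "T (rank x - 1) < x" if "1 \<le> x" "x \<le> m" for x
    using rank_greedy[of x "rank x"] r0[OF that] that by simp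
  have mono: "rank x \<le> rank y" if "x \<le> y" "y \<le> m" for x y
    using rank_props(2)[of x "rank y"] rank_props(1)[of y] that by simp
  define i where "i = rank a"
  have i: "1 \<le> i" using r0[of a] assms m by (simp add: i_def)
  have ai: "T (i - 1) < a" "a \<le> T i" using low[of a] rank_props(1)[of a] assms m by (auto simp: i_def)
  have im: "i \<le> rank m" using mono[of a m] m by (simp add: i_def)
  note Tst = T_Suc
  show ?thesis
  proof (cases "rank b = i")
    case True
    have "T (i - 1) + 1 \<le> a" using ai by simp
    then have "T i \<le> \<rho> a"
      using \<rho>_mono[of "T (i - 1) + 1" a] m Tst[of "i - 1"] ai i by simp
    then have "\<not> rank c \<le> i" using rank_props(2)[of c i] assms by simp
    then show ?thesis using True by (auto simp: i_def)
  next
    case False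
    then have bi: "T i < b" using mono[of a b] rank_props(2)[of b i] assms m by (auto simp: i_def)
    then have lt: "T i < m" using m by simp
    have im': "i < rank m" using T_below[of i] lt by simp
    have T1: "1 \<le> T i" using T_pos[of i] i m assms by simp
    have bT: "b \<le> \<rho> (T i)" using \<rho>_mono[of a "T i"] ai assms lt by simp
    have b2: "b \<le> T (Suc i)" using bT t4A[OF i im'] Tst[OF lt] by simp
    have rb: "rank b = Suc i" using rank_greedy[of b "Suc i"] bi b2 assms m by simp
    have "c \<le> T (Suc i)"
    proof (cases "Suc i < rank m")
      case True
      have "\<rho> b \<le> \<rho> (\<rho> (T i))" using \<rho>_mono[of b "\<rho> (T i)"] bT assms \<rho>_le[of "T i"] T1 lt by simp
      then show ?thesis using t4B[of "Suc i"] True i assms by simp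
    next
      case False
      then have "T (Suc i) = m" using T_below[of "Suc i"] T_le[of "Suc i"] by simp
      then show ?thesis using assms by simp
    qed
    then have "rank c = Suc i" using rank_greedy[of c "Suc i"] bi assms by simp
    then show ?thesis using False rb by (simp add: i_def)
  qed
qed

lemma rank_alternates:
  assumes r: "1 \<le> a" "a \<le> m" "1 \<le> b" "b \<le> m" "1 \<le> c" "c \<le> m"
    and adj: "adj H (w a) (w b)" "adj H (w b) (w c)" "w a \<noteq> w c" "\<not> adj H (w a) (w c)"
  shows "rank a = rank b \<longleftrightarrow> rank b \<noteq> rank c"
proof -
  have ne: "a \<noteq> b" "b \<noteq> c" "a \<noteq> c" using adj adj_irrefl[OF simple_H] by auto
  have near: "x \<le> \<rho> y \<and> y \<le> \<rho> x" if "adj H (w x) (w y)" "1 \<le> x" "x \<le> m" "1 \<le> y" "y \<le> m" for x y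
    using near_iff[of x y] that adj_sym[of H "w x" "w y"] w_in[of y] by (simp add: closed_nbhd_def)
  have ab: "a \<le> \<rho> b" "b \<le> \<rho> a" and bc: "b \<le> \<rho> c" "c \<le> \<rho> b" using near adj r by auto
  have nac: "\<not> (a \<le> \<rho> c \<and> c \<le> \<rho> a)"
    using near_iff[of a c] r adj ne adj_sym[of H "w c" "w a"] by (auto simp: closed_nbhd_def)
  consider "a < b" "b < c" | "c < b" "b < a" | "a < b" "c < b" | "b < a" "b < c" using ne by linarith
  then show ?thesis
  proof cases
    case 1
    have "\<rho> a < c" using nac \<rho>_ge[of c] r 1 by auto
    then show ?thesis using rank_alternates_less[of a b c] 1 r ab bc by simp
  next
    case 2
    have "\<rho> c < a" using nac \<rho>_ge[of a] r 2 by auto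
    have "rank c = rank b \<longleftrightarrow> rank b \<noteq> rank a"
      by (rule rank_alternates_less[of c b a]) (use 2 r ab bc \<open>\<rho> c < a\<close> in simp_all)
    then show ?thesis by argo
  next
    case 3
    then have "c \<le> \<rho> a" "a \<le> \<rho> c" using ab bc by auto
    then show ?thesis using nac by simp
  next
    case 4
    have "\<rho> b \<le> \<rho> a" "\<rho> b \<le> \<rho> c" using \<rho>_mono[of b a] \<rho>_mono[of b c] 4 r by auto
    then show ?thesis using nac ab bc by simp
  qed
qed

text \<open>At the front the greedy clique is the whole neighbourhood of \<open>w 1\<close>. At the
  back \<open>t4A\<close> says that no vertex of an earlier clique sees \<open>w m\<close>. This is
  what makes the blocks fit together at their ends.\<close>

lemma rank_at_ends:
  assumes "2 \<le> rank m" "1 \<le> b" "b \<le> m"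
  shows "b \<le> \<rho> 1 \<Longrightarrow> rank b = rank 1" "m \<le> \<rho> b \<Longrightarrow> rank b = rank m"
proof -
  have m1: "1 \<le> m" using assms by simp
  have T1: "T 1 = \<rho> 1" using m1 T_Suc[of 0] by simp
  have "rank 1 = 1" using rank_greedy[of 1 1] m1 T1 \<rho>_ge[of 1] by simp
  then show "b \<le> \<rho> 1 \<Longrightarrow> rank b = rank 1" using rank_greedy[of b 1] assms T1 by simp
  assume bm: "m \<le> \<rho> b"
  let ?k = "rank m"
  have lt: "T (?k - 1) < m" using T_below[of "?k - 1"] assms by simp
  have Tk: "T ?k = m" using rank_props(1)[of m] T_le[of ?k] by simp
  have "\<rho> (T (?k - 1)) < \<rho> (T (?k - 1) + 1)" using t4A[of "?k - 1"] assms by simp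
  moreover have "\<rho> (T (?k - 1) + 1) \<le> m" using \<rho>_le[of "T (?k - 1) + 1"] lt by simp
  ultimately have "\<rho> (T (?k - 1)) < m" by simp
  then have "T (?k - 1) < b"
    using \<rho>_mono[of b "T (?k - 1)"] bm assms lt by (cases "T (?k - 1) < b") auto
  then show "rank b = ?k" using rank_greedy[of b ?k] assms Tk by simp
qed

end

end

text \<open>For monotonicity, let \<open>c\<close> be the last neighbour of \<open>a\<close> and let
  \<open>b\<close> lie between \<open>a\<close> and \<open>c\<close>. The closed neighbourhood of
  \<open>w c\<close> is an interval containing both ends, hence also \<open>b\<close>.\<close>

lemma straight_line_graph:
  assumes H: "simple_graph H" and s: "straight_ordering H m w"
  shows "line_graph H m w (last_nbr H m w)"
proof -
  have bij: "bij_betw w {1..m} (verts H)" using s by (simp add: straight_ordering_def)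
  have win: "w a \<in> verts H" if "1 \<le> a" "a \<le> m" for a using bij that by (auto simp: bij_betw_def)
  have winj: "a = b" if "w a = w b" "a \<in> {1..m}" "b \<in> {1..m}" for a b
    using inj_onD[OF bij_betw_imp_inj_on[OF bij]] that by blast
  have nb: "\<exists>p. 1 \<le> p \<and> p \<le> a \<and> a \<le> last_nbr H m w a \<and> last_nbr H m w a \<le> m \<and>
      (\<forall>b\<in>{1..m}. w b \<in> closed_nbhd H (w a) \<longleftrightarrow> p \<le> b \<and> b \<le> last_nbr H m w a)" if a: "1 \<le> a" "a \<le> m" for a
  proof -
    obtain p q where pq: "1 \<le> p" "q \<le> m" "closed_nbhd H (w a) = w ` {p..q}"
      using s win[OF a] unfolding straight_ordering_def by blast
    have iff: "w b \<in> closed_nbhd H (w a) \<longleftrightarrow> p \<le> b \<and> b \<le> q" if "b \<in> {1..m}" for b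
    proof
      assume "w b \<in> closed_nbhd H (w a)"
      then obtain b' where "b' \<in> {p..q}" "w b = w b'" using pq by auto
      then show "p \<le> b \<and> b \<le> q" using winj[of b b'] that pq by auto
    qed (use pq in auto)
    have "w a \<in> closed_nbhd H (w a)" using win[OF a] by (simp add: closed_nbhd_def)
    then have pa: "p \<le> a" "a \<le> q" using iff a by auto
    have "last_nbr H m w a = q"
      unfolding last_nbr_def by (rule Max_eqI) (use iff pa pq a in auto)
    then show ?thesis using pq pa iff by (intro exI[of _ p]) simp
  qed
  have near: "adj H (w a) (w b) \<longleftrightarrow> b \<le> last_nbr H m w a" if "1 \<le> a" "a < b" "b \<le> m" for a b
  proof -
    have b: "b \<in> {1..m}" using that by simp
    have am: "1 \<le> a" "a \<le> m" using that by simp_all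
    obtain p where pq: "p \<le> a"
      "\<forall>b\<in>{1..m}. w b \<in> closed_nbhd H (w a) \<longleftrightarrow> p \<le> b \<and> b \<le> last_nbr H m w a"
      using nb[OF am] by blast
    have "w a \<noteq> w b" using winj[of a b] that by auto
    then have "adj H (w a) (w b) \<longleftrightarrow> w b \<in> closed_nbhd H (w a)"
      using win[of b] that adj_sym[of H "w a" "w b"] by (auto simp: closed_nbhd_def)
    then show ?thesis using pq b that by auto
  qed
  show ?thesis
  proof
    fix a b assume ab: "1 \<le> a" "a \<le> b" "b \<le> m"
    show "last_nbr H m w a \<le> last_nbr H m w b"
    proof (cases "a = b \<or> last_nbr H m w a \<le> b")
      case True
      then show ?thesis using nb[of b] ab by auto
    next
      case False
      define c where "c = last_nbr H m w a"
      have c: "b < c" "a < b" "c \<le> m" using False ab nb[of a] by (auto simp: c_def)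
      then have "adj H (w a) (w c)" using near[of a c] ab by (simp add: c_def)
      then have "w a \<in> closed_nbhd H (w c)" using win[of a] ab by (simp add: closed_nbhd_def)
      moreover have "1 \<le> c" using c ab by simp
      moreover obtain p where pq: "p \<le> c" "c \<le> last_nbr H m w c"
        "\<forall>b\<in>{1..m}. w b \<in> closed_nbhd H (w c) \<longleftrightarrow> p \<le> b \<and> b \<le> last_nbr H m w c"
        using nb[OF \<open>1 \<le> c\<close> c(3)] by blast
      ultimately have "w b \<in> closed_nbhd H (w c)" using ab c by auto
      then have "adj H (w b) (w c)"
        using winj[of b c] c ab by (auto simp: closed_nbhd_def)
      then show ?thesis using near[of b c] c ab by (simp add: c_def)
    qed
  next
    fix a assume "1 \<le> a" "a \<le> m"
    then show "a \<le> last_nbr H m w a" "last_nbr H m w a \<le> m" using nb[of a] by auto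
  qed (use H bij near in auto)
qed

lemma (in line_graph) type_4_conditions:
  assumes "two_connected H" "rank m \<ge> 2"
    and A: "\<forall>i\<in>{1..clique_cover_number H - 1}. t_index H m w i = s_index H m w (i + 1) - 1"
    and B: "\<forall>i\<in>{2..clique_cover_number H - 1}.
           last_nbr H m w (s_index H m w i - 1) < first_nbr H m w (t_index H m w i + 1)"
  shows "\<And>i. 1 \<le> i \<Longrightarrow> i < rank m \<Longrightarrow> \<rho> (T i) < \<rho> (T i + 1)"
    and "\<And>i. 2 \<le> i \<Longrightarrow> i < rank m \<Longrightarrow> \<rho> (\<rho> (T (i - 1))) \<le> T i"
proof -
  show *: "\<rho> (T i) < \<rho> (T i + 1)" if i: "1 \<le> i" "i < rank m" for i
    using s_index_iff[OF i] A i by (auto simp: cover_number)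
  fix i assume i: "2 \<le> i" "i < rank m"
  have "t_index H m w (i - 1) = s_index H m w i - 1"
    using s_index_iff[of "i - 1"] *[of "i - 1"] i by simp
  then have s: "s_index H m w i - 1 = T (i - 1)" using t_index_eq[of "i - 1"] i by simp
  have lt: "T i < m" "T (i - 1) < m" using T_below[of i] T_below[of "i - 1"] i by auto
  have T1: "1 \<le> T (i - 1)" using T_pos[of "i - 1"] lt i by simp
  have r: "1 \<le> \<rho> (T (i - 1))" "\<rho> (T (i - 1)) \<le> m"
    using \<rho>_ge[of "T (i - 1)"] \<rho>_le[of "T (i - 1)"] T1 lt by auto
  have "last_nbr H m w (T (i - 1)) < first_nbr H m w (T i + 1)"
    using B[rule_format, of i] i s t_index_eq[of i] by (simp add: cover_number)
  then show "\<rho> (\<rho> (T (i - 1))) \<le> T i"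
    using first_nbr_in(4)[of "T i + 1" "\<rho> (T (i - 1))"] last_nbr_eq[of "T (i - 1)"] T1 r lt by simp
qed

section \<open>Weak blocks\<close>

lemma closed_nbhd_sym: "u \<in> verts B \<Longrightarrow> x \<in> closed_nbhd B u \<Longrightarrow> u \<in> closed_nbhd B x"
  using adj_sym[of B x u] by (auto simp: closed_nbhd_def)

text \<open>Equality of neighbourhoods lifts from the reduction to \<open>B\<close>: every vertex of
  \<open>B\<close> has a twin in \<open>R\<close>, through which its adjacencies can be
  tested.\<close>

lemma reduction_reduced:
  assumes "reduction_of B H"
  shows "reduced H"
proof -
  obtain R where R0: "R \<subseteq> verts B \<and> (\<forall>u\<in>verts B. \<exists>!r. r \<in> R \<and> closed_nbhd B r = closed_nbhd B u) \<and>
      H = induced_subgraph B R"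
    using assms unfolding reduction_of_def by (elim exE)
  note R = R0[THEN conjunct1] R0[THEN conjunct2, THEN conjunct2]
    R0[THEN conjunct2, THEN conjunct1, THEN bspec]
  have VH: "verts H = R" using R by (auto simp: verts_induced)
  have N: "x \<in> closed_nbhd H u \<longleftrightarrow> x \<in> R \<and> x \<in> closed_nbhd B u" if "u \<in> R" for x u
    using that R(1) unfolding closed_nbhd_def VH by (auto simp: R(2) adj_induced)
  have sub: "closed_nbhd B u \<subseteq> closed_nbhd B u'"
    if u: "u \<in> R" "u' \<in> R" and eq: "closed_nbhd H u = closed_nbhd H u'" for u u'
  proof
    fix z assume z: "z \<in> closed_nbhd B u"
    then have zB: "z \<in> verts B" by (simp add: closed_nbhd_def)
    obtain z' where z': "z' \<in> R" "closed_nbhd B z' = closed_nbhd B z" using R(3)[OF zB] by blast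
    have "u \<in> closed_nbhd B z'" using closed_nbhd_sym[OF _ z] u R(1) z' by auto
    then have "z' \<in> closed_nbhd B u" using closed_nbhd_sym[of z' B u] z' R(1) by blast
    then have "z' \<in> closed_nbhd B u'" using N[OF u(1)] N[OF u(2)] eq z' by blast
    then have "u' \<in> closed_nbhd B z" using closed_nbhd_sym[of z' B u'] closed_nbhd_sym[of u' B z'] u R(1) z' by blast
    then show "z \<in> closed_nbhd B u'" using closed_nbhd_sym[OF zB] by blast
  qed
  show ?thesis
    unfolding reduced_def VH
  proof (intro ballI impI notI)
    fix u u' assume u: "u \<in> R" "u' \<in> R" "u \<noteq> u'" "closed_nbhd H u = closed_nbhd H u'"
    then have "closed_nbhd B u = closed_nbhd B u'" using sub[of u u'] sub[of u' u] by auto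
    then show False using R(1,3) u by blast
  qed
qed

context round_graph
begin

lemma clique_arc_iff: "a < b \<Longrightarrow> b < a + N \<Longrightarrow> clique G (v ` {a..b}) \<longleftrightarrow> b \<le> fwd a"
  using fwd_max[of a b] fwd_clique[of b a] by auto

lemma verts_arc: "verts (arc_subgraph G v i j) = v ` {i..j}"
  by (simp add: arc_subgraph_def)

lemma arc_shift: "arc_subgraph G v (i + N) (j + N) = arc_subgraph G v i j"
proof -
  have "{{v a, v b} |a b. i + N \<le> a \<and> a < b \<and> b \<le> j + N \<and> clique G (v ` {a..b})} =
      {{v a, v b} |a b. i \<le> a \<and> a < b \<and> b \<le> j \<and> clique G (v ` {a..b})}" (is "?A = ?B")
  proof
    show "?A \<subseteq> ?B"
    proof
      fix e assume "e \<in> ?A"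
      then obtain a b where "e = {v a, v b}" "i + N \<le> a" "a < b" "b \<le> j + N" "clique G (v ` {a..b})" by blast
      then show "e \<in> ?B" using v_per[of "a - N"] v_per[of "b - N"] v_shift[of "a - N" 1 "b - N"]
        by (intro CollectI exI[of _ "a - N"] exI[of _ "b - N"]) simp
    qed
    show "?B \<subseteq> ?A"
    proof
      fix e assume "e \<in> ?B"
      then obtain a b where "e = {v a, v b}" "i \<le> a" "a < b" "b \<le> j" "clique G (v ` {a..b})" by blast
      then show "e \<in> ?A" using v_per[of a] v_per[of b] v_shift[of a 1 b]
        by (intro CollectI exI[of _ "a + N"] exI[of _ "b + N"]) simp
    qed
  qed
  then show ?thesis using v_shift[of i 1 j] by (simp add: arc_subgraph_def)
qed

text \<open>The edges inside a class are to get one colour and the other edges of the block the other one.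
  Since the edges at the ends of the block all get the first colour, the blocks can be coloured separately
  and glued with swapped colours.\<close>

definition block_classes :: "'a graph \<Rightarrow> ('a \<Rightarrow> nat) \<Rightarrow> bool" where
  "block_classes B \<kappa> \<longleftrightarrow>
     (\<forall>x y z. adj B x y \<longrightarrow> adj B y z \<longrightarrow> x \<noteq> z \<longrightarrow> \<not> adj B x z \<longrightarrow> (\<kappa> x = \<kappa> y \<longleftrightarrow> \<kappa> y \<noteq> \<kappa> z)) \<and>
     (\<forall>x y. pseudo_cutvertex G v x \<longrightarrow> adj B x y \<longrightarrow> \<kappa> x = \<kappa> y)"

context
  fixes p q :: int
  assumes p: "pseudo p" and q: "pseudo q" and pq: "p < q" "q < p + N"
    and between: "\<And>u. p < u \<Longrightarrow> u < q \<Longrightarrow> \<not> pseudo u"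
begin

abbreviation B :: "'a graph" where "B \<equiv> arc_subgraph G v p q"

lemma inj_block: "inj_on v {p..q}"
  by (rule inj_window) (rule pq)

lemma v_block: "v a = v b \<longleftrightarrow> a = b" if "p \<le> a" "a \<le> q" "p \<le> b" "b \<le> q"
  using inj_onD[OF inj_block, of a b] that by auto

lemma adj_block:
  assumes "p \<le> a" "a < b" "b \<le> q"
  shows "adj B (v a) (v b) \<longleftrightarrow> b \<le> fwd a"
proof
  assume "adj B (v a) (v b)"
  then obtain x y where xy: "{v a, v b} = {v x, v y}" "p \<le> x" "x < y" "y \<le> q" "clique G (v ` {x..y})"
    by (auto simp: adj_def arc_subgraph_def)
  then have "(v a = v x \<and> v b = v y) \<or> (v a = v y \<and> v b = v x)" by (auto simp: doubleton_eq_iff)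
  then have "(a = x \<and> b = y) \<or> (a = y \<and> b = x)"
    using v_block[of a x] v_block[of b y] v_block[of a y] v_block[of b x] xy assms by auto
  then have "a = x" "b = y" using assms xy by auto
  then show "b \<le> fwd a" using xy clique_arc_iff[of a b] pq by simp
next
  assume "b \<le> fwd a"
  then have "clique G (v ` {a..b})" by (rule fwd_clique)
  then show "adj B (v a) (v b)" using assms by (auto simp: adj_def arc_subgraph_def)
qed

lemma simple_block: "simple_graph B"
  unfolding simple_graph_def
proof (intro conjI ballI)
  fix e assume "e \<in> edges B"
  then obtain a b where e: "e = {v a, v b}" "p \<le> a" "a < b" "b \<le> q" by (auto simp: arc_subgraph_def)
  then show "e \<subseteq> verts B" by (simp add: verts_arc)
  have "v a \<noteq> v b" using v_block[of a b] e by simp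
  then show "card e = 2" using e by simp
qed (simp add: verts_arc)

lemma near_block:
  assumes "p \<le> x" "x \<le> q" "p \<le> y" "y \<le> q"
  shows "v y \<in> closed_nbhd B (v x) \<longleftrightarrow> y \<le> fwd x \<and> x \<le> fwd y"
proof (cases x y rule: linorder_cases)
  case less
  then have "x \<le> fwd y" using fwd_gt[of y] by simp
  then show ?thesis
    using less assms adj_block[of x y] v_block[of x y] adj_sym[of B "v x" "v y"]
    by (auto simp: closed_nbhd_def verts_arc)
next
  case equal
  then show ?thesis using assms fwd_gt[of x] by (simp add: closed_nbhd_def verts_arc)
next
  case greater
  then have "y \<le> fwd x" using fwd_gt[of x] by simp
  then show ?thesis
    using greater assms adj_block[of y x] v_block[of x y] by (auto simp: closed_nbhd_def verts_arc)
qed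

lemma block_vertex:
  assumes "u \<in> verts B"
  obtains x where "p \<le> x" "x \<le> q" "u = v x"
  using assms by (auto simp: verts_arc)

lemma nbhd_eqI:
  assumes "p \<le> x" "x \<le> q" "p \<le> y" "y \<le> q"
    and "\<And>z. p \<le> z \<Longrightarrow> z \<le> q \<Longrightarrow> z \<le> fwd x \<and> x \<le> fwd z \<longleftrightarrow> z \<le> fwd y \<and> y \<le> fwd z"
  shows "closed_nbhd B (v x) = closed_nbhd B (v y)"
proof -
  have "u \<in> closed_nbhd B (v x) \<longleftrightarrow> u \<in> closed_nbhd B (v y)" if "u \<in> verts B" for u
    using that near_block assms by (metis block_vertex)
  then show ?thesis by (auto simp: closed_nbhd_def)
qed

lemma block_pseudo_ends: "u \<in> verts B \<Longrightarrow> pseudo_cutvertex G v u \<longleftrightarrow> u = v p \<or> u = v q"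
proof -
  assume "u \<in> verts B"
  then obtain x where x: "p \<le> x" "x \<le> q" "u = v x" by (rule block_vertex)
  have "pseudo x \<longleftrightarrow> x = p \<or> x = q" using between[of x] p q x by force
  then show ?thesis using x v_block[of x p] v_block[of x q] pseudo_cutvertex_iff[of x] pq by simp
qed

lemma block_is_weak: "weak_block G n v B"
  unfolding weak_block_def
proof (intro exI conjI)
  show "{x \<in> verts B. pseudo_cutvertex G v x} = {v p, v q}"
    using block_pseudo_ends pq by (auto simp: verts_arc)
qed (use pq in auto)

lemma complete_block: "q \<le> fwd p \<Longrightarrow> complete_graph B"
  unfolding complete_graph_def clique_def
proof (intro conjI ballI impI)
  assume f: "q \<le> fwd p"
  fix a b assume ab: "a \<in> verts B" "b \<in> verts B" "a \<noteq> b"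
  obtain x y where x: "p \<le> x" "x \<le> q" "a = v x" and y: "p \<le> y" "y \<le> q" "b = v y"
    using ab block_vertex by metis
  have "q \<le> fwd x" "q \<le> fwd y" using fwd_mono[of p x] fwd_mono[of p y] f x y by auto
  then have "b \<in> closed_nbhd B a" using near_block[of x y] x y by simp
  then show "adj B a b" using ab(3) adj_sym[of B a b] by (auto simp: closed_nbhd_def)
qed simp

lemma complete_classes: "complete_graph B \<Longrightarrow> block_classes B (\<lambda>_. 0)"
  using adj_verts[OF simple_block] unfolding block_classes_def complete_graph_def clique_def by blast

context
  assumes incomplete: "fwd p < q"
begin

lemma step_block: "p < x + 1 \<Longrightarrow> x + 1 < q \<Longrightarrow> x + 2 \<le> fwd x"
  using nonpseudo_r[OF between[of "x + 1"]] by simp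

lemma bwd_q: "p < bwd q"
  using incomplete gal[of q p] by linarith

text \<open>The ends of the block may be twins of their neighbours; the reduction keeps the neighbours.\<close>

definition p' :: int where "p' = (if fwd (p + 1) = fwd p then p + 1 else p)"
definition q' :: int where "q' = (if bwd (q - 1) = bwd q then q - 1 else q)"

lemma p'_props: "p \<le> p'" "p' \<le> p + 1" "fwd p' = fwd p" and q'_props: "q' \<le> q" "q - 1 \<le> q'"
  by (auto simp: p'_def q'_def)

text \<open>Consecutive vertices differ in \<open>fwd\<close> or \<open>bwd\<close>. Inside the
  block this difference disappears only if it is cut off at \<open>p\<close> or \<open>q\<close>,
  which happens only at the ends, where \<open>p'\<close> and \<open>q'\<close> have removed the
  twin.\<close>

lemma nbhd_distinct:
  assumes "p' \<le> x" "x < y" "y \<le> q'"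
  shows "closed_nbhd B (v x) \<noteq> closed_nbhd B (v y)"
proof
  assume eq: "closed_nbhd B (v x) = closed_nbhd B (v y)"
  have r: "p \<le> x" "y \<le> q" using assms p'_props q'_props by auto
  have z: "z \<le> fwd x \<and> x \<le> fwd z \<longleftrightarrow> z \<le> fwd y \<and> y \<le> fwd z" if "p \<le> z" "z \<le> q" for z
    using eq near_block[of x z] near_block[of y z] that r assms by simp
  have 1: "min q (fwd y) \<le> fwd x"
    using z[of "min q (fwd y)"] r assms fwd_gt[of y] fwd_gt[of "min q (fwd y)"] by auto
  have 2: "bwd y \<le> max p (bwd x)"
  proof -
    let ?z = "max p (bwd x)"
    have "?z \<le> x" using r l_lt[of x] by simp
    moreover have "x \<le> fwd ?z" using gal[of x ?z] by simp
    ultimately have "y \<le> fwd ?z" using z[of ?z] r assms fwd_gt[of x] by simp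
    then show ?thesis using gal by blast
  qed
  from red[of x] show False
  proof
    assume f: "fwd x < fwd (x + 1)"
    have "fwd (x + 1) \<le> fwd y" using fwd_mono[of "x + 1" y] assms by simp
    then have qf: "q \<le> fwd x" using 1 f by simp
    have "\<not> x + 1 < q" using pseudo_r_le[OF q, of "x + 1"] f qf by auto
    then have e: "x = q - 1" "y = q" "q' = q" using assms q'_props by auto
    then have "bwd (q - 1) \<noteq> bwd q" by (auto simp: q'_def split: if_splits)
    then have "bwd (q - 1) < bwd q" using l_mono[of "q - 1" q] by simp
    then show False using 2 e bwd_q by simp
  next
    assume b: "bwd x < bwd (x + 1)"
    have "bwd (x + 1) \<le> bwd y" using l_mono[of "x + 1" y] assms by simp
    then have "bwd y \<le> p" "bwd x < p" using 2 b by auto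
    have "\<not> p < x" using pseudo_l_ge[OF p, of x] \<open>bwd x < p\<close> by linarith
    then have e: "x = p" "p' = p" using r assms p'_props by linarith+
    then have "fwd (p + 1) \<noteq> fwd p" by (auto simp: p'_def split: if_splits)
    moreover have "fwd (p + 1) \<le> fwd y" using fwd_mono[of "p + 1" y] assms e by simp
    moreover have "fwd y \<le> fwd p" using 1 e incomplete by simp
    ultimately show False using fwd_mono[of p "p + 1"] by simp
  qed
qed

definition H :: "'a graph" where "H = induced_subgraph B (v ` {p'..q'})"

lemma sub_block: "v ` {p'..q'} \<subseteq> verts B"
  using p'_props q'_props by (auto simp: verts_arc)

lemma verts_H: "verts H = v ` {p'..q'}"
  using sub_block by (auto simp: H_def verts_induced)

context
  fixes S
  assumes chain: "clique_chain fwd bwd S"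
begin

interpretation ch: clique_chain fwd bwd S by (rule chain)

text \<open>The tile after the one starting at \<open>p\<close> begins at \<open>fwd p + 1\<close>.
  By \<open>S_next\<close> this is not a pseudo-cutvertex and so differs from
  \<open>q\<close>.\<close>

lemma first_clique: "p + 2 \<le> fwd p" "fwd p + 2 \<le> q" "fwd p < q'" "p' + 2 \<le> q'"
proof -
  have f1: "p + 1 < q" using incomplete fwd_gt[of p] by simp
  then show a: "p + 2 \<le> fwd p" using step_block[of p] by simp
  have "\<not> pseudo (fwd p)" using between[of "fwd p"] incomplete fwd_gt[of p] by simp
  then have "\<not> pseudo (fwd p + 1)" using ch.S_next[OF ch.pseudo_S[OF p]] by blast
  then have "fwd p + 1 \<noteq> q" using q by auto
  then show b: "fwd p + 2 \<le> q" using incomplete by simp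
  show "fwd p < q'" "p' + 2 \<le> q'" using a b p'_props q'_props by auto
qed

lemma reduction_H: "reduction_of B H"
  unfolding reduction_of_def
proof (intro exI[of _ "v ` {p'..q'}"] conjI ballI)
  note fc = first_clique
  fix u assume "u \<in> verts B"
  then obtain x where x: "p \<le> x" "x \<le> q" "u = v x" by (rule block_vertex)
  have "\<exists>y\<in>{p'..q'}. closed_nbhd B (v y) = closed_nbhd B (v x)"
  proof -
    consider "x \<in> {p'..q'}" | "x = p" "p' = p + 1" | "x = q" "q' = q - 1"
      using x p'_props q'_props by force
    then show ?thesis
    proof cases
      case 2
      have "closed_nbhd B (v (p + 1)) = closed_nbhd B (v p)"
      proof (rule nbhd_eqI)
        fix z assume "p \<le> z" "z \<le> q"
        then show "z \<le> fwd (p + 1) \<and> p + 1 \<le> fwd z \<longleftrightarrow> z \<le> fwd p \<and> p \<le> fwd z"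
          using 2 p'_props fwd_gt[of z] by auto
      qed (use fc in auto)
      then show ?thesis using 2 fc by (intro bexI[of _ "p + 1"]) auto
    next
      case 3
      have b: "bwd (q - 1) = bwd q" using 3 by (simp add: q'_def split: if_splits)
      have "closed_nbhd B (v (q - 1)) = closed_nbhd B (v q)"
      proof (rule nbhd_eqI)
        fix z assume "p \<le> z" "z \<le> q"
        then show "z \<le> fwd (q - 1) \<and> q - 1 \<le> fwd z \<longleftrightarrow> z \<le> fwd q \<and> q \<le> fwd z"
          using fwd_gt[of q] fwd_gt[of "q - 1"] gal[of "q - 1" z] gal[of q z] b by auto
      qed (use pq in auto)
      then show ?thesis using 3 fc by (intro bexI[of _ "q - 1"]) auto
    qed blast
  qed
  then obtain y where y: "y \<in> {p'..q'}" "closed_nbhd B (v y) = closed_nbhd B u" using x by blast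
  show "\<exists>!r. r \<in> v ` {p'..q'} \<and> closed_nbhd B r = closed_nbhd B u"
  proof (rule ex1I[of _ "v y"])
    fix r assume "r \<in> v ` {p'..q'} \<and> closed_nbhd B r = closed_nbhd B u"
    then obtain z where z: "z \<in> {p'..q'}" "r = v z" "closed_nbhd B (v z) = closed_nbhd B (v y)" using y by auto
    then show "r = v y"
      using nbhd_distinct[of z y] nbhd_distinct[of y z] y by (cases z y rule: linorder_cases) auto
  qed (use y in auto)
qed (simp_all add: sub_block H_def)

definition m :: nat where "m = nat (q' - p' + 1)"
text \<open>The offset that lets the indices of \<open>w\<close> start at 1.\<close>

definition o' :: int where "o' = p' - 1"
definition w :: "nat \<Rightarrow> 'a" where "w k = v (o' + int k)"
definition \<rho> :: "nat \<Rightarrow> nat" where "\<rho> k = nat (min (fwd (o' + int k)) q' - o')"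

lemma m_int: "int m = q' - o'"
  using first_clique by (simp add: m_def o'_def)

lemma \<rho>_int: "1 \<le> k \<Longrightarrow> k \<le> m \<Longrightarrow> int (\<rho> k) = min (fwd (o' + int k)) q' - o'"
  using fwd_gt[of "o' + int k"] m_int by (simp add: \<rho>_def)

lemma adj_H:
  assumes "p' \<le> x" "x < y" "y \<le> q'"
  shows "adj H (v x) (v y) \<longleftrightarrow> y \<le> fwd x"
  using adj_block[of x y] assms p'_props q'_props by (auto simp: H_def adj_induced)

lemma simple_H: "simple_graph H"
  using simple_block unfolding simple_graph_def H_def induced_subgraph_def by auto

lemma line_H: "line_graph H m w \<rho>"
proof
  show "simple_graph H" by (rule simple_H)
  show "bij_betw w {1..m} (verts H)"
  proof (rule bij_betw_imageI)
    show "inj_on w {1..m}"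
    proof (rule inj_onI)
      fix a b assume "a \<in> {1..m}" "b \<in> {1..m}" "w a = w b"
      then show "a = b" using v_block[of "o' + int a" "o' + int b"] m_int p'_props q'_props
        by (simp add: w_def o'_def)
    qed
    show "w ` {1..m} = verts H"
    proof
      show "w ` {1..m} \<subseteq> verts H" using m_int by (auto simp: w_def verts_H o'_def)
      show "verts H \<subseteq> w ` {1..m}"
      proof
        fix u assume "u \<in> verts H"
        then obtain x where "p' \<le> x" "x \<le> q'" "u = v x" by (auto simp: verts_H)
        then show "u \<in> w ` {1..m}"
          using m_int by (intro image_eqI[of _ _ "nat (x - o')"]) (auto simp: w_def o'_def)
      qed
    qed
  qed
  fix a b :: nat
  show "adj H (w a) (w b) \<longleftrightarrow> b \<le> \<rho> a" if "1 \<le> a" "a < b" "b \<le> m"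
    using adj_H[of "o' + int a" "o' + int b"] \<rho>_int[of a] that m_int by (simp add: w_def o'_def) linarith
  show "\<rho> a \<le> \<rho> b" if "1 \<le> a" "a \<le> b" "b \<le> m"
    using \<rho>_int[of a] \<rho>_int[of b] fwd_mono[of "o' + int a" "o' + int b"] that by simp
  show "a \<le> \<rho> a" "\<rho> a \<le> m" if "1 \<le> a" "a \<le> m"
    using \<rho>_int[of a] fwd_gt[of "o' + int a"] that m_int by auto
qed

interpretation lg: line_graph H m w \<rho> by (rule line_H)

text \<open>The greedy cover of \<open>H\<close> is the tiling restricted to the block. Its first
  clique may begin at \<open>p + 1\<close> although the tile begins at \<open>p\<close>, with the
  same end; this is why the clause about \<open>s\<close> asks for \<open>2 \<le> i\<close>.\<close>

lemma greedy_starts: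
  assumes "1 \<le> i" "lg.T i < m"
  shows "\<exists>s\<in>S. p \<le> s \<and> fwd s = o' + int (lg.T i) \<and> \<not> pseudo (fwd s) \<and> fwd s < q' \<and>
    (2 \<le> i \<longrightarrow> s = o' + int (lg.T (i - 1)) + 1)"
  using assms
proof (induction i rule: dec_induct)
  case base
  have "lg.T 1 = \<rho> 1" using lg.T_Suc[of 0] base by simp
  moreover have "int (\<rho> 1) = fwd p - o'"
    using \<rho>_int[of 1] p'_props(3) first_clique(3) base by (simp add: o'_def)
  ultimately have "fwd p = o' + int (lg.T 1)" by simp
  moreover have "\<not> pseudo (fwd p)" using between[of "fwd p"] incomplete fwd_gt[of p] by simp
  ultimately show ?case using ch.pseudo_S[OF p] first_clique(3) by (intro bexI[of _ p]) auto
next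
  case (step i)
  have lt: "lg.T i < m" using step.prems lg.T_mono[of i "Suc i"] by simp
  then obtain s where s: "s \<in> S" "p \<le> s" "fwd s = o' + int (lg.T i)" "\<not> pseudo (fwd s)" "fwd s < q'"
    using step.IH by blast
  let ?s = "fwd s + 1"
  have s': "?s \<in> S" using ch.S_next s by blast
  have "lg.T (Suc i) = \<rho> (lg.T i + 1)" by (rule lg.T_Suc) (rule lt)
  moreover have "int (\<rho> (lg.T i + 1)) = min (fwd ?s) q' - o'"
    using \<rho>_int[of "lg.T i + 1"] lt s(3) by (simp add: algebra_simps)
  ultimately have T: "int (lg.T (Suc i)) = min (fwd ?s) q' - o'" by simp
  then have lq: "fwd ?s < q'" using step.prems m_int by simp
  have "p < fwd ?s" using s fwd_gt[of s] fwd_gt[of ?s] by simp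
  then have "\<not> pseudo (fwd ?s)" using between lq q'_props by simp
  moreover have "p \<le> ?s" using s fwd_gt[of s] by simp
  ultimately show ?case using s' s(3) T lq by (intro bexI[of _ ?s]) auto
qed

text \<open>After cutting off at \<open>q'\<close>, \<open>S_less\<close> becomes the first
  condition of type 4 and \<open>S_reach\<close> the second.\<close>

lemma type_4_H: "type_4 H"
proof -
  have m3: "3 \<le> m" using m_int first_clique(4) by (simp add: o'_def)
  have tc: "two_connected H"
  proof (rule lg.two_connected_line[OF m3])
    fix a :: nat assume a: "1 \<le> a" "a + 2 \<le> m"
    have "o' + int a + 2 \<le> fwd (o' + int a)"
      by (rule step_block) (use a m_int p'_props q'_props in \<open>auto simp: o'_def\<close>)
    then show "a + 2 \<le> \<rho> a" using \<rho>_int[of a] a m_int by simp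
  qed
  have pig: "proper_interval_graph H"
  proof (rule proper_interval_graph_reach[of "the_inv_into {p..q} v" H fwd])
    have inv: "the_inv_into {p..q} v (v x) = x" if "p \<le> x" "x \<le> q" for x
      using the_inv_into_f_f[OF inj_block, of x] that by simp
    show "inj_on (the_inv_into {p..q} v) (verts H)"
      unfolding verts_H by (rule inj_onI) (use inv p'_props q'_props in auto)
    fix u u' assume u: "u \<in> verts H" "u' \<in> verts H" "the_inv_into {p..q} v u < the_inv_into {p..q} v u'"
    then obtain x y where "p' \<le> x" "x \<le> q'" "u = v x" "p' \<le> y" "y \<le> q'" "u' = v y" by (auto simp: verts_H)
    then show "adj H u u' \<longleftrightarrow> the_inv_into {p..q} v u' \<le> fwd (the_inv_into {p..q} v u)"
      using inv[of x] inv[of y] adj_H[of x y] u(3) p'_props q'_props by simp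
  qed (use fwd_mono fwd_in(1) in auto)
  have T1: "lg.T 1 < m"
  proof -
    have "lg.T 1 = \<rho> 1" using lg.T_Suc[of 0] m3 by simp
    moreover have "int (\<rho> 1) = fwd p - o'"
      using \<rho>_int[of 1] p'_props(3) first_clique(3) m3 by (simp add: o'_def)
    ultimately show ?thesis using m_int first_clique(3) by simp
  qed
  show ?thesis
  proof (rule lg.type_4_iff[OF tc reduction_reduced[OF reduction_H] pig])
    show "2 \<le> lg.rank m" using lg.T_below[of 1] T1 by simp
  next
    fix i assume i: "1 \<le> i" "i < lg.rank m"
    then have lt: "lg.T i < m" using lg.T_below by blast
    then obtain s where s: "s \<in> S" "p \<le> s" "fwd s = o' + int (lg.T i)" "\<not> pseudo (fwd s)" "fwd s < q'"
      using greedy_starts[OF i(1)] by blast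
    let ?t = "fwd s"
    have s': "?t + 1 \<in> S" "\<not> pseudo (?t + 1)" using ch.S_next[OF s(1,4)] by auto
    have tq: "?t + 1 < q" using s'(2) q s(5) q'_props by (cases "?t + 1 = q") auto
    have f: "fwd ?t < fwd (?t + 1)" using ch.S_less[OF s'(1)] by simp
    have fq: "fwd (?t + 1) \<le> q" by (rule pseudo_r_le[OF q tq])
    \<comment> \<open>If \<open>q\<close> was dropped, \<open>q - 1\<close> and \<open>q\<close>
      have the same first neighbour. Whatever reaches \<open>q - 1\<close> then reaches
      \<open>q\<close>, so cutting off at \<open>q'\<close> does not destroy the strict
      inequality.\<close>
    have "fwd ?t < q'"
    proof (cases "q' = q")
      case True then show ?thesis using f fq by simp
    next
      case False
      then have b: "bwd (q - 1) = bwd q" "q' = q - 1" by (auto simp: q'_def split: if_splits)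
      show ?thesis
      proof (rule ccontr)
        assume "\<not> fwd ?t < q'"
        then have "bwd (q - 1) \<le> ?t" using gal[of "q - 1" ?t] b by simp
        then have "q \<le> fwd ?t" using gal[of q ?t] b by simp
        then show False using f fq by simp
      qed
    qed
    moreover have "int (\<rho> (lg.T i)) = min (fwd ?t) q' - o'"
      using \<rho>_int[of "lg.T i"] lt s(3) lg.T_pos[of i] i m3 by simp
    moreover have "int (\<rho> (lg.T i + 1)) = min (fwd (?t + 1)) q' - o'"
      using \<rho>_int[of "lg.T i + 1"] lt s(3) by (simp add: algebra_simps)
    ultimately show "\<rho> (lg.T i) < \<rho> (lg.T i + 1)" using f by simp
  next
    fix i assume i: "2 \<le> i" "i < lg.rank m"
    then have lt: "lg.T i < m" "lg.T (i - 1) < m" using lg.T_below[of i] lg.T_below[of "i - 1"] by auto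
    then obtain s where s: "s \<in> S" "fwd s = o' + int (lg.T i)" "s = o' + int (lg.T (i - 1)) + 1"
      using greedy_starts[of i] i by auto
    let ?k = "\<rho> (lg.T (i - 1))"
    have T1: "1 \<le> lg.T (i - 1)" using lg.T_pos[of "i - 1"] i m3 by simp
    have k: "int ?k = min (fwd (s - 1)) q' - o'" using \<rho>_int[of "lg.T (i - 1)"] T1 lt s(3) by simp
    have k1: "1 \<le> ?k" "?k \<le> m"
      using lg.\<rho>_ge[of "lg.T (i - 1)"] lg.\<rho>_le[of "lg.T (i - 1)"] T1 lt by auto
    have "fwd (o' + int ?k) \<le> fwd (fwd (s - 1))" using k by (intro fwd_mono) simp
    also have "\<dots> \<le> fwd s" by (rule ch.S_reach[OF s(1)])
    finally show "\<rho> ?k \<le> lg.T i" using \<rho>_int[OF k1] s(2) by simp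
  qed
qed

lemma weak_block_type_4: "weak_block_of_type_4 B"
  unfolding weak_block_of_type_4_def using reduction_H type_4_H by blast

end

text \<open>The first and the last vertex of a straight ordering of the reduction are simplicial and their
  closed neighbourhoods do not separate it. Only the (classes of the) ends of the block
  have this property, so the ordering begins and ends there.\<close>

context
  fixes K :: "'a graph" and R :: "'a set" and k :: nat and x :: "nat \<Rightarrow> 'a" and \<sigma> :: "nat \<Rightarrow> nat"
  assumes R_sub: "R \<subseteq> verts B"
    and R_rep: "\<And>u. u \<in> verts B \<Longrightarrow> \<exists>!r. r \<in> R \<and> closed_nbhd B r = closed_nbhd B u"
    and K_def: "K = induced_subgraph B R"
    and line_K: "line_graph K k x \<sigma>"
    and con_K: "connected_graph K"
begin

interpretation lk: line_graph K k x \<sigma> by (rule line_K)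

lemma verts_K: "verts K = R"
  using R_sub by (auto simp: K_def verts_induced)

lemma x_R: "1 \<le> a \<Longrightarrow> a \<le> k \<Longrightarrow> x a \<in> R"
  using lk.w_in verts_K by simp

lemma x_B: "1 \<le> a \<Longrightarrow> a \<le> k \<Longrightarrow> x a \<in> verts B"
  using x_R R_sub by blast

lemma near_K:
  assumes "1 \<le> a" "a \<le> k" "1 \<le> b" "b \<le> k"
  shows "x b \<in> closed_nbhd B (x a) \<longleftrightarrow> a \<le> \<sigma> b \<and> b \<le> \<sigma> a"
proof -
  have "x b \<in> closed_nbhd B (x a) \<longleftrightarrow> x b \<in> closed_nbhd K (x a)"
    using x_R[of a] x_R[of b] x_B[of b] assms unfolding closed_nbhd_def verts_K by (simp add: K_def adj_induced)
  then show ?thesis using lk.near_iff[OF assms] by simp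
qed

text \<open>The position in the ordering of the representative of \<open>u\<close>; it is also
  defined for vertices dropped by the reduction.\<close>

definition ix :: "'a \<Rightarrow> nat" where
  "ix u = (SOME a. 1 \<le> a \<and> a \<le> k \<and> closed_nbhd B (x a) = closed_nbhd B u)"

lemma ix_props:
  assumes "u \<in> verts B"
  shows "1 \<le> ix u" "ix u \<le> k" "closed_nbhd B (x (ix u)) = closed_nbhd B u"
proof -
  obtain r where r: "r \<in> R" "closed_nbhd B r = closed_nbhd B u" using R_rep[OF assms] by blast
  then have "r \<in> verts K" by (simp add: verts_K)
  then obtain a where "1 \<le> a" "a \<le> k" "x a = r" by (rule lk.w_surj)
  then have "1 \<le> a \<and> a \<le> k \<and> closed_nbhd B (x a) = closed_nbhd B u" using r by simp
  then have "1 \<le> ix u \<and> ix u \<le> k \<and> closed_nbhd B (x (ix u)) = closed_nbhd B u"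
    unfolding ix_def by (rule someI)
  then show "1 \<le> ix u" "ix u \<le> k" "closed_nbhd B (x (ix u)) = closed_nbhd B u" by auto
qed

lemma x_unique:
  assumes "1 \<le> a" "a \<le> k" "1 \<le> b" "b \<le> k" "closed_nbhd B (x a) = closed_nbhd B (x b)"
  shows "a = b"
proof -
  have "x a = x b" using R_rep[OF x_B[of b]] x_R[of a] x_R[of b] assms by blast
  then show ?thesis using lk.w_inj assms by blast
qed

lemma ix_near:
  assumes "u \<in> verts B" "u' \<in> verts B"
  shows "u' \<in> closed_nbhd B u \<longleftrightarrow> ix u \<le> \<sigma> (ix u') \<and> ix u' \<le> \<sigma> (ix u)"
proof -
  note i = ix_props[OF assms(1)] and i' = ix_props[OF assms(2)]
  have "u' \<in> closed_nbhd B u \<longleftrightarrow> u' \<in> closed_nbhd B (x (ix u))" using i by simp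
  also have "\<dots> \<longleftrightarrow> x (ix u) \<in> closed_nbhd B u'"
    using closed_nbhd_sym[OF x_B[OF i(1,2)], of u'] closed_nbhd_sym[OF assms(2), of "x (ix u)"] by blast
  also have "\<dots> \<longleftrightarrow> x (ix u) \<in> closed_nbhd B (x (ix u'))" using i' by simp
  also have "\<dots> \<longleftrightarrow> ix u \<le> \<sigma> (ix u') \<and> ix u' \<le> \<sigma> (ix u)"
    using near_K[OF i'(1,2) i(1,2)] by auto
  finally show ?thesis .
qed

lemma end_class:
  assumes e: "1 \<le> e" "e \<le> k"
    and simplicial: "\<And>a b. \<lbrakk>1 \<le> a; a \<le> k; 1 \<le> b; b \<le> k; e \<le> \<sigma> a; a \<le> \<sigma> e; e \<le> \<sigma> b; b \<le> \<sigma> e\<rbrakk> \<Longrightarrow> b \<le> \<sigma> a"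
    and convex: "\<And>a b c. \<lbrakk>1 \<le> a; a \<le> b; b \<le> c; c \<le> k; \<not> (e \<le> \<sigma> a \<and> a \<le> \<sigma> e); \<not> (e \<le> \<sigma> c \<and> c \<le> \<sigma> e)\<rbrakk>
      \<Longrightarrow> \<not> (e \<le> \<sigma> b \<and> b \<le> \<sigma> e)"
  shows "closed_nbhd B (x e) = closed_nbhd B (v p) \<or> closed_nbhd B (x e) = closed_nbhd B (v q)"
proof -
  obtain a where a: "p \<le> a" "a \<le> q" "x e = v a" using block_vertex[OF x_B[OF e]] by blast
  have va: "v a \<in> verts B" using a by (auto simp: verts_arc)
  have ixa: "ix (v a) = e"
    using x_unique[OF ix_props(1,2)[OF va] e] ix_props(3)[OF va] a by simp
  \<comment> \<open>The neighbourhood of \<open>v a\<close> inside the block is the image of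
    \<open>{lo..hi}\<close>. Simpliciality makes its two extremes adjacent or equal.\<close>
  define lo hi where "lo = max p (bwd a)" and "hi = min q (fwd a)"
  have lohi: "p \<le> lo" "lo \<le> a" "a \<le> hi" "hi \<le> q" "a \<le> fwd lo" "hi \<le> fwd a"
    using a l_lt[of a] fwd_gt[of a] gal[of a lo] by (auto simp: lo_def hi_def)
  have vl: "v lo \<in> verts B" "v hi \<in> verts B" using lohi a by (auto simp: verts_arc)
  have "v lo \<in> closed_nbhd B (v a)" "v hi \<in> closed_nbhd B (v a)"
    using near_block[of a lo] near_block[of a hi] lohi a fwd_gt[of a] fwd_gt[of hi] by auto
  then have "ix (v hi) \<le> \<sigma> (ix (v lo))" "ix (v lo) \<le> \<sigma> (ix (v hi))"
    using ix_near[OF va vl(1)] ix_near[OF va vl(2)] ixa ix_props(1,2)[OF vl(1)] ix_props(1,2)[OF vl(2)]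
    by (auto intro: simplicial)
  then have "v hi \<in> closed_nbhd B (v lo)" using ix_near[OF vl] by simp
  then have hl: "hi \<le> fwd lo" using near_block[of lo hi] lohi a by simp
  \<comment> \<open>If this neighbourhood contains an end of the block, \<open>v a\<close> is a twin
    of that end. Otherwise non-neighbours lie on both sides of it, and \<open>convex\<close>
    fails.\<close>
  consider "lo = p" | "lo \<noteq> p" "hi = q" | "lo \<noteq> p" "hi \<noteq> q" by blast
  then show ?thesis
  proof cases
    case 1
    then have "fwd a = fwd p" using hl incomplete fwd_mono[of p a] a by (auto simp: hi_def)
    have "closed_nbhd B (v a) = closed_nbhd B (v p)"
    proof (rule nbhd_eqI)
      fix z assume z: "p \<le> z" "z \<le> q"
      have "a \<le> fwd z" using 1 lohi fwd_mono[of p z] z by simp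
      then show "z \<le> fwd a \<and> a \<le> fwd z \<longleftrightarrow> z \<le> fwd p \<and> p \<le> fwd z"
        using \<open>fwd a = fwd p\<close> fwd_gt[of z] z by auto
    qed (use a pq in auto)
    then show ?thesis using a by simp
  next
    case 2
    then have lb: "lo = bwd a" by (simp add: lo_def max_def split: if_splits)
    have "bwd q \<le> bwd a" using hl 2 lb gal[of q "bwd a"] by simp
    then have bq: "bwd a = bwd q" using l_mono[of a q] a by simp
    have qa: "q \<le> fwd a" using 2 lohi by simp
    have "closed_nbhd B (v a) = closed_nbhd B (v q)"
    proof (rule nbhd_eqI)
      fix z assume z: "p \<le> z" "z \<le> q"
      then show "z \<le> fwd a \<and> a \<le> fwd z \<longleftrightarrow> z \<le> fwd q \<and> q \<le> fwd z"
        using qa fwd_gt[of q] gal[of a z] gal[of q z] bq by auto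
    qed (use a pq in auto)
    then show ?thesis using a by simp
  next
    case 3
    then have lb: "lo = bwd a" "p < bwd a" and hb: "hi = fwd a" "fwd a < q"
      using lohi by (auto simp: lo_def hi_def max_def min_def split: if_splits)
    define ps where "ps c = (SOME y. p \<le> y \<and> y \<le> q \<and> x c = v y)" for c
    have ps: "p \<le> ps c" "ps c \<le> q" "x c = v (ps c)" if "1 \<le> c" "c \<le> k" for c
    proof -
      have "\<exists>y. p \<le> y \<and> y \<le> q \<and> x c = v y" using block_vertex[OF x_B[OF that]] by metis
      then have "p \<le> ps c \<and> ps c \<le> q \<and> x c = v (ps c)" unfolding ps_def by (rule someI_ex)
      then show "p \<le> ps c" "ps c \<le> q" "x c = v (ps c)" by auto
    qed
    have far: "\<not> (e \<le> \<sigma> c \<and> c \<le> \<sigma> e) \<longleftrightarrow> ps c < bwd a \<or> fwd a < ps c" if "1 \<le> c" "c \<le> k" for c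
    proof -
      have "e \<le> \<sigma> c \<and> c \<le> \<sigma> e \<longleftrightarrow> ps c \<le> fwd a \<and> a \<le> fwd (ps c)"
        using near_K[OF e that] near_block[OF a(1,2) ps(1,2)[OF that]] a(3) ps(3)[OF that] by auto
      then show ?thesis using gal[of a "ps c"] by auto
    qed
    \<comment> \<open>Consecutive members of the ordering are adjacent and \<open>convex\<close>
      keeps all of them outside the neighbourhood of \<open>v a\<close>. Vertices on opposite sides
      of it are never adjacent, so the side cannot change along the way.\<close>
    have walk: "ps c < bwd a \<longleftrightarrow> ps b < bwd a"
      if b: "1 \<le> b" "b \<le> c" "c \<le> k" and f: "\<not> (e \<le> \<sigma> b \<and> b \<le> \<sigma> e)" "\<not> (e \<le> \<sigma> c \<and> c \<le> \<sigma> e)" for b c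
      using b(2,3) f(2)
    proof (induction c rule: dec_induct)
      case (step c)
      have c: "1 \<le> c" "c < k" using step b by auto
      have fc: "\<not> (e \<le> \<sigma> c \<and> c \<le> \<sigma> e)"
        by (rule convex[of b c "Suc c"]) (use b step f in auto)
      have "c + 1 \<le> \<sigma> c" by (rule lk.consecutive_adjacent[OF con_K c])
      moreover have "c \<le> \<sigma> (c + 1)" using lk.\<rho>_ge[of "c + 1"] c by simp
      ultimately have "x (c + 1) \<in> closed_nbhd B (x c)" using near_K[of c "c + 1"] c by simp
      then have nr: "ps (c + 1) \<le> fwd (ps c)" "ps c \<le> fwd (ps (c + 1))"
        using near_block[of "ps c" "ps (c + 1)"] ps[of c] ps[of "c + 1"] c by auto
      have s: "ps c < bwd a \<or> fwd a < ps c" using far[of c] fc c by simp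
      have s1: "ps (c + 1) < bwd a \<or> fwd a < ps (c + 1)" using far[of "c + 1"] step.prems c by simp
      have lowr: "fwd y < a" if "y < bwd a" for y using gal[of a y] that by linarith
      have "ps (c + 1) < bwd a \<longleftrightarrow> ps c < bwd a"
        using s s1 nr lowr[of "ps c"] lowr[of "ps (c + 1)"] fwd_gt[of a] l_lt[of a] by linarith
      then show ?case using step fc c by simp
    qed simp
    let ?l = "bwd a - 1" and ?h = "fwd a + 1"
    have v1: "v ?l \<in> verts B" "v ?h \<in> verts B" using lb hb a l_lt[of a] fwd_gt[of a] by (auto simp: verts_arc)
    let ?i = "ix (v ?l)" and ?j = "ix (v ?h)"
    note ii = ix_props[OF v1(1)] and jj = ix_props[OF v1(2)]
    have lf: "fwd ?l < a" using gal[of a ?l] by linarith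
    have farl: "\<not> (e \<le> \<sigma> ?i \<and> ?i \<le> \<sigma> e)"
      using ix_near[OF va v1(1)] ixa near_block[of a ?l] lf lb a l_lt[of a] by auto
    have farh: "\<not> (e \<le> \<sigma> ?j \<and> ?j \<le> \<sigma> e)"
      using ix_near[OF va v1(2)] ixa near_block[of a ?h] hb a fwd_gt[of a] by auto
    have "v ?l \<in> closed_nbhd B (v ?l)" using v1 by (simp add: closed_nbhd_def)
    then have "v ?l \<in> closed_nbhd B (v (ps ?i))" using ii(3) ps(3)[OF ii(1,2)] by simp
    then have "ps ?i \<le> fwd ?l" using near_block[of "ps ?i" ?l] ps[OF ii(1,2)] lb a l_lt[of a] by auto
    then have si: "ps ?i < bwd a" using far[OF ii(1,2)] farl lf fwd_gt[of a] by auto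
    have "v ?h \<in> closed_nbhd B (v ?h)" using v1 by (simp add: closed_nbhd_def)
    then have "v ?h \<in> closed_nbhd B (v (ps ?j))" using jj(3) ps(3)[OF jj(1,2)] by simp
    then have "?h \<le> fwd (ps ?j)" using near_block[of "ps ?j" ?h] ps[OF jj(1,2)] hb a fwd_gt[of a] by auto
    then have "a < ps ?j" using fwd_mono[of "ps ?j" a] by (cases "a < ps ?j") auto
    then have sj: "\<not> ps ?j < bwd a" using l_lt[of a] by simp
    show ?thesis
      using walk[of ?i ?j] walk[of ?j ?i] si sj farl farh ii jj by (cases "?i \<le> ?j") auto
  qed
qed

text \<open>An induced path with two edges stays one in the reduction: its middle vertex is no twin
  of an end, as it sees the other end. The pseudo-cutvertices are represented by the two extreme
  positions, so \<open>rank_at_ends\<close> applies to them.\<close>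

lemma reduction_classes:
  assumes r2: "2 \<le> lk.rank k"
    and A: "\<And>i. 1 \<le> i \<Longrightarrow> i < lk.rank k \<Longrightarrow> \<sigma> (lk.T i) < \<sigma> (lk.T i + 1)"
    and A': "\<And>i. 2 \<le> i \<Longrightarrow> i < lk.rank k \<Longrightarrow> \<sigma> (\<sigma> (lk.T (i - 1))) \<le> lk.T i"
  shows "block_classes B (\<lambda>u. lk.rank (ix u))"
  unfolding block_classes_def
proof (intro conjI allI impI)
  fix a b c assume abc: "adj B a b" "adj B b c" "a \<noteq> c" "\<not> adj B a c"
  have V: "a \<in> verts B" "b \<in> verts B" "c \<in> verts B" using adj_verts[OF simple_block] abc by blast+
  have irr: "\<not> adj B u u" for u by (rule adj_irrefl[OF simple_block])
  have N: "u \<in> closed_nbhd B u' \<longleftrightarrow> u = u' \<or> adj B u u'" if "u \<in> verts B" for u u'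
    using that by (simp add: closed_nbhd_def)
  have ab: "a \<in> closed_nbhd B b" "b \<in> closed_nbhd B a" and bc: "b \<in> closed_nbhd B c" "c \<in> closed_nbhd B b"
    using N V abc adj_sym[of B a b] adj_sym[of B b c] by auto
  have ac: "a \<notin> closed_nbhd B c" "c \<notin> closed_nbhd B a" using N V abc adj_sym[of B a c] by auto
  have adjK: "adj K (x (ix u)) (x (ix u'))"
    if "u \<in> verts B" "u' \<in> verts B" "u' \<in> closed_nbhd B u" "closed_nbhd B u \<noteq> closed_nbhd B u'" for u u'
  proof -
    have "ix u \<noteq> ix u'" using ix_props(3)[OF that(1)] ix_props(3)[OF that(2)] that(4) by auto
    moreover have "ix u \<le> \<sigma> (ix u')" "ix u' \<le> \<sigma> (ix u)" using ix_near[OF that(1,2)] that(3) by auto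
    ultimately show ?thesis
      using lk.adj_w[of "ix u" "ix u'"] lk.adj_w[of "ix u'" "ix u"] ix_props(1,2)[OF that(1)]
        ix_props(1,2)[OF that(2)] adj_sym[of K "x (ix u)" "x (ix u')"]
      by (cases "ix u" "ix u'" rule: linorder_cases) auto
  qed
  show "lk.rank (ix a) = lk.rank (ix b) \<longleftrightarrow> lk.rank (ix b) \<noteq> lk.rank (ix c)"
  proof (rule lk.rank_alternates[OF A A'])
    show "adj K (x (ix a)) (x (ix b))" by (rule adjK) (use V ab bc ac in auto)
    show "adj K (x (ix b)) (x (ix c))" by (rule adjK) (use V ab bc ac in auto)
    show "\<not> adj K (x (ix a)) (x (ix c))"
    proof
      assume "adj K (x (ix a)) (x (ix c))"
      then have "x (ix c) \<in> closed_nbhd K (x (ix a))"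
        using adj_verts[OF lk.simple_H] adj_sym[of K "x (ix c)" "x (ix a)"] by (auto simp: closed_nbhd_def)
      then show False
        using lk.near_iff[OF ix_props(1,2)[OF V(1)] ix_props(1,2)[OF V(3)]] ix_near[OF V(1,3)] ac by simp
    qed
    show "x (ix a) \<noteq> x (ix c)"
    proof
      assume "x (ix a) = x (ix c)"
      then have "closed_nbhd B a = closed_nbhd B c"
        using ix_props(3)[OF V(1)] ix_props(3)[OF V(3)] by simp
      then show False using ac N[OF V(1), of a] by simp
    qed
  qed (use ix_props V in auto)
next
  fix u u' assume u: "pseudo_cutvertex G v u" and adj: "adj B u u'"
  have V: "u \<in> verts B" "u' \<in> verts B" using adj_verts[OF simple_block adj] by auto
  have k1: "1 \<le> k" using ix_props(1,2)[OF V(1)] by simp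
  have vpq: "v p \<in> verts B" "v q \<in> verts B" using pq by (auto simp: verts_arc)
  have "1 \<noteq> k"
  proof
    assume "1 = k"
    then have "lk.rank k = 1" using lk.rank_greedy[of k 1] lk.T_Suc[of 0] lk.\<rho>_ge[of 1] by simp
    then show False using r2 by simp
  qed
  then have ne: "closed_nbhd B (x 1) \<noteq> closed_nbhd B (x k)" using x_unique[of 1 k] k1 by auto
  have e1: "closed_nbhd B (x 1) = closed_nbhd B (v p) \<or> closed_nbhd B (x 1) = closed_nbhd B (v q)"
  proof (rule end_class)
    fix a b assume "1 \<le> a" "a \<le> k" "1 \<le> b" "b \<le> k" "b \<le> \<sigma> 1"
    then show "b \<le> \<sigma> a" using lk.\<rho>_mono[of 1 a] by simp
  next
    fix a b c assume abc: "1 \<le> a" "a \<le> b" "b \<le> c" "c \<le> k" "\<not> (1 \<le> \<sigma> a \<and> a \<le> \<sigma> 1)"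
    then have "\<sigma> 1 < a" using lk.\<rho>_ge[of a] by simp
    then show "\<not> (1 \<le> \<sigma> b \<and> b \<le> \<sigma> 1)" using abc by simp
  qed (use k1 in auto)
  have ek: "closed_nbhd B (x k) = closed_nbhd B (v p) \<or> closed_nbhd B (x k) = closed_nbhd B (v q)"
  proof (rule end_class)
    fix a b c assume abc: "1 \<le> a" "a \<le> b" "b \<le> c" "c \<le> k" "\<not> (k \<le> \<sigma> c \<and> c \<le> \<sigma> k)"
    then have "\<sigma> c < k" using lk.\<rho>_ge[of k] by simp
    then show "\<not> (k \<le> \<sigma> b \<and> b \<le> \<sigma> k)" using lk.\<rho>_mono[of b c] abc by simp
  qed (use k1 in auto)
  have "u = v p \<or> u = v q" using block_pseudo_ends[OF V(1)] u by simp
  then have "closed_nbhd B u = closed_nbhd B (x 1) \<or> closed_nbhd B u = closed_nbhd B (x k)"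
    using e1 ek ne by auto
  then have "ix u = 1 \<or> ix u = k"
    using x_unique[OF ix_props(1,2)[OF V(1)], of 1] x_unique[OF ix_props(1,2)[OF V(1)], of k] ix_props(3)[OF V(1)] k1
    by auto
  moreover have nr: "ix u \<le> \<sigma> (ix u')" "ix u' \<le> \<sigma> (ix u)"
    using ix_near[OF V] adj adj_sym[of B u u'] V by (auto simp: closed_nbhd_def)
  ultimately show "lk.rank (ix u) = lk.rank (ix u')"
    using lk.rank_at_ends[OF A A' r2 ix_props(1,2)[OF V(2)]] by auto
qed

end

lemma type_4_classes:
  assumes "weak_block_of_type_4 B"
  shows "\<exists>\<kappa>. block_classes B \<kappa>"
proof -
  obtain K where K: "reduction_of B K" "type_4 K" using assms unfolding weak_block_of_type_4_def by blast
  obtain R where R0: "R \<subseteq> verts B \<and> (\<forall>u\<in>verts B. \<exists>!r. r \<in> R \<and> closed_nbhd B r = closed_nbhd B u) \<and>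
      K = induced_subgraph B R"
    using K(1) unfolding reduction_of_def by (elim exE)
  note R = R0[THEN conjunct1] R0[THEN conjunct2, THEN conjunct1, THEN bspec]
    R0[THEN conjunct2, THEN conjunct2]
  have t4: "two_connected K" "2 \<le> clique_cover_number K" using K(2) by (simp_all add: type_4_def)
  obtain k x where t0: "straight_ordering K k x \<and>
    (\<forall>i\<in>{1..clique_cover_number K - 1}. t_index K k x i = s_index K k x (i + 1) - 1) \<and>
    (\<forall>i\<in>{2..clique_cover_number K - 1}.
       last_nbr K k x (s_index K k x i - 1) < first_nbr K k x (t_index K k x i + 1))"
    using K(2) unfolding type_4_def by (elim exE conjE) blast
  note t = t0[THEN conjunct1] t0[THEN conjunct2, THEN conjunct1] t0[THEN conjunct2, THEN conjunct2] t4
  have sK: "simple_graph K"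
    using simple_block unfolding simple_graph_def R(3) induced_subgraph_def by auto
  have line: "line_graph K k x (last_nbr K k x)" by (rule straight_line_graph[OF sK t(1)])
  interpret lk: line_graph K k x "last_nbr K k x" by (rule line)
  have r2: "2 \<le> lk.rank k" using t(5) lk.cover_number by simp
  have con: "connected_graph K" using t(4) by (simp add: two_connected_def)
  show ?thesis
    using reduction_classes[OF R(1,2,3) line con r2 lk.type_4_conditions[OF t(4) r2 t(2,3)]] by blast
qed

end
end

end

section \<open>Gluing the weak blocks, and the equivalence\<close>

context round_graph
begin

lemma weak_block_ends:
  assumes "weak_block G n v X"
  obtains i j where "i \<le> j" "j < i + N" "X = arc_subgraph G v i j" "pseudo i" "pseudo j"
    "\<And>u. i < u \<Longrightarrow> u < j \<Longrightarrow> \<not> pseudo u"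
proof -
  obtain i j where ij: "i \<le> j" "j < i + N" "X = arc_subgraph G v i j"
    "{x \<in> verts X. pseudo_cutvertex G v x} = {v i, v j}"
    using assms unfolding weak_block_def by blast
  have ps: "pseudo u \<longleftrightarrow> v u \<in> {v i, v j}" if "i \<le> u" "u \<le> j" for u
    using ij(4) pseudo_cutvertex_iff[of u] that by (auto simp: ij(3) verts_arc)
  show ?thesis
  proof (rule that[OF ij(1-3)])
    show "pseudo i" "pseudo j" using ps[of i] ps[of j] ij by auto
    fix u assume u: "i < u" "u < j"
    then show "\<not> pseudo u"
      using ps[of u] v_window[of i u i] v_window[of i u j] ij by auto
  qed
qed

lemma chain_blocks:
  assumes chain: "clique_chain fwd bwd S" and W: "weak_block G n v X"
  shows "complete_graph X \<or> weak_block_of_type_4 X"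
proof -
  obtain i j where ij: "i \<le> j" "j < i + N" "X = arc_subgraph G v i j" "pseudo i" "pseudo j"
    "\<And>u. i < u \<Longrightarrow> u < j \<Longrightarrow> \<not> pseudo u" using weak_block_ends[OF W] by blast
  show ?thesis
  \<comment> \<open>A single pseudo-cutvertex counts as a weak block, and it is complete.\<close>
  proof (cases "i = j")
    case True
    then have "verts X = {v i}" by (simp add: ij(3) verts_arc)
    then show ?thesis by (simp add: complete_graph_def clique_def)
  next
    case False
    then have lt: "i < j" using ij by simp
    show ?thesis
    proof (cases "j \<le> fwd i")
      case True
      then show ?thesis using complete_block[OF ij(4,5) lt ij(2,6)] ij(3) by blast
    next
      case False
      then have "fwd i < j" by simp
      then show ?thesis using weak_block_type_4[OF ij(4,5) lt ij(2,6) _ chain] ij(3) by blast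
    qed
  qed
qed

text \<open>\<open>prev x\<close> may be \<open>x\<close> itself, whereas \<open>succ x\<close> lies
  strictly later. A pseudo-cutvertex is thus assigned to the block that it starts.\<close>

definition prev :: "int \<Rightarrow> int" where "prev x = Max {u. pseudo u \<and> x - N < u \<and> u \<le> x}"
definition succ :: "int \<Rightarrow> int" where "succ x = Min {u. pseudo u \<and> x < u \<and> u \<le> x + N}"

context
  fixes p0 assumes p0: "pseudo p0"
begin

lemma prev_props: "pseudo (prev x)" "prev x \<le> x" "\<And>u. pseudo u \<Longrightarrow> u \<le> x \<Longrightarrow> u \<le> prev x"
proof -
  let ?A = "{u. pseudo u \<and> x - N < u \<and> u \<le> x}"
  have fin: "finite ?A" by (rule finite_subset[of _ "{x-N..x}"]) auto
  obtain q where "pseudo q" "x - N + 1 \<le> q" "q < x - N + 1 + N" using pseudo_shift[OF p0] by blast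
  then have "q \<in> ?A" by simp
  then have ne: "?A \<noteq> {}" by blast
  have "prev x \<in> ?A" unfolding prev_def by (rule Max_in[OF fin ne])
  then show P: "pseudo (prev x)" "prev x \<le> x" by auto
  show "u \<le> prev x" if "pseudo u" "u \<le> x" for u
  proof (cases "x - N < u")
    case True
    then show ?thesis unfolding prev_def using Max_ge[OF fin, of u] that by simp
  next
    case False
    then show ?thesis using \<open>prev x \<in> ?A\<close> by simp
  qed
qed

lemma succ_props: "pseudo (succ x)" "x < succ x" "\<And>u. pseudo u \<Longrightarrow> x < u \<Longrightarrow> succ x \<le> u"
proof -
  let ?A = "{u. pseudo u \<and> x < u \<and> u \<le> x + N}"
  have fin: "finite ?A" by (rule finite_subset[of _ "{x..x+N}"]) auto
  obtain q where "pseudo q" "x + 1 \<le> q" "q < x + 1 + N" using pseudo_shift[OF p0] by blast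
  then have "q \<in> ?A" by simp
  then have ne: "?A \<noteq> {}" by blast
  have "succ x \<in> ?A" unfolding succ_def by (rule Min_in[OF fin ne])
  then show P: "pseudo (succ x)" "x < succ x" by auto
  show "succ x \<le> u" if "pseudo u" "x < u" for u
  proof (cases "u \<le> x + N")
    case True
    then show ?thesis unfolding succ_def using Min_le[OF fin, of u] that by simp
  next
    case False
    then show ?thesis using \<open>succ x \<in> ?A\<close> by simp
  qed
qed

lemma prev_per: "prev (x + N) = prev x + N" and succ_per: "succ (x + N) = succ x + N"
proof -
  have pm: "pseudo (u - N) = pseudo u" for u using pseudo_per[of "u - N"] by simp
  show "prev (x + N) = prev x + N"
  proof (rule order_antisym)
    have "prev (x + N) - N \<le> prev x"
      by (rule prev_props(3)) (use prev_props(1,2)[of "x + N"] pm in auto)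
    then show "prev (x + N) \<le> prev x + N" by simp
    show "prev x + N \<le> prev (x + N)"
      by (rule prev_props(3)) (use prev_props(1,2)[of x] pseudo_per in auto)
  qed
  show "succ (x + N) = succ x + N"
  proof (rule order_antisym)
    show "succ (x + N) \<le> succ x + N"
      by (rule succ_props(3)) (use succ_props(1,2)[of x] pseudo_per in auto)
    have "succ x \<le> succ (x + N) - N"
      by (rule succ_props(3)) (use succ_props(1,2)[of "x + N"] pm in auto)
    then show "succ x + N \<le> succ (x + N)" by simp
  qed
qed

lemma glue_blocks:
  assumes even: "even (card {i \<in> {1..N}. pseudo i})"
    and blocks: "\<And>X. weak_block G n v X \<Longrightarrow> complete_graph X \<or> weak_block_of_type_4 X"
  shows "locally_complete_2_edge_colourable G"
proof -
  obtain par where par: "\<And>i. par i \<longleftrightarrow> par (i - 1) \<noteq> pseudo i" "\<And>i. par (i + N) = par i"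
    using periodic_parity[OF n_pos pseudo_per even] by blast
  define bl where "bl x = arc_subgraph G v (prev x) (succ x)" for x
  \<comment> \<open>The choice depends on the block and not on \<open>x\<close>, so it is periodic
    and the same for all \<open>x\<close> of one block.\<close>
  define kap where "kap x = (SOME \<kappa>. block_classes (bl x) \<kappa>)" for x
  have bl_per: "bl (x + N) = bl x" for x
    unfolding bl_def prev_per succ_per by (rule arc_shift)
  have none: "\<not> pseudo u" if "prev x < u" "u < succ x" for u x
    using prev_props(3)[of u x] succ_props(3)[of u x] that by force
  \<comment> \<open>Evenness excludes a single pseudo-cutvertex per turn, for which the block would
    run all the way around.\<close>
  have len: "succ x < prev x + N" for x
  proof (rule ccontr)
    assume "\<not> succ x < prev x + N"
    then have "{u. pseudo u \<and> prev x \<le> u \<and> u < prev x + N} = {prev x}"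
      using none[of x] prev_props(1)[of x] n_pos by force
    then have "card {u. pseudo u \<and> prev x \<le> u \<and> u < prev x + N} = 1" by simp
    then show False using even card_pseudo_window[of "prev x"] by simp
  qed
  have ps: "prev x < succ x" for x using prev_props(2)[of x] succ_props(2)[of x] by simp
  have kap: "block_classes (bl x) (kap x)" for x
  proof -
    note block = prev_props(1)[of x] succ_props(1)[of x] ps[of x] len[of x] none[of x]
    have "weak_block G n v (bl x)" unfolding bl_def by (rule block_is_weak[OF block])
    then have "complete_graph (bl x) \<or> weak_block_of_type_4 (bl x)" by (rule blocks)
    then have "\<exists>\<kappa>. block_classes (bl x) \<kappa>"
    proof
      assume "complete_graph (bl x)"
      then show ?thesis using complete_classes[OF block] unfolding bl_def by blast
    next
      assume t: "weak_block_of_type_4 (bl x)"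
      show ?thesis
      proof (cases "fwd (prev x) < succ x")
        case True
        then show ?thesis using type_4_classes[OF block True] t unfolding bl_def by blast
      next
        case False
        then have "complete_graph (bl x)" using complete_block[OF block] unfolding bl_def by simp
        then show ?thesis using complete_classes[OF block] unfolding bl_def by blast
      qed
    qed
    then show ?thesis unfolding kap_def by (rule someI_ex)
  qed
  have adj: "adj (bl x) (v a) (v b) \<longleftrightarrow> b \<le> fwd a" if "prev x \<le> a" "a < b" "b \<le> succ x" for x a b
    unfolding bl_def by (rule adj_block) (use prev_props(1) succ_props(1) ps len none that in auto)
  have simp_bl: "simple_graph (bl x)" for x
    unfolding bl_def by (rule simple_block) (use prev_props(1) succ_props(1) ps len none in auto)
  define e where "e x y \<longleftrightarrow> (kap x (v x) = kap x (v y)) \<noteq> par x" for x y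
  show ?thesis
  proof (rule colourable_if_alternating[of e])
    fix x y
    have "kap (x + N) = kap x" unfolding kap_def bl_per by (rule refl)
    then show "e (x + N) (y + N) = e x y" by (simp add: e_def v_per par(2))
  next
    fix x y z assume xyz: "x < y" "y \<le> fwd x" "fwd x < z" "z \<le> fwd y"
    have ys: "y \<le> succ x"
      using pseudo_r_le[OF succ_props(1)[of x] succ_props(2)[of x]] xyz by simp
    have axy: "adj (bl x) (v x) (v y)" using adj[of x x y] prev_props(2)[of x] xyz ys by simp
    have zs: "z \<le> succ y"
      using pseudo_r_le[OF succ_props(1)[of y] succ_props(2)[of y]] xyz by simp
    have ayz: "adj (bl y) (v y) (v z)" using adj[of y y z] prev_props(2)[of y] xyz zs by simp
    have np: "\<not> pseudo u" if "x < u" "u < y" for u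
      using none[of x u] that ys prev_props(2)[of x] by simp
    have par1: "par (y - 1) = par x"
    proof -
      have "par (x + int k) = par x" if "x + int k < y" for k
        using that
      proof (induction k)
        case (Suc k)
        then show ?case using par(1)[of "x + int (Suc k)"] np[of "x + int (Suc k)"] by (simp add: algebra_simps)
      qed simp
      from this[of "nat (y - 1 - x)"] show ?thesis using xyz by simp
    qed
    show "e x y \<noteq> e y z"
    \<comment> \<open>At a pseudo-cutvertex both edges stay inside a class of their own block, and
      the swap of \<open>par\<close> separates their colours. Elsewhere both edges lie in the same
      block, whose classes do it.\<close>
    proof (cases "pseudo y")
      case True
      have "kap x (v y) = kap x (v x)"
        using kap[of x] axy adj_sym[of "bl x" "v x" "v y"] True pseudo_cutvertex_iff[of y]
        unfolding block_classes_def by blast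
      moreover have "kap y (v y) = kap y (v z)"
        using kap[of y] ayz True pseudo_cutvertex_iff[of y] unfolding block_classes_def by blast
      ultimately show ?thesis using par(1)[of y] par1 True by (simp add: e_def)
    next
      case False
      have np': "\<not> pseudo u" if "x < u" "u \<le> y" for u using np[of u] False that by (cases "u = y") auto
      have "prev y = prev x"
      proof (rule order_antisym)
        show "prev y \<le> prev x"
          using prev_props(3)[OF prev_props(1)[of y], of x] np'[of "prev y"] prev_props(1,2)[of y] by force
        show "prev x \<le> prev y"
          using prev_props(3)[OF prev_props(1)[of x], of y] prev_props(2)[of x] xyz by simp
      qed
      moreover have "succ y = succ x"
      proof (rule order_antisym)
        have "y < succ x" using ys False succ_props(1)[of x] by (cases "y = succ x") auto
        then show "succ y \<le> succ x" using succ_props(3)[OF succ_props(1)[of x]] by blast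
        show "succ x \<le> succ y"
          using succ_props(3)[OF succ_props(1)[of y], of x] succ_props(2)[of y] xyz by simp
      qed
      ultimately have bl: "bl y = bl x" by (simp add: bl_def)
      have k: "kap y = kap x" unfolding kap_def bl by (rule refl)
      have zx: "z \<le> succ x" using zs \<open>succ y = succ x\<close> by simp
      have nadj: "\<not> adj (bl x) (v x) (v z)" using adj[of x x z] prev_props(2)[of x] xyz zx by simp
      have ne: "v x \<noteq> v z" using v_neq[of x z] xyz zx len[of x] prev_props(2)[of x] by simp
      have "kap x (v x) = kap x (v y) \<longleftrightarrow> kap x (v y) \<noteq> kap x (v z)"
        using kap[of x] axy ayz nadj ne unfolding bl block_classes_def by blast
      then show ?thesis using par(1)[of y] par1 False k by (auto simp: e_def)
    qed
  qed
qed

end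

lemma chain_if_no_obstruction:
  assumes np: "\<And>i. \<not> pseudo i" and ah: "\<And>j g. \<not> odd_antihole G j g"
    and F: "\<not> contains_induced G F1" "\<not> contains_induced G F2" "\<not> contains_induced G F3"
  shows "clique_chain fwd bwd {s. start s}"
proof -
  have good: "good_reach fwd bwd" by (rule pseudo_free_good[OF assms])
  then obtain s where "type2 s" using good_reach.type2_exists np by blast
  then have "start s" by (simp add: start_def)
  then show ?thesis by (rule good_clique_chain[OF good])
qed

lemma colourable_iff:
  "locally_complete_2_edge_colourable G \<longleftrightarrow>
      perfect_graph G \<and>
      (\<not> contains_induced G F1 \<and> \<not> contains_induced G F2 \<and> \<not> contains_induced G F3) \<and>
      even (card {x \<in> verts G. pseudo_cutvertex G v x}) \<and>
      (\<forall>B. weak_block G n v B \<longrightarrow> complete_graph B \<or> weak_block_of_type_4 B)"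
    (is "?L \<longleftrightarrow> ?R")
proof
  assume L: ?L
  then obtain c where c: "locally_complete_colouring G c"
    unfolding locally_complete_2_edge_colourable_def by blast
  have F: "\<not> contains_induced G F1" "\<not> contains_induced G F2" "\<not> contains_induced G F3"
    using F_not_colourable[OF simple L] by auto
  have ev: "even (card {i \<in> {1..N}. pseudo i})" by (rule even_pseudo_if_coloured[OF c])
  have chain: "clique_chain fwd bwd {s. start s}"
  proof (cases "\<exists>p. pseudo p")
    case True
    then obtain p where p: "pseudo p" by blast
    interpret coloured_reach fwd bwd "C c" by (rule coloured_if_pseudo[OF c p])
    show ?thesis by (rule good_clique_chain[OF good_reach_axioms, of p]) (simp add: start_def p)
  next
    case False
    then show ?thesis
      using chain_if_no_obstruction[OF _ _ F] odd_antihole_not_colourable[OF simple c] by blast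
  qed
  have "perfect_graph G" by (rule chain_perfect[OF chain _ ev]) (simp add: start_per)
  then show ?R using F ev chain_blocks[OF chain] card_pseudo by simp
next
  assume R: ?R
  then have F: "\<not> contains_induced G F1" "\<not> contains_induced G F2" "\<not> contains_induced G F3"
    and ev: "even (card {i \<in> {1..N}. pseudo i})" by (simp_all add: card_pseudo)
  show ?L
  proof (cases "\<exists>p. pseudo p")
    case True
    then show ?thesis using glue_blocks[OF _ ev] R by blast
  next
    case False
    have "clique_chain fwd bwd {s. start s}"
      by (rule chain_if_no_obstruction) (use False F R odd_antihole_not_perfect[OF simple] in auto)
    then show ?thesis by (rule chain_colourable[OF _ _ ev]) (simp add: start_per)
  qed
qed

end

theorem theorem26:
  fixes G :: "'a graph" and n :: nat and v :: "int \<Rightarrow> 'a"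
  assumes "simple_graph G"
    and "reduced G"
    and "proper_circular_arc_graph G"
    and "\<not> proper_interval_graph G"
    and "clique_cover_number G \<ge> 3"
    and "round_ordering G n v"
  shows "locally_complete_2_edge_colourable G \<longleftrightarrow>
      perfect_graph G \<and>
      (\<not> contains_induced G F1 \<and> \<not> contains_induced G F2 \<and> \<not> contains_induced G F3) \<and>
      even (card {x \<in> verts G. pseudo_cutvertex G v x}) \<and>
      (\<forall>B. weak_block G n v B \<longrightarrow> complete_graph B \<or> weak_block_of_type_4 B)"
proof -
  interpret round_graph G n v by unfold_locales (use assms in auto)
  show ?thesis by (rule colourable_iff)
qed

end
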